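(* Let $(\alpha,\nu)$ be critical data and let $M$ be a fixed, finite, positive constant. (i) If, for some $\varepsilon>0$, $\langle\chi^{2+\varepsilon},\nu\rangle<\infty$, then there exist a finite, positive constant $C_\rho$ and a finite, positive time $T_\rho$ such that $$\sup_{\xi\in\mathcal{B}_\rho^{M,\varepsilon}}\rho\big(\bar\mu_\xi(t),\beta_e\langle\chi,\xi\rangle\nu_e\big)\le C_\rho\,t^{-\varepsilon/4}\qquad\text{for all }t\ge T_\rho .$$ (ii) If, for some $\varepsilon>0$, $\langle\chi^{3+\varepsilon},\nu\rangle<\infty$, then there exist a finite, positive constant $C_{TV}$ and a finite, positive time $T_{TV}$ such that $$\sup_{\xi\in\mathcal{B}_{TV}^{M,\varepsilon}}\big\|\bar\mu_\xi(t)-\beta_e\langle\chi,\xi\rangle\nu_e\big\|_{TV}\le C_{TV}\,t^{-\varepsilon}\qquad\text{for all }t\ge T_{TV}.$$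
   Context: $\mathbb{R}_+=[0,\infty)$. $\mathcal{M}_F$ is the space of finite nonnegative Borel measures on $\mathbb{R}_+$ with the topology of weak convergence; $\langle g,\zeta\rangle=\int_{\mathbb{R}_+}g\,d\zeta$; $\mathbb{1}_A$ is the indicator of $A$, $\mathbb{1}=\mathbb{1}_{\mathbb{R}_+}$, and $\chi(x)=x$. $\mathcal{M}_F^c$ is the set of $\xi\in\mathcal{M}_F$ with $\langle\mathbb{1}_{\{x\}},\xi\rangle=0$ for all $x\in\mathbb{R}_+$ (no atoms). For $\zeta_1,\zeta_2\in\mathcal{M}_F$, $\rho(\zeta_1,\zeta_2)=\inf\{\delta>0:\langle\mathbb{1}_B,\zeta_1\rangle\le\langle\mathbb{1}_{B^\delta},\zeta_2\rangle+\delta\text{ and }\langle\mathbb{1}_B,\zeta_2\rangle\le\langle\mathbb{1}_{B^\delta},\zeta_1\rangle+\delta\text{ for all nonempty closed }B\subset\mathbb{R}_+\}$, where $B^\delta=\{x\in\mathbb{R}_+:\inf_{y\in B}|x-y|<\delta\}$. For a signed Borel measure $\zeta$ on $\mathbb{R}_+$, $\|\zeta\|_{TV}=\sup\{|\langle g,\zeta\rangle|: g:\mathbb{R}_+\to\mathbb{R}\text{ Borel measurable},\ |g(x)|\le1\text{ for all }x\in\mathbb{R}_+\}$. For $M,\varepsilon\in(0,\infty)$: $\mathcal{B}_\rho^{M,\varepsilon}=\{\xi\in\mathcal{M}_F^c:\langle\mathbb{1},\xi\rangle\vee\langle\chi,\xi\rangle\vee\langle\chi^{1+\varepsilon},\xi\rangle\le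 M\}$ and $\mathcal{B}_{TV}^{M,\varepsilon}=\{\xi\in\mathcal{M}_F^c:\langle\mathbb{1},\xi\rangle\vee\langle\chi,\xi\rangle\vee\langle\chi^2,\xi\rangle\vee\langle\chi^{2+\varepsilon},\xi\rangle\le M\}$. Critical data $(\alpha,\nu)$: $\nu$ is a Borel probability measure on $\mathbb{R}_+$ with $\nu(\{0\})=0$ and $\langle\chi,\nu\rangle<\infty$, and $\alpha=1/\langle\chi,\nu\rangle$. $F$ is the cumulative distribution function of $\nu$. The excess lifetime probability measure $\nu_e$ is the Borel probability measure on $\mathbb{R}_+$ with density $f_e(x)=\alpha(1-F(x))$. Set $\beta_e=1/\langle\chi,\nu_e\rangle$ (interpreted as $0$ if $\langle\chi,\nu_e\rangle=\infty$). Let $\mathcal{C}=\{g\in \mathbf{C}_b^1(\mathbb{R}_+): g(0)=0,\ g'(0)=0\}$, where $\mathbf{C}^1_b(\mathbb{R}_+)$ is the set of once continuously differentiable real functions on $\mathbb{R}_+$ that are bounded together with their first derivatives. A fluid model solution (for $(\alpha,\nu)$) is a function $\bar\mu:[0,\infty)\to\mathcal{M}_F$ such that: (C1) $\bar\mu(\cdot)$ is continuous; (C2) $\langle\mathbb{1}_{\{0\}},\bar\mu(t)\rangle=0$ for each $t\ge0$; (C3) for each $g\in\mathcal{C}$, $\langle g,\bar\mu(t)\rangle=\langle g,\bar\mu(0)\rangle-\int_0^t\frac{\langle g',\bar\mu(s)\rangle}{\langle\mathbb{1},\bar\mu(s)\rangle}\,ds+\alpha t\langle g,\nu\rangle$ for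 all $0\le t<t^*$, where $t^*=\inf\{s\ge0:\langle\mathbb{1},\bar\mu(s)\rangle=0\}$; (C4) $\langle\mathbb{1},\bar\mu(t)\rangle=0$ for all $t\ge t^*$. It is known (from earlier work) that for each $\xi\in\mathcal{M}_F^c$ there is a unique fluid model solution $\bar\mu_\xi(\cdot)$ with $\bar\mu_\xi(0)=\xi$; also $\bar\mu_\xi(t)\in\mathcal{M}_F^c$ for all $t$, $\bar\mu_\xi(t)\ne\mathbf{0}$ for all $t$ (so $t^*=\infty$) if $\xi\neq\mathbf{0}$, and $\bar\mu_{\mathbf{0}}(\cdot)\equiv\mathbf{0}$, where $\mathbf{0}$ is the zero measure. *)

theory Defs
  imports "HOL-Probability.Probability"
begin

abbreviation borel_Rplus :: "real measure" where
  "borel_Rplus \<equiv> restrict_space borel {0..}"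

text \<open>
  Measures on the half-line live on the space \<open>{0..}\<close> itself. A real function on the half-line is
  a HOL function of type \<open>real \<Rightarrow> real\<close> whose values at negative arguments are never used.
\<close>

definition M_F :: "real measure set" where
  "M_F = {\<xi>. finite_measure \<xi> \<and> sets \<xi> = sets borel_Rplus}"

definition M_F_c :: "real measure set" where
  "M_F_c = {\<xi> \<in> M_F. \<forall>x\<ge>0. measure \<xi> {x} = 0}"

text \<open>
  The Bochner integral is \<open>0\<close> for non-integrable functions, so for nonnegative functions whose
  integral may be infinite the extended version \<open>epairing\<close> is used.
\<close>

definition pairing :: "(real \<Rightarrow> real) \<Rightarrow> real measure \<Rightarrow> real" where
  "pairing g \<zeta> = (LINT x|\<zeta>. g x)"

definition epairing :: "(real \<Rightarrow> real) \<Rightarrow> real measure \<Rightarrow> ennreal" where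
  "epairing g \<zeta> = (\<integral>\<^sup>+ x. ennreal (g x) \<partial>\<zeta>)"

definition bdd_cont :: "(real \<Rightarrow> real) \<Rightarrow> bool" where
  "bdd_cont f \<longleftrightarrow> continuous_on {0..} f \<and> bounded (f ` {0..})"

definition weak_topology :: "real measure topology" where
  "weak_topology =
     topology_generated_by {{\<xi> \<in> M_F. pairing f \<xi> \<in> U} | f U. bdd_cont f \<and> open U}"

lemma topspace_weak_topology: "topspace weak_topology = M_F"
proof -
  have "M_F = {\<xi> \<in> M_F. pairing (\<lambda>_. 0) \<xi> \<in> UNIV}" by simp
  moreover have "bdd_cont (\<lambda>_. 0)" by (simp add: bdd_cont_def image_constant_conv)
  ultimately have "M_F \<in> {{\<xi> \<in> M_F. pairing f \<xi> \<in> U} | f U. bdd_cont f \<and> open U}"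
    using open_UNIV by blast
  then show ?thesis
    unfolding weak_topology_def topology_generated_by_topspace by blast
qed

lemma continuous_map_weak_topology:
  "continuous_map (top_of_set S) weak_topology \<mu> \<longleftrightarrow>
     \<mu> ` S \<subseteq> M_F \<and> (\<forall>f. bdd_cont f \<longrightarrow> continuous_on S (\<lambda>t. pairing f (\<mu> t)))"
  (is "?L \<longleftrightarrow> ?R")
proof
  assume L: ?L
  then have im: "\<mu> ` S \<subseteq> M_F"
    using continuous_map_image_subset_topspace topspace_weak_topology by fastforce
  have "continuous_on S (\<lambda>t. pairing f (\<mu> t))" if f: "bdd_cont f" for f
    unfolding continuous_on_open_invariant
  proof safe
    fix U :: "real set" assume "open U"
    with f have "openin weak_topology {\<xi> \<in> M_F. pairing f \<xi> \<in> U}"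
      unfolding weak_topology_def by (intro topology_generated_by_Basis) blast
    with L have "openin (top_of_set S)
        {t \<in> topspace (top_of_set S). \<mu> t \<in> {\<xi> \<in> M_F. pairing f \<xi> \<in> U}}"
      by (rule openin_continuous_map_preimage)
    also have "{t \<in> topspace (top_of_set S). \<mu> t \<in> {\<xi> \<in> M_F. pairing f \<xi> \<in> U}}
        = (\<lambda>t. pairing f (\<mu> t)) -` U \<inter> S"
      using im by auto
    finally show "\<exists>A. open A \<and> A \<inter> S = (\<lambda>t. pairing f (\<mu> t)) -` U \<inter> S"
      by (auto simp: openin_open)
  qed
  with im show ?R by blast
next
  assume R: ?R
  show ?L unfolding weak_topology_def
  proof (rule continuous_on_generated_topo)
    fix V assume "V \<in> {{\<xi> \<in> M_F. pairing f \<xi> \<in> U} | f U. bdd_cont f \<and> open U}"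
    then obtain f U where V: "V = {\<xi> \<in> M_F. pairing f \<xi> \<in> U}" "bdd_cont f" "open U" by blast
    have "\<mu> -` V \<inter> topspace (top_of_set S) = S \<inter> (\<lambda>t. pairing f (\<mu> t)) -` U"
      using R V by auto
    moreover have "openin (top_of_set S) (S \<inter> (\<lambda>t. pairing f (\<mu> t)) -` U)"
      using R V continuous_openin_preimage_gen by blast
    ultimately show "openin (top_of_set S) (\<mu> -` V \<inter> topspace (top_of_set S))" by simp
  next
    show "\<mu> ` topspace (top_of_set S)
        \<subseteq> \<Union>{{\<xi> \<in> M_F. pairing f \<xi> \<in> U} | f U. bdd_cont f \<and> open U}"
      using R topspace_weak_topology
      unfolding weak_topology_def topology_generated_by_topspace by simp
  qed
qed

definition enlarge :: "real set \<Rightarrow> real \<Rightarrow> real set" where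
  "enlarge B \<delta> = {x \<in> {0..}. infdist x B < \<delta>}"

definition rho :: "real measure \<Rightarrow> real measure \<Rightarrow> real" where
  "rho \<zeta>1 \<zeta>2 = Inf {\<delta>. \<delta> > 0 \<and>
     (\<forall>B. closed B \<and> B \<noteq> {} \<and> B \<subseteq> {0..} \<longrightarrow>
        measure \<zeta>1 B \<le> measure \<zeta>2 (enlarge B \<delta>) + \<delta> \<and>
        measure \<zeta>2 B \<le> measure \<zeta>1 (enlarge B \<delta>) + \<delta>)}"

text \<open>
  The total variation norm of the signed measure \<open>\<zeta>1 - \<zeta>2\<close>, for finite \<open>\<zeta>1\<close> and \<open>\<zeta>2\<close>; the
  pairing of \<open>g\<close> with the difference is the difference of the pairings.
\<close>

definition tv_diff :: "real measure \<Rightarrow> real measure \<Rightarrow> real" where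
  "tv_diff \<zeta>1 \<zeta>2 =
     (SUP g \<in> {g \<in> borel_measurable borel_Rplus. \<forall>x\<ge>0. \<bar>g x\<bar> \<le> 1}.
        \<bar>pairing g \<zeta>1 - pairing g \<zeta>2\<bar>)"

definition B_rho :: "real \<Rightarrow> real \<Rightarrow> real measure set" where
  "B_rho M \<epsilon> = {\<xi> \<in> M_F_c.
     max (max (epairing (\<lambda>_. 1) \<xi>) (epairing (\<lambda>x. x) \<xi>)) (epairing (\<lambda>x. x powr (1 + \<epsilon>)) \<xi>)
       \<le> ennreal M}"

definition B_TV :: "real \<Rightarrow> real \<Rightarrow> real measure set" where
  "B_TV M \<epsilon> = {\<xi> \<in> M_F_c.
     max (max (max (epairing (\<lambda>_. 1) \<xi>) (epairing (\<lambda>x. x) \<xi>)) (epairing (\<lambda>x. x\<^sup>2) \<xi>))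
         (epairing (\<lambda>x. x powr (2 + \<epsilon>)) \<xi>)
       \<le> ennreal M}"

definition critical_data :: "real \<Rightarrow> real measure \<Rightarrow> bool" where
  "critical_data \<alpha> \<nu> \<longleftrightarrow>
     prob_space \<nu> \<and> sets \<nu> = sets borel_Rplus \<and> measure \<nu> {0} = 0 \<and>
     epairing (\<lambda>x. x) \<nu> < \<infinity> \<and> \<alpha> = 1 / pairing (\<lambda>x. x) \<nu>"

text \<open>
  The library's \<open>cdf\<close> is not usable here, because \<open>{..x}\<close> is not a subset of the space \<open>{0..}\<close>.
\<close>

definition excess_lifetime :: "real \<Rightarrow> real measure \<Rightarrow> real measure" where
  "excess_lifetime \<alpha> \<nu> =
     density (restrict_space lborel {0..}) (\<lambda>x. ennreal (\<alpha> * (1 - measure \<nu> {0..x})))"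

definition beta_e :: "real \<Rightarrow> real measure \<Rightarrow> real" where
  "beta_e \<alpha> \<nu> =
     (if epairing (\<lambda>x. x) (excess_lifetime \<alpha> \<nu>) = \<infinity> then 0
      else 1 / pairing (\<lambda>x. x) (excess_lifetime \<alpha> \<nu>))"

text \<open>
  \<open>test_pair g g'\<close>: \<open>g\<close> belongs to the class \<open>\<C>\<close> and \<open>g'\<close> is its derivative on the half-line,
  one-sided at \<open>0\<close>.
\<close>

definition test_pair :: "(real \<Rightarrow> real) \<Rightarrow> (real \<Rightarrow> real) \<Rightarrow> bool" where
  "test_pair g g' \<longleftrightarrow>
     (\<forall>x\<ge>0. (g has_real_derivative g' x) (at x within {0..})) \<and>
     bdd_cont g \<and> bdd_cont g' \<and> g 0 = 0 \<and> g' 0 = 0"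

text \<open>The infimum is taken in \<open>ereal\<close>, so that it is \<open>\<infinity>\<close> if the mass never vanishes.\<close>

definition t_star :: "(real \<Rightarrow> real measure) \<Rightarrow> ereal" where
  "t_star \<mu> = (INF s \<in> {s. 0 \<le> s \<and> pairing (\<lambda>_. 1) (\<mu> s) = 0}. ereal s)"

definition fluid_model_solution :: "real \<Rightarrow> real measure \<Rightarrow> (real \<Rightarrow> real measure) \<Rightarrow> bool" where
  "fluid_model_solution \<alpha> \<nu> \<mu> \<longleftrightarrow>
     (\<forall>t\<ge>0. \<mu> t \<in> M_F) \<and>
     continuous_map (top_of_set {0..}) weak_topology \<mu> \<and>
     (\<forall>t\<ge>0. measure (\<mu> t) {0} = 0) \<and>
     (\<forall>g g'. test_pair g g' \<longrightarrow> (\<forall>t\<ge>0. ereal t < t_star \<mu> \<longrightarrow>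
        pairing g (\<mu> t) = pairing g (\<mu> 0)
          - (LINT s:{0..t}|lborel. pairing g' (\<mu> s) / pairing (\<lambda>_. 1) (\<mu> s))
          + \<alpha> * t * pairing g \<nu>)) \<and>
     (\<forall>t\<ge>0. t_star \<mu> \<le> ereal t \<longrightarrow> pairing (\<lambda>_. 1) (\<mu> t) = 0)"

text \<open>
  For critical data and \<open>\<xi> \<in> M_F_c\<close> this set consists of a single solution, up to the irrelevant
  values at negative times.
\<close>

definition solutions_from :: "real \<Rightarrow> real measure \<Rightarrow> real measure \<Rightarrow> (real \<Rightarrow> real measure) set" where
  "solutions_from \<alpha> \<nu> \<xi> = {\<mu>. fluid_model_solution \<alpha> \<nu> \<mu> \<and> \<mu> 0 = \<xi>}"

definition limit_state :: "real \<Rightarrow> real measure \<Rightarrow> real measure \<Rightarrow> real measure" where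
  "limit_state \<alpha> \<nu> \<xi> =
     scale_measure (ennreal (beta_e \<alpha> \<nu> * pairing (\<lambda>x. x) \<xi>)) (excess_lifetime \<alpha> \<nu>)"

end

theory Submission
  imports Defs
begin

text \<open>
  Run the fluid model on the clock \<open>u = S t = \<integral>\<^sub>0\<^sup>t 1 / \<langle>1, \<mu> s\<rangle> ds\<close>, which measures the service received by
  each job. Write \<open>f\<close> for the density of the excess lifetime. The total mass \<open>Z\<close> then solves the
  renewal equation \<open>Z = H + f * Z\<close> with \<open>H(x) = \<xi>(x,\<infinity>)\<close>, and subtracting the constant
  \<open>\<beta> \<langle>\<chi>,\<xi>\<rangle>\<close> leaves a renewal equation \<open>d = g + f * d\<close> with \<open>\<integral> g = 0\<close>.

  Restarting this equation at time \<open>u\<close> gives a new free term \<open>g\<^sub>u\<close>, again of mean zero and with tail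
  \<open>\<integral>\<^sub>R\<^sup>\<infinity> \<bar>g\<^sub>u\<bar> = O(R\<^sup>-\<^sup>q)\<close> uniformly in \<open>u\<close>. The renewal density of \<open>f\<close> is bounded
  below by a positive constant, which yields a Doeblin-type contraction
  \<open>\<parallel>g\<^sub>u\<^sub>+\<^sub>R\<parallel> \<le> (1 - \<delta>) \<parallel>g\<^sub>u\<parallel> + 2 \<delta> \<integral>\<^sub>R\<^sub>/\<^sub>2\<^sup>\<infinity> \<bar>g\<^sub>u\<bar>\<close> in \<open>L\<^sup>1\<close>. Taking \<open>R\<close> proportional to \<open>u\<close> and iterating gives
  \<open>\<parallel>g\<^sub>u\<parallel> = O(u\<^sup>-\<^sup>q)\<close>.

  This bounds the total variation distance at rate \<open>t\<^sup>-\<^sup>q\<close>, where \<open>q = \<epsilon>\<close> in the first part and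
  \<open>q = 1 + \<epsilon>\<close> in the second.
\<close>

section \<open>Convolution of causal functions\<close>

text \<open>The density \<open>f = \<alpha> * survival \<nu>\<close> is bounded by
  \<open>\<alpha>\<close> and nonincreasing on the half-line. These two properties carry the renewal
  theory, which stays with locally bounded functions and pointwise estimates. Its central identity
  is \<open>conv k z = conv unit_step g\<close> for \<open>z = g + conv f z\<close>, with
  \<open>k\<close> the tail of \<open>f\<close>. It bounds the renewal density above, gives it mass
  on every long window, keeps the restarted free terms centred and computes the norm that contracts.
  The obstacle is that tails are controlled only polynomially: with a fixed step the error term
  would not decay, so the step has to grow with the elapsed time. Constants must moreover be uniform
  over the ball of initial states; they are therefore chosen from a single bound \<open>G\<close>
  before the functions \<open>g\<close> and \<open>d\<close>. Clock time becomes real time because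
  the total mass is bounded by some \<open>K\<close>, so that \<open>S t\<close> is at least
  \<open>t / K\<close>. The state itself is recovered from its total mass by an explicit formula,
  and its set-wise distance from the limit is at most \<open>conv f |d|\<close> plus two tail
  values.\<close>

definition causal :: "(real \<Rightarrow> real) \<Rightarrow> bool" where
  "causal g \<longleftrightarrow> g \<in> borel_measurable borel \<and> (\<forall>x<0. g x = 0) \<and> (\<forall>x. \<exists>B. \<forall>y\<le>x. \<bar>g y\<bar> \<le> B)"

text \<open>Integration over the whole line keeps substitutions and Fubini free of boundary terms;
  for causal arguments only \<open>0 \<le> y \<le> x\<close> contributes.\<close>

definition conv :: "(real \<Rightarrow> real) \<Rightarrow> (real \<Rightarrow> real) \<Rightarrow> real \<Rightarrow> real" where
  "conv f g x = (LINT y|lborel. f (x - y) * g y)"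

lemma causal_measurable: "causal g \<Longrightarrow> g \<in> borel_measurable borel"
  and causal_neg: "causal g \<Longrightarrow> x < 0 \<Longrightarrow> g x = 0"
  by (auto simp: causal_def)

lemma causal_bound:
  assumes "causal g" obtains B where "B \<ge> 0" "\<And>y. y \<le> x \<Longrightarrow> \<bar>g y\<bar> \<le> B"
proof -
  obtain B where "\<forall>y\<le>x. \<bar>g y\<bar> \<le> B" using assms unfolding causal_def by blast
  then show thesis using that[of "max B 0"] by (meson max.cobounded2 max.coboundedI1)
qed

lemma causalI:
  assumes "g \<in> borel_measurable borel" "\<And>x. x < 0 \<Longrightarrow> g x = 0" "\<And>x y. y \<le> x \<Longrightarrow> \<bar>g y\<bar> \<le> B x"
  shows "causal g"
  using assms unfolding causal_def by blast

lemma causal_add: "causal f \<Longrightarrow> causal g \<Longrightarrow> causal (\<lambda>x. f x + g x)"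
proof -
  assume fg: "causal f" "causal g"
  show ?thesis unfolding causal_def
  proof (intro conjI allI)
    show "(\<lambda>x. f x + g x) \<in> borel_measurable borel"
      using fg[THEN causal_measurable] by measurable
    show "\<exists>B. \<forall>y\<le>x. \<bar>f y + g y\<bar> \<le> B" for x
    proof -
      obtain A where A: "\<And>y. y \<le> x \<Longrightarrow> \<bar>f y\<bar> \<le> A" using causal_bound[OF fg(1)] by metis
      obtain B where B: "\<And>y. y \<le> x \<Longrightarrow> \<bar>g y\<bar> \<le> B" using causal_bound[OF fg(2)] by metis
      show ?thesis by (rule exI[of _ "A + B"]) (use A B abs_triangle_ineq add_mono order_trans in blast)
    qed
  qed (use fg in \<open>auto simp: causal_def\<close>)
qed

lemma causal_mult_left: "causal f \<Longrightarrow> causal (\<lambda>x. c * f x)"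
proof -
  assume f: "causal f"
  show ?thesis unfolding causal_def
  proof (intro conjI allI)
    show "(\<lambda>x. c * f x) \<in> borel_measurable borel"
      using f[THEN causal_measurable] by measurable
    show "\<exists>B. \<forall>y\<le>x. \<bar>c * f y\<bar> \<le> B" for x
    proof -
      obtain A where A: "\<And>y. y \<le> x \<Longrightarrow> \<bar>f y\<bar> \<le> A" using causal_bound[OF f(1)] by metis
      show ?thesis by (rule exI[of _ "\<bar>c\<bar> * A"]) (use A in \<open>auto simp: abs_mult mult_left_mono\<close>)
    qed
  qed (use f in \<open>auto simp: causal_def\<close>)
qed

lemma causal_diff: "causal f \<Longrightarrow> causal g \<Longrightarrow> causal (\<lambda>x. f x - g x)"
  using causal_add[of f "\<lambda>x. (-1) * g x"] causal_mult_left[of g "-1"] by simp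

lemma causal_abs: "causal f \<Longrightarrow> causal (\<lambda>x. \<bar>f x\<bar>)"
  unfolding causal_def by auto

lemma causal_truncate:
  assumes "causal f" shows "causal (\<lambda>x. if x < u then f x else 0)"
proof -
  have [measurable]: "f \<in> borel_measurable borel" by (rule causal_measurable[OF assms])
  show ?thesis unfolding causal_def
  proof (intro conjI allI)
    show "\<exists>B. \<forall>y\<le>x. \<bar>if y < u then f y else 0\<bar> \<le> B" for x
    proof -
      obtain A where A: "A \<ge> 0" "\<And>y. y \<le> x \<Longrightarrow> \<bar>f y\<bar> \<le> A" using causal_bound[OF assms] by metis
      show ?thesis by (rule exI[of _ A]) (use A in auto)
    qed
  qed (use assms in \<open>auto simp: causal_neg\<close>)
qed

lemma causal_shift:
  assumes "causal f" shows "causal (\<lambda>x. if x < 0 then 0 else f (u + x))"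
proof -
  have [measurable]: "f \<in> borel_measurable borel" by (rule causal_measurable[OF assms])
  show ?thesis unfolding causal_def
  proof (intro conjI allI)
    show "\<exists>B. \<forall>y\<le>x. \<bar>if y < 0 then 0 else f (u + y)\<bar> \<le> B" for x
    proof -
      obtain A where A: "A \<ge> 0" "\<And>y. y \<le> u + x \<Longrightarrow> \<bar>f y\<bar> \<le> A" using causal_bound[OF assms] by metis
      show ?thesis by (rule exI[of _ A]) (use A in auto)
    qed
  qed (use assms in auto)
qed

abbreviation unit_step :: "real \<Rightarrow> real" where "unit_step \<equiv> indicator {0..}"

lemma causal_unit_step: "causal unit_step"
  by (rule causalI[where B="\<lambda>_. 1"]) (auto simp: indicator_def)

text \<open>The integrand is bounded on the compact interval \<open>{0..x}\<close> and vanishes off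
  it, since there one of the two factors has a negative argument.\<close>

lemma conv_integrable:
  assumes "causal f" "causal g" shows "integrable lborel (\<lambda>y. f (x - y) * g y)"
proof -
  have [measurable]: "f \<in> borel_measurable borel" "g \<in> borel_measurable borel"
    using assms causal_measurable by auto
  obtain A where A: "A \<ge> 0" "\<And>y. y \<le> x \<Longrightarrow> \<bar>f y\<bar> \<le> A" using causal_bound[OF assms(1)] by metis
  obtain B where B: "B \<ge> 0" "\<And>y. y \<le> x \<Longrightarrow> \<bar>g y\<bar> \<le> B" using causal_bound[OF assms(2)] by metis
  show ?thesis
  proof (rule integrableI_bounded_set[where A="{0..x}" and B="A * B"])
    show "AE y in lborel. y \<in> {0..x} \<longrightarrow> norm (f (x - y) * g y) \<le> A * B"
      using A B by (auto intro!: AE_I2 mult_mono simp: abs_mult)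
    show "AE y in lborel. y \<notin> {0..x} \<longrightarrow> f (x - y) * g y = 0"
    proof (rule AE_I2, rule impI)
      fix y assume "y \<notin> {0..x}" then show "f (x - y) * g y = 0"
        using causal_neg[OF assms(1), of "x - y"] causal_neg[OF assms(2), of y] by (cases "y < 0") auto
    qed
  qed (auto simp: emeasure_lborel_Icc_eq)
qed

lemma conv_commute: "conv f g = conv g f"
proof
  fix x
  have "conv f g x = (LINT y|lborel. f (x - (x + (-1) * y)) * g (x + (-1) * y))"
    unfolding conv_def using lborel_integral_real_affine[of "-1" "\<lambda>y. f (x - y) * g y" x] by simp
  then show "conv f g x = conv g f x" unfolding conv_def by (simp add: mult.commute)
qed

lemma causal_conv:
  assumes "causal f" "causal g" shows "causal (conv f g)"
  unfolding causal_def
proof (intro conjI allI impI)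
  have [measurable]: "f \<in> borel_measurable borel" "g \<in> borel_measurable borel"
    using assms causal_measurable by auto
  have "(\<lambda>x. LINT y|lborel. f (x - y) * g y) \<in> borel_measurable borel" by measurable
  then show "conv f g \<in> borel_measurable borel" unfolding conv_def[abs_def] .
  show "conv f g x = 0" if "x < 0" for x
  proof -
    have "(\<lambda>y. f (x - y) * g y) = (\<lambda>_. 0)"
    proof
      show "f (x - y) * g y = 0" for y
        using that causal_neg[OF assms(1), of "x - y"] causal_neg[OF assms(2), of y] by (cases "y < 0") auto
    qed
    then show ?thesis unfolding conv_def by simp
  qed
  show "\<exists>B. \<forall>y\<le>x. \<bar>conv f g y\<bar> \<le> B" for x
  proof -
    obtain A where A: "A \<ge> 0" "\<And>y. y \<le> x \<Longrightarrow> \<bar>f y\<bar> \<le> A" using causal_bound[OF assms(1)] by metis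
    obtain B where B: "B \<ge> 0" "\<And>y. y \<le> x \<Longrightarrow> \<bar>g y\<bar> \<le> B" using causal_bound[OF assms(2)] by metis
    have "\<bar>conv f g z\<bar> \<le> (LINT y|lborel. A * B * indicator {0..x} y)" if "z \<le> x" for z
    proof -
      have "\<bar>conv f g z\<bar> \<le> (LINT y|lborel. \<bar>f (z - y) * g y\<bar>)" unfolding conv_def by (rule integral_abs_bound)
      also have "\<dots> \<le> (LINT y|lborel. A * B * indicator {0..x} y)"
      proof (rule integral_mono)
        show "integrable lborel (\<lambda>y. \<bar>f (z - y) * g y\<bar>)" using conv_integrable[OF assms] by (rule integrable_abs)
        show "\<bar>f (z - y) * g y\<bar> \<le> A * B * indicator {0..x} y" for y
        proof (cases "0 \<le> y \<and> y \<le> z")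
          case True then show ?thesis using A B that by (auto simp: abs_mult intro!: mult_mono)
        next
          case False
          then have "f (z - y) * g y = 0"
            using causal_neg[OF assms(1), of "z - y"] causal_neg[OF assms(2), of y] by (cases "y < 0") auto
          then show ?thesis using A B by auto
        qed
      qed (simp add: emeasure_lborel_Icc_eq)
      finally show ?thesis .
    qed
    then show ?thesis by blast
  qed
qed

lemma conv_add_right:
  assumes "causal f" "causal g" "causal h"
  shows "conv f (\<lambda>x. g x + h x) x = conv f g x + conv f h x"
  unfolding conv_def
  using Bochner_Integration.integral_add[OF conv_integrable[OF assms(1,2)] conv_integrable[OF assms(1,3)]]
  by (simp add: algebra_simps)

lemma conv_diff_right:
  assumes "causal f" "causal g" "causal h"
  shows "conv f (\<lambda>x. g x - h x) x = conv f g x - conv f h x"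
  unfolding conv_def
  using Bochner_Integration.integral_diff[OF conv_integrable[OF assms(1,2)] conv_integrable[OF assms(1,3)]]
  by (simp add: algebra_simps)

lemma conv_add_left:
  assumes "causal f" "causal g" "causal h"
  shows "conv (\<lambda>x. g x + h x) f x = conv g f x + conv h f x"
  using conv_add_right[OF assms] by (metis conv_commute)

lemma conv_diff_left:
  assumes "causal f" "causal g" "causal h"
  shows "conv (\<lambda>x. g x - h x) f x = conv g f x - conv h f x"
  using conv_diff_right[OF assms] by (metis conv_commute)

lemma conv_mult_right: "conv f (\<lambda>x. c * g x) x = c * conv f g x"
  unfolding conv_def by (subst integral_mult_right_zero[symmetric]) (simp add: ac_simps)

text \<open>Fubini on the square over \<open>{0..x}\<close>, to which causality confines the double
  integrand, followed by a translation of the inner variable.\<close>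

lemma conv_assoc:
  assumes f: "causal f" and g: "causal g" and h: "causal h"
  shows "conv f (conv g h) x = conv (conv f g) h x"
proof -
  have [measurable]: "f \<in> borel_measurable borel" "g \<in> borel_measurable borel" "h \<in> borel_measurable borel"
    using assms causal_measurable by auto
  obtain A where A: "A \<ge> 0" "\<And>y. y \<le> x \<Longrightarrow> \<bar>f y\<bar> \<le> A" using causal_bound[OF f] by metis
  obtain B where B: "B \<ge> 0" "\<And>y. y \<le> x \<Longrightarrow> \<bar>g y\<bar> \<le> B" using causal_bound[OF g] by metis
  obtain C where C: "C \<ge> 0" "\<And>y. y \<le> x \<Longrightarrow> \<bar>h y\<bar> \<le> C" using causal_bound[OF h] by metis
  let ?F = "\<lambda>y z. f (x - y) * (g (y - z) * h z)"
  have int: "integrable (lborel \<Otimes>\<^sub>M lborel) (case_prod ?F)"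
  proof (rule integrableI_bounded_set[where A="{0..x} \<times> {0..x}" and B="A * (B * C)"])
    show "emeasure (lborel \<Otimes>\<^sub>M lborel) ({0..x} \<times> {0..x}) < \<infinity>"
      by (subst lborel.emeasure_pair_measure_Times) (auto simp: emeasure_lborel_Icc_eq ennreal_mult_less_top)
    show "AE p in lborel \<Otimes>\<^sub>M lborel. p \<in> {0..x} \<times> {0..x} \<longrightarrow> norm (case_prod ?F p) \<le> A * (B * C)"
      using A B C by (intro AE_I2) (auto simp: abs_mult intro!: mult_mono)
    show "AE p in lborel \<Otimes>\<^sub>M lborel. p \<notin> {0..x} \<times> {0..x} \<longrightarrow> case_prod ?F p = 0"
    proof (intro AE_I2 impI)
      fix p :: "real \<times> real" assume p: "p \<notin> {0..x} \<times> {0..x}"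
      obtain y z where yz: "p = (y, z)" by (cases p)
      have "x - y < 0 \<or> y - z < 0 \<or> z < 0" using p yz by auto
      then show "case_prod ?F p = 0"
        using yz causal_neg[OF f, of "x - y"] causal_neg[OF g, of "y - z"] causal_neg[OF h, of z] by auto
    qed
  qed auto
  have "conv f (conv g h) x = (LINT y|lborel. LINT z|lborel. ?F y z)"
    unfolding conv_def by simp
  also have "\<dots> = (LINT z|lborel. LINT y|lborel. ?F y z)"
    using lborel_pair.Fubini_integral[OF int] by simp
  also have "\<dots> = (LINT z|lborel. conv f g (x - z) * h z)"
  proof (rule Bochner_Integration.integral_cong[OF refl])
    fix z
    have "(LINT y|lborel. ?F y z) = (LINT y|lborel. f (x - y) * g (y - z)) * h z"
      by (subst integral_mult_left_zero[symmetric]) (simp add: ac_simps)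
    also have "(LINT y|lborel. f (x - y) * g (y - z)) = conv f g (x - z)"
      unfolding conv_def using lborel_integral_real_affine[of 1 "\<lambda>y. f (x - y) * g (y - z)" z]
      by (simp add: algebra_simps)
    finally show "(LINT y|lborel. ?F y z) = conv f g (x - z) * h z" .
  qed
  finally show ?thesis unfolding conv_def[of "conv f g"] .
qed

text \<open>Comparison is demanded on \<open>{0..x}\<close> only, so estimates known up to a finite
  time can be convolved up to that time.\<close>

lemma conv_mono:
  assumes "causal f" "causal g" "causal f'" "causal g'"
    and "\<And>y. 0 \<le> y \<Longrightarrow> y \<le> x \<Longrightarrow> f (x - y) * g y \<le> f' (x - y) * g' y"
  shows "conv f g x \<le> conv f' g' x"
  unfolding conv_def
proof (rule integral_mono[OF conv_integrable[OF assms(1,2)] conv_integrable[OF assms(3,4)]])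
  fix y
  show "f (x - y) * g y \<le> f' (x - y) * g' y"
  proof (cases "0 \<le> y \<and> y \<le> x")
    case False
    then have "y < 0 \<or> x - y < 0" by auto
    then show ?thesis using causal_neg[OF assms(1)] causal_neg[OF assms(2)] causal_neg[OF assms(3)] causal_neg[OF assms(4)]
      by auto
  qed (use assms(5) in auto)
qed

lemma conv_nonneg:
  assumes "\<And>y. f y \<ge> 0" "\<And>y. g y \<ge> 0" shows "conv f g x \<ge> 0"
  unfolding conv_def using assms by (intro Bochner_Integration.integral_nonneg) auto

lemma conv_abs_le:
  assumes "\<And>y. f y \<ge> 0" shows "\<bar>conv f g x\<bar> \<le> conv f (\<lambda>y. \<bar>g y\<bar>) x"
  unfolding conv_def using integral_abs_bound[of lborel "\<lambda>y. f (x - y) * g y"] assms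
  by (simp add: abs_mult)

lemma conv_unit_step: 
  "conv unit_step g x = (LINT y|lborel. indicator {..x} y * g y)"
  unfolding conv_def by (intro Bochner_Integration.integral_cong) (auto simp: indicator_def)

section \<open>The renewal equation\<close>

text \<open>The instance to come is the excess lifetime law. Bound and monotonicity of its density
  replace any finer regularity of \<nu>.\<close>

locale renewal_density =
  fixes f :: "real \<Rightarrow> real" and \<alpha> :: real
  assumes causal_f: "causal f" and f_nonneg: "0 \<le> f x" and f_le: "f x \<le> \<alpha>"
    and f_anti: "0 \<le> x \<Longrightarrow> x \<le> y \<Longrightarrow> f y \<le> f x"
    and f_integrable: "integrable lborel f" and f_integral: "(LINT x|lborel. f x) = 1"
begin

lemma measurable_f [measurable]: "f \<in> borel_measurable borel"
  by (rule causal_measurable[OF causal_f])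

lemma alpha_pos: "\<alpha> > 0"
proof (rule ccontr)
  assume "\<not> \<alpha> > 0"
  then have "f x = 0" for x using f_nonneg[of x] f_le[of x] by linarith
  then have "(LINT x|lborel. f x) = 0" by simp
  then show False using f_integral by simp
qed

text \<open>This is the integral of \<open>f\<close> over \<open>{x<..}\<close>, as
  \<open>k_tail\<close> shows. The convolution form makes causality immediate and lets associativity
  act on \<open>k\<close>.\<close>

definition k :: "real \<Rightarrow> real" where "k x = unit_step x - conv f unit_step x"

lemma causal_k: "causal k"
  unfolding k_def[abs_def] by (intro causal_diff causal_unit_step causal_conv causal_f)

lemma measurable_k [measurable]: "k \<in> borel_measurable borel"
  by (rule causal_measurable[OF causal_k])

lemma integrable_indicator_f:
  "A \<in> sets borel \<Longrightarrow> integrable lborel (\<lambda>y. indicator A y * f y)"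
  using integrable_mult_indicator[of A lborel f] f_integrable by simp

lemma k_tail: assumes "x \<ge> 0" shows "k x = (LINT y|lborel. indicator {x<..} y * f y)"
proof -
  have "1 = (LINT y|lborel. indicator {..x} y * f y + indicator {x<..} y * f y)"
    unfolding f_integral[symmetric] by (rule Bochner_Integration.integral_cong) (auto simp: indicator_def)
  also have "\<dots> = (LINT y|lborel. indicator {..x} y * f y) + (LINT y|lborel. indicator {x<..} y * f y)"
    by (intro Bochner_Integration.integral_add integrable_indicator_f) auto
  also have "(LINT y|lborel. indicator {..x} y * f y) = conv f unit_step x"
    by (simp add: conv_commute[of f] conv_unit_step)
  finally show ?thesis using assms by (simp add: k_def)
qed

lemma k_neg: "x < 0 \<Longrightarrow> k x = 0" by (rule causal_neg[OF causal_k])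

lemma k_nonneg: "0 \<le> k x"
  by (cases "x < 0") (auto simp: k_neg k_tail f_nonneg intro!: Bochner_Integration.integral_nonneg)

lemma k_le: "k x \<le> 1"
proof (cases "x < 0")
  case False
  have "0 \<le> conv f unit_step x" by (rule conv_nonneg) (auto simp: f_nonneg)
  with False show ?thesis unfolding k_def by simp
qed (simp add: k_neg)

lemma k_diff: assumes "0 \<le> x" "x \<le> y"
  shows "k x - k y = (LINT z|lborel. indicator {x<..y} z * f z)"
proof -
  have "k x = (LINT z|lborel. indicator {x<..y} z * f z + indicator {y<..} z * f z)"
    using assms by (auto simp: k_tail indicator_def intro!: Bochner_Integration.integral_cong)
  also have "\<dots> = (LINT z|lborel. indicator {x<..y} z * f z) + k y"
    using assms by (simp add: k_tail Bochner_Integration.integral_add integrable_indicator_f)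
  finally show ?thesis by simp
qed

lemma k_anti: assumes "0 \<le> x" "x \<le> y" shows "k y \<le> k x"
proof -
  have "0 \<le> (LINT z|lborel. indicator {x<..y} z * f z)"
    by (auto simp: f_nonneg intro!: Bochner_Integration.integral_nonneg)
  then show ?thesis using k_diff[OF assms] by simp
qed

text \<open>On \<open>{x<..y}\<close> the density is at least its value at the right end. This is
  how decay of \<open>k\<close> passes to \<open>f\<close>, with a gain of one power.\<close>

lemma k_diff_ge: assumes "0 \<le> x" "x \<le> y" shows "(y - x) * f y \<le> k x - k y"
proof -
  have "(y - x) * f y = (LINT z|lborel. indicator {x<..y} z * f y)" using assms by simp
  also have "\<dots> \<le> (LINT z|lborel. indicator {x<..y} z * f z)"
    using assms by (intro integral_mono integrable_indicator_f integrable_mult_left integrable_real_indicator)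
      (auto simp: indicator_def emeasure_lborel_Ioc f_anti)
  finally show ?thesis using k_diff[OF assms] by simp
qed

lemma k_diff_le: assumes "0 \<le> x" "x \<le> y" shows "k x - k y \<le> (y - x) * \<alpha>"
proof -
  have "(LINT z|lborel. indicator {x<..y} z * f z) \<le> (LINT z|lborel. indicator {x<..y} z * \<alpha>)"
    using assms by (intro integral_mono integrable_indicator_f integrable_mult_left integrable_real_indicator)
      (auto simp: indicator_def emeasure_lborel_Ioc f_le)
  also have "\<dots> = (y - x) * \<alpha>" using assms by simp
  finally show ?thesis using k_diff[OF assms] by simp
qed

lemma k_0: "k 0 = 1"
proof -
  have "AE y in lborel. y \<noteq> (0::real)" by (rule AE_lborel_singleton)
  then have "k 0 = (LINT y|lborel. f y)"
    unfolding k_tail[OF order_refl]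
    by (intro integral_cong_AE) (auto simp: indicator_def causal_neg[OF causal_f] elim!: eventually_mono)
  then show ?thesis by (simp add: f_integral)
qed

section \<open>Well-posedness of the renewal equation and the renewal density\<close>

definition expw :: "real \<Rightarrow> real" where "expw y = (if y < 0 then 0 else exp (2 * \<alpha> * y))"

lemma causal_expw: "causal expw"
proof (rule causalI)
  show "expw \<in> borel_measurable borel" unfolding expw_def[abs_def] by measurable
  show "\<bar>expw y\<bar> \<le> exp (2 * \<alpha> * max x 0)" if "y \<le> x" for x y
    using that alpha_pos by (auto simp: expw_def)
qed (simp add: expw_def)

text \<open>The exponent is twice the bound of \<open>f\<close>: integrating
  \<open>\<alpha> * exp (2 * \<alpha> * y)\<close> over \<open>{0..x}\<close> yields less than half
  of the value of the exponential at \<open>x\<close>.\<close>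

lemma conv_expw_le: "conv f expw x \<le> expw x / 2"
proof (cases "x < 0")
  case True then show ?thesis using causal_neg[OF causal_conv[OF causal_f causal_expw]] by (simp add: expw_def)
next
  case False
  have int: "integrable lborel (\<lambda>y. \<alpha> * exp (2 * \<alpha> * y) * indicator {0..x} y)"
    by (rule borel_integrable_atLeastAtMost) (auto intro!: continuous_intros)
  have "conv f expw x \<le> (LINT y|lborel. \<alpha> * exp (2 * \<alpha> * y) * indicator {0..x} y)"
    unfolding conv_def
  proof (rule integral_mono[OF conv_integrable[OF causal_f causal_expw] int])
    show "f (x - y) * expw y \<le> \<alpha> * exp (2 * \<alpha> * y) * indicator {0..x} y" for y
      using f_le[of "x - y"] causal_neg[OF causal_f, of "x - y"] by (auto simp: expw_def indicator_def)
  qed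
  also have "\<dots> = exp (2 * \<alpha> * x) / 2 - exp (2 * \<alpha> * 0) / 2"
    using False by (intro integral_FTC_Icc_real) (auto intro!: derivative_eq_intros continuous_intros)
  also have "\<dots> \<le> expw x / 2" using False by (simp add: expw_def)
  finally show ?thesis .
qed

text \<open>The bound \<open>conv f expw \<le> expw / 2\<close> makes convolution with \<open>f\<close> a contraction for the norm weighted by \<open>expw\<close>.\<close>

lemma conv_fixpoint_zero:
  assumes d: "causal d" and eq: "\<And>x. x \<le> u \<Longrightarrow> d x = conv f d x" and "x \<le> u"
  shows "d x = 0"
proof -
  obtain B where B: "B \<ge> 0" "\<And>y. y \<le> u \<Longrightarrow> \<bar>d y\<bar> \<le> B" using causal_bound[OF d] by metis
  have *: "\<forall>x\<le>u. \<bar>d x\<bar> \<le> B / 2 ^ n * expw x" for n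
  proof (induction n)
    case 0
    show ?case
    proof (intro allI impI)
      fix x assume x: "x \<le> u"
      show "\<bar>d x\<bar> \<le> B / 2 ^ 0 * expw x"
      proof (cases "x < 0")
        case False
        then have "B * 1 \<le> B * expw x" using B(1) alpha_pos by (intro mult_left_mono) (auto simp: expw_def)
        then show ?thesis using B(2)[OF x] by simp
      qed (simp add: causal_neg[OF d] expw_def)
    qed
  next
    case (Suc n)
    show ?case
    proof (intro allI impI)
      fix x assume x: "x \<le> u"
      have "\<bar>d x\<bar> \<le> conv f (\<lambda>y. \<bar>d y\<bar>) x" by (subst eq[OF x]) (rule conv_abs_le[OF f_nonneg])
      also have "\<dots> \<le> conv f (\<lambda>y. B / 2 ^ n * expw y) x"
        using Suc x by (intro conv_mono causal_f causal_abs d causal_mult_left causal_expw mult_left_mono f_nonneg) auto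
      also have "\<dots> \<le> B / 2 ^ n * (expw x / 2)"
        unfolding conv_mult_right using conv_expw_le B(1) by (intro mult_left_mono) auto
      finally show "\<bar>d x\<bar> \<le> B / 2 ^ Suc n * expw x" by simp
    qed
  qed
  have "(\<lambda>n. B * expw x * (1/2) ^ n) \<longlonglongrightarrow> B * expw x * 0"
    by (intro tendsto_intros LIMSEQ_power_zero) auto
  then have "\<bar>d x\<bar> \<le> B * expw x * 0"
    by (rule LIMSEQ_le_const) (use * \<open>x \<le> u\<close> in \<open>auto simp: power_divide\<close>)
  then show ?thesis by simp
qed

text \<open>Partial sums of the renewal series: the n-th iterate is the sum of the convolution
  powers of \<open>f\<close> of orders 1 to n.\<close>

primrec renewal_iter :: "nat \<Rightarrow> real \<Rightarrow> real" where
  "renewal_iter 0 = (\<lambda>_. 0)"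
| "renewal_iter (Suc n) = (\<lambda>x. f x + conv f (renewal_iter n) x)"

lemma causal_zero: "causal (\<lambda>_. 0)" by (rule causalI[where B="\<lambda>_. 0"]) auto

lemma causal_renewal_iter: "causal (renewal_iter n)"
  by (induction n) (auto intro: causal_zero causal_add causal_f causal_conv)

lemma renewal_iter_nonneg: "0 \<le> renewal_iter n x"
  by (induction n arbitrary: x) (auto intro!: add_nonneg_nonneg f_nonneg conv_nonneg)

lemma renewal_iter_mono: "renewal_iter n x \<le> renewal_iter (Suc n) x"
proof (induction n arbitrary: x)
  case 0 then show ?case using renewal_iter_nonneg[of "Suc 0" x] by simp
next
  case (Suc n)
  have "conv f (renewal_iter n) x \<le> conv f (renewal_iter (Suc n)) x"
    by (intro conv_mono causal_f causal_renewal_iter mult_left_mono Suc f_nonneg)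
  then show ?case by simp
qed

text \<open>The bound reproduces itself: \<open>f\<close> is at most \<open>\<alpha> * expw\<close>,
  and convolution with \<open>f\<close> halves \<open>2 * \<alpha> * expw\<close>.\<close>

lemma renewal_iter_le: "renewal_iter n x \<le> 2 * \<alpha> * expw x"
proof (induction n arbitrary: x)
  case 0 then show ?case using alpha_pos by (simp add: expw_def)
next
  case (Suc n)
  have "conv f (renewal_iter n) x \<le> conv f (\<lambda>y. 2 * \<alpha> * expw y) x"
    by (intro conv_mono causal_f causal_renewal_iter causal_mult_left causal_expw mult_left_mono Suc f_nonneg)
  also have "\<dots> \<le> 2 * \<alpha> * (expw x / 2)"
    unfolding conv_mult_right using alpha_pos conv_expw_le by (intro mult_left_mono) auto
  finally have 1: "conv f (renewal_iter n) x \<le> \<alpha> * expw x" by simp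
  have 2: "f x \<le> \<alpha> * expw x"
  proof (cases "x < 0")
    case False
    then have "\<alpha> * 1 \<le> \<alpha> * expw x" using alpha_pos by (intro mult_left_mono) (auto simp: expw_def)
    then show ?thesis using f_le[of x] by simp
  qed (simp add: causal_neg[OF causal_f] expw_def)
  show ?case using 1 2 by simp
qed

text \<open>The renewal density, the sum of all convolution powers of \<open>f\<close> of positive
  order. The power of order 0, a unit mass at 0, is kept apart, hence solutions of the form
  \<open>g + conv U g\<close>.\<close>

definition U :: "real \<Rightarrow> real" where "U x = lim (\<lambda>n. renewal_iter n x)"

lemma renewal_iter_LIMSEQ: "(\<lambda>n. renewal_iter n x) \<longlonglongrightarrow> U x"
proof -
  have "incseq (\<lambda>n. renewal_iter n x)" using renewal_iter_mono by (simp add: incseq_Suc_iff)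
  then have "convergent (\<lambda>n. renewal_iter n x)"
    using incseq_convergent[of "\<lambda>n. renewal_iter n x" "2 * \<alpha> * expw x"] renewal_iter_le by (meson convergentI)
  then show ?thesis unfolding U_def by (simp add: convergent_LIMSEQ_iff)
qed

lemma renewal_iter_le_U: "renewal_iter n x \<le> U x"
  by (rule incseq_le[OF _ renewal_iter_LIMSEQ]) (use renewal_iter_mono in \<open>auto simp: incseq_Suc_iff\<close>)

lemma U_nonneg: "0 \<le> U x" using renewal_iter_le_U[of 0] by simp

lemma U_le_expw: "U x \<le> 2 * \<alpha> * expw x"
  by (rule LIMSEQ_le_const2[OF renewal_iter_LIMSEQ]) (use renewal_iter_le in auto)

lemma measurable_U [measurable]: "U \<in> borel_measurable borel"
  by (rule borel_measurable_LIMSEQ_real[of _ renewal_iter]) (use renewal_iter_LIMSEQ causal_measurable[OF causal_renewal_iter] in auto)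

lemma causal_U: "causal U"
proof -
  obtain B where B: "\<And>x y. y \<le> x \<Longrightarrow> \<bar>2 * \<alpha> * expw y\<bar> \<le> B x"
    using causal_mult_left[OF causal_expw, of "2 * \<alpha>"] unfolding causal_def by metis
  show ?thesis
  proof (rule causalI[OF measurable_U, where B=B])
    show "U x = 0" if "x < 0" for x using U_le_expw[of x] U_nonneg[of x] that by (simp add: expw_def)
    show "\<bar>U y\<bar> \<le> B x" if "y \<le> x" for x y
      using B[OF that] U_nonneg[of y] U_le_expw[of y] by linarith
  qed
qed

lemma U_eq: "U x = f x + conv f U x"
proof -
  have [measurable]: "renewal_iter n \<in> borel_measurable borel" for n by (rule causal_measurable[OF causal_renewal_iter])
  have "(\<lambda>n. conv f (renewal_iter n) x) \<longlonglongrightarrow> conv f U x"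
    unfolding conv_def
  proof (rule integral_dominated_convergence[where w="\<lambda>y. f (x - y) * (2 * \<alpha> * expw y)"])
    show "integrable lborel (\<lambda>y. f (x - y) * (2 * \<alpha> * expw y))"
      by (intro conv_integrable causal_f causal_mult_left causal_expw)
    show "AE y in lborel. (\<lambda>n. f (x - y) * renewal_iter n y) \<longlonglongrightarrow> f (x - y) * U y"
      by (intro AE_I2 tendsto_intros renewal_iter_LIMSEQ)
    show "AE y in lborel. norm (f (x - y) * renewal_iter n y) \<le> f (x - y) * (2 * \<alpha> * expw y)" for n
      by (intro AE_I2) (auto simp: abs_mult renewal_iter_nonneg f_nonneg renewal_iter_le intro!: mult_left_mono)
  qed auto
  then have "(\<lambda>n. renewal_iter (Suc n) x) \<longlonglongrightarrow> f x + conv f U x" by (auto intro!: tendsto_intros)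
  moreover have "(\<lambda>n. renewal_iter (Suc n) x) \<longlonglongrightarrow> U x" by (rule LIMSEQ_Suc[OF renewal_iter_LIMSEQ])
  ultimately show ?thesis by (rule LIMSEQ_unique[rotated])
qed

text \<open>From \<open>k = unit_step - conv f unit_step\<close> and associativity,
  \<open>conv k z\<close> is \<open>unit_step\<close> convolved with \<open>z - conv f z\<close>,
  which is \<open>g\<close>. It acts as a conservation law: a weighted history of \<open>z\<close>
  depends on \<open>g\<close> alone.\<close>

lemma conv_k:
  assumes z: "causal z" and g: "causal g" and eq: "\<And>x. z x = g x + conv f z x"
  shows "conv k z x = conv unit_step g x"
proof -
  have z': "z = (\<lambda>x. g x + conv f z x)" by (rule ext) (rule eq)
  have "conv k z x = conv unit_step z x - conv (conv f unit_step) z x"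
    unfolding k_def[abs_def] by (intro conv_diff_left z causal_unit_step causal_conv causal_f)
  also have "conv (conv f unit_step) z x = conv unit_step (conv f z) x"
    by (subst conv_commute[of f]) (intro conv_assoc[symmetric] z causal_f causal_unit_step)
  also have "conv unit_step z x = conv unit_step g x + conv unit_step (conv f z) x"
    by (subst z') (intro conv_add_right causal_unit_step g causal_conv causal_f z)
  finally show ?thesis by simp
qed

text \<open>Here \<open>U = f + conv f U\<close> turns \<open>conv f g + conv f (conv U g)\<close>
  into \<open>conv U g\<close>.\<close>

lemma renewal_solution:
  assumes g: "causal g" and E: "\<And>x. E x = g x + conv U g x"
  shows "E x = g x + conv f E x"
proof -
  have E': "E = (\<lambda>x. g x + conv U g x)" by (rule ext) (rule E)
  have U': "U = (\<lambda>x. f x + conv f U x)" by (rule ext) (rule U_eq)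
  have "conv f E x = conv f g x + conv f (conv U g) x"
    unfolding E' by (intro conv_add_right causal_f g causal_conv causal_U)
  also have "conv f (conv U g) x = conv (conv f U) g x"
    by (intro conv_assoc causal_f g causal_U)
  also have "conv f g x + conv (conv f U) g x = conv U g x"
    by (subst (2) U') (intro conv_add_left[symmetric] causal_f g causal_conv causal_U)
  finally show ?thesis by (subst E) simp
qed

text \<open>The equation is required only up to \<open>u\<close>, because the fluid model supplies
  it only on the range of its clock.\<close>

lemma renewal_unique:
  assumes g: "causal g" and z: "causal z" and eq: "\<And>x. x \<le> u \<Longrightarrow> z x = g x + conv f z x" and "x \<le> u"
  shows "z x = g x + conv U g x"
proof -
  let ?E = "\<lambda>x. g x + conv U g x"
  have E: "causal ?E" by (intro causal_add g causal_conv causal_U)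
  have "z x - ?E x = 0"
  proof (rule conv_fixpoint_zero[OF _ _ \<open>x \<le> u\<close>])
    show "causal (\<lambda>x. z x - ?E x)" by (intro causal_diff z E)
    show "z y - ?E y = conv f (\<lambda>x. z x - ?E x) y" if "y \<le> u" for y
      using eq[OF that] renewal_solution[OF g refl, of y] conv_diff_right[OF causal_f z E, of y] by simp
  qed
  then show ?thesis by simp
qed

lemma conv_k_U: "conv k U x = conv unit_step f x"
  by (rule conv_k[OF causal_U causal_f U_eq])

lemma conv_step_f: "conv unit_step f x = unit_step x - k x"
  unfolding k_def by (simp add: conv_commute)

text \<open>Trades \<open>f\<close> for \<open>k\<close>, whose convolutions are known. On
  \<open>{0..h}\<close> the function \<open>k\<close> loses at most 1/2 of its initial value 1, so
  \<open>2 * \<alpha> * k\<close> covers the bound \<alpha>; beyond \<open>h\<close> monotonicity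
  gives \<open>h * f r \<le> k (r - h)\<close>.\<close>

lemma f_le_k: assumes "\<alpha> * h = 1/2" shows "f r \<le> 2 * \<alpha> * k r + 2 * \<alpha> * k (r - h)"
proof -
  have h: "h > 0" using assms alpha_pos zero_less_mult_pos[of \<alpha> h] by simp
  consider "r < 0" | "0 \<le> r" "r \<le> h" | "r > h" by linarith
  then show ?thesis
  proof cases
    case 1 then show ?thesis using alpha_pos k_nonneg by (simp add: causal_neg[OF causal_f])
  next
    case 2
    have "r * \<alpha> \<le> h * \<alpha>" using 2 alpha_pos by (intro mult_right_mono) auto
    with 2 have "k 0 - k r \<le> h * \<alpha>" using k_diff_le[of 0 r] by simp
    then have "k r \<ge> 1/2" using assms k_0 by (simp add: mult.commute)
    then have "\<alpha> * 1 \<le> \<alpha> * (2 * k r)" using alpha_pos by (intro mult_left_mono) auto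
    moreover have "0 \<le> 2 * \<alpha> * k (r - h)" using alpha_pos k_nonneg by simp
    ultimately show ?thesis using f_le[of r] by simp
  next
    case 3
    have "h * f r \<le> k (r - h)" using k_diff_ge[of "r - h" r] 3 h k_nonneg[of r] by simp
    then have "2 * \<alpha> * (h * f r) \<le> 2 * \<alpha> * k (r - h)" using alpha_pos by (intro mult_left_mono) auto
    moreover have "2 * \<alpha> * (h * f r) = f r" using assms by (simp add: field_simps)
    moreover have "0 \<le> 2 * \<alpha> * k r" using alpha_pos k_nonneg by simp
    ultimately show ?thesis by linarith
  qed
qed

lemma conv_f_le_k:
  assumes z: "causal z" "\<And>x. z x \<ge> 0" and B: "\<And>x. conv k z x \<le> B"
  shows "conv f z x \<le> 4 * \<alpha> * B"
proof -
  define h where "h = 1 / (2 * \<alpha>)"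
  have h: "\<alpha> * h = 1/2" using alpha_pos by (simp add: h_def)
  have int: "integrable lborel (\<lambda>y. k (x - y) * z y)" for x by (intro conv_integrable causal_k z)
  have "conv f z x \<le> (LINT y|lborel. 2 * \<alpha> * (k (x - y) * z y) + 2 * \<alpha> * (k (x - h - y) * z y))"
    unfolding conv_def
  proof (rule integral_mono)
    show "f (x - y) * z y \<le> 2 * \<alpha> * (k (x - y) * z y) + 2 * \<alpha> * (k (x - h - y) * z y)" for y
      using mult_right_mono[OF f_le_k[OF h, of "x - y"] z(2)[of y]] by (simp add: algebra_simps)
  qed (use int[of x] int[of "x - h"] in \<open>auto intro!: conv_integrable causal_f z\<close>)
  also have "\<dots> = 2 * \<alpha> * conv k z x + 2 * \<alpha> * conv k z (x - h)"
    unfolding conv_def using int[of x] int[of "x - h"] by simp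
  also have "\<dots> \<le> 2 * \<alpha> * B + 2 * \<alpha> * B"
    using alpha_pos B by (intro add_mono mult_left_mono) auto
  finally show ?thesis by (simp add: algebra_simps)
qed

text \<open>Replaces the exponential bound by a constant: \<open>conv k U\<close> is
  \<open>unit_step - k\<close>, hence at most 1; this makes \<open>conv f U\<close> at most
  \<open>4 * \<alpha>\<close>, and \<open>f\<close> adds one more \<alpha>.\<close>

lemma U_le: "U x \<le> 5 * \<alpha>"
proof -
  have "conv k U x \<le> 1" for x unfolding conv_k_U conv_step_f using k_nonneg[of x] by (auto simp: indicator_def)
  then have "conv f U x \<le> 4 * \<alpha>" using conv_f_le_k[OF causal_U U_nonneg, of 1] by simp
  then show ?thesis using U_eq[of x] f_le[of x] by simp
qed

end

text \<open>The history is cut at time \<open>u\<close>: the past enters frozen, and the rest is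
  again a convolution of causal functions, with the origin of time moved to
  \<open>u\<close>.\<close>

lemma conv_shift:
  assumes "causal f" "causal g" "0 \<le> u"
  shows "conv f g (x + u) = conv f (\<lambda>y. if y < u then g y else 0) (x + u)
    + conv f (\<lambda>y. if y < 0 then 0 else g (u + y)) x"
proof -
  let ?a = "\<lambda>y. if y < u then g y else 0" and ?b = "\<lambda>y. if y < u then 0 else g y"
  have b: "?b = (\<lambda>y. g y - ?a y)" by auto
  have cb: "causal ?b" unfolding b by (intro causal_diff causal_truncate assms)
  have "conv f g (x + u) = conv f (\<lambda>y. ?a y + ?b y) (x + u)" by (rule arg_cong[where f="\<lambda>g. conv f g _"]) auto
  also have "\<dots> = conv f ?a (x + u) + conv f ?b (x + u)"
    by (intro conv_add_right causal_truncate assms cb)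
  also have "conv f ?b (x + u) = conv f (\<lambda>y. if y < 0 then 0 else g (u + y)) x"
    unfolding conv_def using lborel_integral_real_affine[of 1 "\<lambda>y. f (x + u - y) * ?b y" u]
    by (simp add: algebra_simps if_distrib cong: if_cong)
  finally show ?thesis .
qed

section \<open>Tail integrals\<close>

definition tail :: "(real \<Rightarrow> real) \<Rightarrow> real \<Rightarrow> real" where
  "tail g R = (LINT x|lborel. indicator {R<..} x * g x)"

lemma integrable_indicator_mult:
  "integrable lborel g \<Longrightarrow> A \<in> sets borel \<Longrightarrow> integrable lborel (\<lambda>x. indicator A x * g x :: real)"
  using integrable_mult_indicator[of A lborel g] by simp

lemma tail_shift: "tail g (R + u) = (LINT x|lborel. indicator {R<..} x * g (x + u))"
  unfolding tail_def using lborel_integral_real_affine[of 1 "\<lambda>x. indicator {R + u<..} x * g x" u]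
  by (simp add: indicator_def add.commute)

lemma tail_closed: 
  assumes [measurable]: "g \<in> borel_measurable borel"
  shows "(LINT x|lborel. indicator {R..} x * g x) = tail g R"
  unfolding tail_def
proof (rule integral_cong_AE)
  show "AE x in lborel. indicator {R..} x * g x = indicator {R<..} x * g x"
    using AE_lborel_singleton[of R] by (rule eventually_mono) (auto simp: indicator_def)
qed auto

lemma tail_split:
  assumes "causal g" "integrable lborel g"
  shows "(LINT x|lborel. g x) = conv unit_step g R + tail g R"
proof -
  have "(LINT x|lborel. g x) = (LINT x|lborel. indicator {..R} x * g x + indicator {R<..} x * g x)"
    by (intro Bochner_Integration.integral_cong) (auto simp: indicator_def)
  also have "\<dots> = conv unit_step g R + tail g R"
    unfolding conv_unit_step tail_def
    by (intro Bochner_Integration.integral_add integrable_indicator_mult assms) auto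
  finally show ?thesis .
qed

lemma tail_mono:
  assumes "integrable lborel g" "integrable lborel h" "\<And>x. R < x \<Longrightarrow> g x \<le> h x"
  shows "tail g R \<le> tail h R"
  unfolding tail_def using assms by (intro integral_mono integrable_indicator_mult) (auto simp: indicator_def)

lemma tail_antimono:
  assumes "integrable lborel g" "\<And>x. 0 \<le> g x" "R \<le> R'"
  shows "tail g R' \<le> tail g R"
  unfolding tail_def using assms by (intro integral_mono integrable_indicator_mult) (auto simp: indicator_def)

lemma tail_nonneg: "(\<And>x. 0 \<le> g x) \<Longrightarrow> 0 \<le> tail g R"
  unfolding tail_def by (intro Bochner_Integration.integral_nonneg) auto

lemma tail_abs: "\<bar>tail g R\<bar> \<le> tail (\<lambda>x. \<bar>g x\<bar>) R"
  unfolding tail_def using integral_abs_bound[of lborel "\<lambda>x. indicator {R<..} x * g x"]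
  by (simp add: abs_mult)

text \<open>Turns an integrated tail bound into a pointwise one, with one extra power of decay when
  \<open>R'\<close> is a fixed multiple of \<open>R\<close>.\<close>

lemma antimono_le_tail:
  assumes "integrable lborel g" "\<And>x. 0 \<le> g x" "\<And>x y. 0 \<le> x \<Longrightarrow> x \<le> y \<Longrightarrow> g y \<le> g x" "0 \<le> R" "R \<le> R'"
  shows "(R' - R) * g R' \<le> tail g R"
proof -
  have "(R' - R) * g R' = (LINT x|lborel. indicator {R<..R'} x * g R')" using assms by simp
  also have "\<dots> \<le> tail g R" unfolding tail_def
    using assms by (intro integral_mono integrable_indicator_mult integrable_mult_left integrable_real_indicator)
      (auto simp: indicator_def emeasure_lborel_Ioc)
  finally show ?thesis .
qed

text \<open>With \<open>R = \<theta> * u\<close> a step multiplies time by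
  \<open>1 + \<theta>\<close> and costs the target a factor \<open>(1 + \<theta>) powr q\<close>.
  For small \<theta> this keeps \<open>1 - \<delta>\<close> below \<open>1 - \<delta>/2\<close>, and
  the slack \<open>\<delta>/2\<close> pays for the error, which then has the target order.
  \<open>C\<close> is chosen before \<open>a\<close>, so it is uniform.\<close>

lemma powr_decay_iteration:
  fixes q \<delta> Q A :: real
  assumes q: "q > 0" and \<delta>: "0 < \<delta>" "\<delta> < 1" and Q: "Q \<ge> 0" and A: "A \<ge> 0"
  shows "\<exists>C\<ge>0. \<forall>a. (\<forall>u\<ge>0. a u \<le> A) \<longrightarrow>
     (\<forall>u\<ge>0. \<forall>R\<ge>2. a (u + R) \<le> (1 - \<delta>) * a u + 2 * \<delta> * (Q * (R/2) powr (-q))) \<longrightarrow>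
     (\<forall>t\<ge>1. a t \<le> C * t powr (-q))"
proof -
  have "((\<lambda>\<theta>::real. (1 - \<delta>) * (1 + \<theta>) powr q) \<longlongrightarrow> (1 - \<delta>) * (1 + 0) powr q) (at_right 0)"
    by (intro tendsto_intros) auto
  moreover have "(1 - \<delta>) * (1 + 0) powr q < 1 - \<delta>/2" using \<delta> by simp
  ultimately have "\<forall>\<^sub>F \<theta> in at_right 0. (1 - \<delta>) * (1 + \<theta>) powr q < 1 - \<delta>/2"
    by (rule order_tendstoD(2))
  then obtain b where b: "b > 0" "\<And>\<theta>. 0 < \<theta> \<Longrightarrow> \<theta> < b \<Longrightarrow> (1 - \<delta>) * (1 + \<theta>) powr q < 1 - \<delta>/2"
    by (auto simp: eventually_at_right_field)
  define \<theta> where "\<theta> = min 1 (b/2)"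
  have \<theta>: "0 < \<theta>" "\<theta> \<le> 1" "(1 - \<delta>) * (1 + \<theta>) powr q < 1 - \<delta>/2"
    using b by (auto simp: \<theta>_def min_def)
  \<comment> \<open>Beyond \<open>t0\<close> the step \<open>\<theta> * u\<close> from
    \<open>u = t / (1 + \<theta>)\<close> is at least 2, as the recursion demands.\<close>
  define t0 where "t0 = (1 + \<theta>) * (2 / \<theta>)"
  have t0: "t0 \<ge> 1" using \<theta> by (simp add: t0_def field_simps)
  \<comment> \<open>The first summand covers \<open>1 \<le> t \<le> t0\<close> by the crude bound
    \<open>A\<close>; the second absorbs the error, using
    \<open>1 + \<theta> \<le> 2\<close>.\<close>
  define C where "C = A * t0 powr q + 4 * 2 powr q * Q * (\<theta>/2) powr (-q)"
  have C: "C \<ge> 0" "A * t0 powr q \<le> C" "4 * 2 powr q * Q * (\<theta>/2) powr (-q) \<le> C"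
    using A Q by (auto simp: C_def)
  show ?thesis
  proof (intro exI[of _ C] conjI allI impI C(1))
    fix a t assume a: "\<forall>u\<ge>0. a u \<le> A" and t: "(1::real) \<le> t"
      and rec: "\<forall>u\<ge>0. \<forall>R\<ge>2. a (u + R) \<le> (1 - \<delta>) * a u + 2 * \<delta> * (Q * (R/2) powr (-q))"
    have *: "\<forall>t. 1 \<le> t \<and> t \<le> t0 * (1 + \<theta>) ^ n \<longrightarrow> a t \<le> C * t powr (-q)" for n
    proof (induction n)
      case 0
      show ?case
      proof (intro allI impI)
        fix t assume t: "1 \<le> t \<and> t \<le> t0 * (1 + \<theta>) ^ 0"
        have "a t \<le> A * 1" using a t by simp
        also have "\<dots> \<le> A * (t0 powr q * t powr (-q))"
          using t t0 q A by (intro mult_left_mono) (auto simp: powr_minus_divide intro!: powr_mono2)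
        also have "\<dots> \<le> C * t powr (-q)" using C(2) by (simp add: mult_right_mono flip: mult.assoc)
        finally show "a t \<le> C * t powr (-q)" .
      qed
    next
      case (Suc n)
      show ?case
      proof (intro allI impI)
        fix t assume t: "1 \<le> t \<and> t \<le> t0 * (1 + \<theta>) ^ Suc n"
        show "a t \<le> C * t powr (-q)"
        proof (cases "t \<le> t0")
          case True
          have "t0 * 1 \<le> t0 * (1 + \<theta>) ^ n" using t0 \<theta> by (intro mult_left_mono one_le_power) auto
          then have "t \<le> t0 * (1 + \<theta>) ^ n" using True by linarith
          then show ?thesis using Suc t by blast
        next
          case False
          define u where "u = t / (1 + \<theta>)"
          have "u * (1 + \<theta>) = t" using \<theta> by (simp add: u_def)
          then have tu: "t = u + \<theta> * u" by (simp add: algebra_simps)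
          have u: "2 / \<theta> \<le> u" using False \<theta> by (simp add: u_def t0_def field_simps)
          then have R: "2 \<le> \<theta> * u" using \<theta> by (simp add: field_simps)
          have "1 \<le> 2 / \<theta>" using \<theta> by (simp add: field_simps)
          then have u1: "1 \<le> u" using u by linarith
          have "u \<le> t0 * (1 + \<theta>) ^ n" using t \<theta> by (simp add: u_def field_simps)
          then have IH: "a u \<le> C * u powr (-q)" using Suc u1 by auto
          have "a t \<le> (1 - \<delta>) * a u + 2 * \<delta> * (Q * (\<theta> * u/2) powr (-q))"
            using rec R u1 tu by auto
          also have "\<dots> \<le> (1 - \<delta>) * (C * u powr (-q)) + 2 * \<delta> * (Q * (\<theta> * u/2) powr (-q))"
            using IH \<delta> by (intro add_right_mono mult_left_mono) auto
          also have "(\<theta> * u/2) powr (-q) = (\<theta>/2) powr (-q) * u powr (-q)"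
            using powr_mult[of "\<theta>/2" u "-q"] \<theta> u1 by simp
          also have "u powr (-q) = (1 + \<theta>) powr q * t powr (-q)"
            using \<theta> t by (simp add: u_def powr_divide powr_minus_divide)
          also have "(1 - \<delta>) * (C * ((1 + \<theta>) powr q * t powr (-q)))
              + 2 * \<delta> * (Q * ((\<theta>/2) powr (-q) * ((1 + \<theta>) powr q * t powr (-q))))
             = (((1 - \<delta>) * (1 + \<theta>) powr q) * C + \<delta>/2 * (4 * (1 + \<theta>) powr q * Q * (\<theta>/2) powr (-q))) * t powr (-q)"
            by (simp add: algebra_simps)
          also have "\<dots> \<le> ((1 - \<delta>/2) * C + \<delta>/2 * C) * t powr (-q)"
          proof (rule mult_right_mono[OF add_mono])
            show "(1 - \<delta>) * (1 + \<theta>) powr q * C \<le> (1 - \<delta>/2) * C"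
              using \<theta>(3) C(1) by (intro mult_right_mono) auto
            have "4 * (1 + \<theta>) powr q * Q * (\<theta>/2) powr (-q) \<le> 4 * 2 powr q * Q * (\<theta>/2) powr (-q)"
              using \<theta> q Q by (intro mult_right_mono mult_left_mono powr_mono2) auto
            then show "\<delta>/2 * (4 * (1 + \<theta>) powr q * Q * (\<theta>/2) powr (-q)) \<le> \<delta>/2 * C"
              using C(3) \<delta> by (intro mult_left_mono) auto
          qed auto
          also have "\<dots> = C * t powr (-q)" by (simp add: algebra_simps)
          finally show ?thesis .
        qed
      qed
    qed
    obtain n where "t / t0 < (1 + \<theta>) ^ n" using real_arch_pow[of "1 + \<theta>" "t / t0"] \<theta> by auto
    then have "t \<le> t0 * (1 + \<theta>) ^ n" using t0 by (simp add: field_simps)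
    then show "a t \<le> C * t powr (-q)" using * t by auto
  qed
qed

section \<open>Lower bounds for the renewal series and the restarted equation\<close>

context renewal_density begin

lemma f_pos_near_0: obtains h c where "h > 0" "c > 0" "\<And>x. 0 \<le> x \<Longrightarrow> x \<le> h \<Longrightarrow> c \<le> f x"
proof -
  have "\<exists>h>0. f h > 0"
  proof (rule ccontr)
    assume "\<not> (\<exists>h>0. f h > 0)"
    then have *: "f h = 0" if "h \<noteq> 0" for h
      using that f_nonneg[of h] causal_neg[OF causal_f, of h]
      by (metis linorder_neqE_linordered_idom order_le_less)
    have "AE x in lborel. f x = 0"
      using AE_lborel_singleton[of "0::real"] by (rule eventually_mono) (rule *)
    then have "(LINT x|lborel. f x) = 0" by (rule integral_eq_zero_AE)
    then show False using f_integral by simp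
  qed
  then obtain h where "h > 0" "f h > 0" by blast
  then show thesis using that[of h "f h"] f_anti by auto
qed

text \<open>Positivity spreads by \<open>h/2\<close> with each convolution: for \<open>x\<close> in
  the new half step and \<open>y\<close> in the last old one, \<open>x - y\<close> lies in
  \<open>{0..h}\<close>, so the integrand is at least \<open>c * e\<close> on an interval of length
  \<open>h/2\<close>.\<close>

lemma renewal_iter_lower:
  assumes h: "h > 0" and c: "c > 0" and fc: "\<And>x. 0 \<le> x \<Longrightarrow> x \<le> h \<Longrightarrow> c \<le> f x"
  shows "\<exists>e>0. \<forall>x. 0 \<le> x \<longrightarrow> x \<le> real (Suc n) * (h/2) \<longrightarrow> e \<le> renewal_iter (Suc n) x"
proof (induction n)
  case 0
  have "conv f (\<lambda>_. 0) x = 0" for x by (simp add: conv_def)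
  then show ?case using h fc by (intro exI[of _ c]) (auto simp: c)
next
  case (Suc n)
  then obtain e where e: "e > 0" "\<And>x. 0 \<le> x \<Longrightarrow> x \<le> real (Suc n) * (h/2) \<Longrightarrow> e \<le> renewal_iter (Suc n) x" by blast
  show ?case
  proof (intro exI[of _ "min e (c * e * (h/2))"] conjI allI impI)
    fix x assume x: "0 \<le> x" "x \<le> real (Suc (Suc n)) * (h/2)"
    show "min e (c * e * (h/2)) \<le> renewal_iter (Suc (Suc n)) x"
    proof (cases "x \<le> real (Suc n) * (h/2)")
      case True
      then show ?thesis using e(2)[of x] x(1) renewal_iter_mono[of "Suc n" x] by linarith
    next
      case False
      let ?I = "{real n * (h/2)..real (Suc n) * (h/2)}"
      have len: "real (Suc n) * (h/2) - real n * (h/2) = h/2" by (simp add: algebra_simps)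
      have "c * e * (h/2) = (LINT y|lborel. c * e * indicator ?I y)"
        using h len by simp
      also have "\<dots> \<le> conv f (renewal_iter (Suc n)) x" unfolding conv_def
      proof (rule integral_mono)
        show "integrable lborel (\<lambda>y. f (x - y) * renewal_iter (Suc n) y)"
          by (intro conv_integrable causal_f causal_renewal_iter)
        show "c * e * indicator ?I y \<le> f (x - y) * renewal_iter (Suc n) y" for y
        proof (cases "y \<in> ?I")
          case True
          have "0 \<le> real n * (h/2)" using h by simp
          then have "0 \<le> y" using True by (meson atLeastAtMost_iff order_trans)
          moreover have "0 \<le> x - y" "x - y \<le> h"
            using True False x by (auto simp: algebra_simps)
          ultimately have "c * e \<le> f (x - y) * renewal_iter (Suc n) y"
            using True fc e c by (intro mult_mono f_nonneg) auto
          then show ?thesis using True by simp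
        qed (simp add: f_nonneg renewal_iter_nonneg del: renewal_iter.simps)
      qed (auto simp: emeasure_lborel_Icc_eq)
      also have "\<dots> \<le> renewal_iter (Suc (Suc n)) x" using f_nonneg[of x] by simp
      finally show ?thesis by linarith
    qed
  qed (use e c h in auto)
qed

text \<open>By \<open>U = f + conv f U\<close>, convolving \<open>U\<close> with \<open>f\<close>
  does not increase it; hence each convolution power of \<open>f\<close> keeps it below
  \<open>U\<close>, and \<open>renewal_iter n\<close> contains n of them.\<close>

lemma conv_renewal_iter_U: "conv (renewal_iter n) U x \<le> real n * U x"
proof (induction n arbitrary: x)
  case 0 then show ?case by (simp add: conv_def)
next
  case (Suc n)
  have "conv (renewal_iter (Suc n)) U x = conv f U x + conv (conv f (renewal_iter n)) U x"
    by (simp, intro conv_add_left causal_U causal_f causal_conv causal_renewal_iter)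
  also have "conv (conv f (renewal_iter n)) U x = conv f (conv (renewal_iter n) U) x"
    by (intro conv_assoc[symmetric] causal_U causal_f causal_renewal_iter)
  also have "\<dots> \<le> conv f (\<lambda>y. real n * U y) x"
    by (intro conv_mono causal_f causal_conv causal_U causal_renewal_iter causal_mult_left mult_left_mono Suc f_nonneg)
  also have "\<dots> = real n * conv f U x" by (rule conv_mult_right)
  also have "conv f U x + real n * conv f U x = real (Suc n) * conv f U x" by (simp add: algebra_simps)
  also have "\<dots> \<le> real (Suc n) * U x" using U_eq[of x] f_nonneg[of x] by (intro mult_left_mono) auto
  finally show ?case by simp
qed

text \<open>
  If \<open>d = g + conv f d\<close>, then \<open>flow g d u\<close> is the free term of the renewal equation for \<open>d\<close> restarted
  at time \<open>u\<close>.
\<close>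

definition flow :: "(real \<Rightarrow> real) \<Rightarrow> (real \<Rightarrow> real) \<Rightarrow> real \<Rightarrow> real \<Rightarrow> real" where
  "flow g d u x = (if x < 0 then 0 else g (x + u) + conv f (\<lambda>y. if y < u then d y else 0) (x + u))"

lemma causal_flow:
  assumes "causal g" "causal d" shows "causal (flow g d u)"
proof -
  have "flow g d u = (\<lambda>x. if x < 0 then 0 else (\<lambda>x. g x + conv f (\<lambda>y. if y < u then d y else 0) x) (u + x))"
    by (auto simp: flow_def add.commute)
  moreover have "causal \<dots>"
    by (rule causal_shift) (intro causal_add causal_conv causal_f causal_truncate assms)
  ultimately show ?thesis by simp
qed

lemma flow_renewal:
  assumes g: "causal g" and d: "causal d" and eq: "\<And>x. d x = g x + conv f d x" and u: "0 \<le> u"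
  shows "(if x < 0 then 0 else d (u + x)) = flow g d u x + conv f (\<lambda>y. if y < 0 then 0 else d (u + y)) x"
proof (cases "x < 0")
  case True
  then show ?thesis
    using causal_neg[OF causal_conv[OF causal_f causal_shift[OF d]], of x u] by (simp add: flow_def)
next
  case False
  have "d (u + x) = g (x + u) + conv f d (x + u)" by (subst eq) (simp add: add.commute)
  then show ?thesis using conv_shift[OF causal_f d u, of x] False by (simp add: flow_def)
qed

text \<open>Semigroup property of restarting; it lets an estimate for one restart be repeated from
  every later time.\<close>

lemma flow_flow:
  assumes g: "causal g" and d: "causal d" and u: "0 \<le> u" and v: "0 \<le> v"
  shows "flow (flow g d u) (\<lambda>y. if y < 0 then 0 else d (u + y)) v = flow g d (u + v)"
proof
  fix x
  show "flow (flow g d u) (\<lambda>y. if y < 0 then 0 else d (u + y)) v x = flow g d (u + v) x"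
  proof (cases "x < 0")
    case False
    let ?d = "\<lambda>y. if y < u + v then d y else 0"
    have "conv f ?d ((x + v) + u) = conv f (\<lambda>y. if y < u then ?d y else 0) ((x + v) + u)
        + conv f (\<lambda>y. if y < 0 then 0 else ?d (u + y)) (x + v)"
      by (intro conv_shift causal_f causal_truncate d u)
    also have "(\<lambda>y. if y < u then ?d y else 0) = (\<lambda>y. if y < u then d y else 0)" using v by auto
    also have "(\<lambda>y. if y < 0 then 0 else ?d (u + y)) = (\<lambda>y. if y < v then if y < 0 then 0 else d (u + y) else 0)"
      using v by auto
    finally show ?thesis using False v by (simp add: flow_def algebra_simps)
  qed (simp add: flow_def)
qed

text \<open>Tonelli: a source at \<open>y\<close> puts the mass \<open>k (a - y)\<close> beyond
  \<open>a\<close>. The support condition ensures \<open>y < u \<le> a\<close>, where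
  \<open>k (a - y)\<close> is indeed the tail integral of \<open>f\<close>.\<close>

lemma conv_f_tail_nonneg:
  assumes p: "causal p" "\<And>y. p y \<ge> 0" "\<And>y. u \<le> y \<Longrightarrow> p y = 0" and a: "0 \<le> a" "u \<le> a"
  shows "integrable lborel (\<lambda>x. indicator {a<..} x * conv f p x)" (is ?int)
    and "tail (conv f p) a = conv k p a" (is ?eq)
proof -
  have [measurable]: "p \<in> borel_measurable borel" "conv f p \<in> borel_measurable borel"
    by (intro causal_measurable causal_conv causal_f p)+
  have in1: "(\<integral>\<^sup>+x. indicator {a<..} x * ennreal (f (x - y)) \<partial>lborel) * ennreal (p y) = ennreal (k (a - y) * p y)" for y
  proof (cases "u \<le> y")
    case False
    then have ay: "0 \<le> a - y" using a by simp
    have "(\<integral>\<^sup>+x. indicator {a<..} x * ennreal (f (x - y)) \<partial>lborel)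
        = (\<integral>\<^sup>+x. indicator {a<..} (y + 1 * x) * ennreal (f (y + 1 * x - y)) \<partial>lborel)"
      by (subst nn_integral_real_affine[where c=1 and t=y]) auto
    also have "\<dots> = (\<integral>\<^sup>+x. ennreal (indicator {a-y<..} x * f x) \<partial>lborel)"
      by (intro nn_integral_cong) (auto simp: indicator_def)
    also have "\<dots> = ennreal (k (a - y))"
      unfolding k_tail[OF ay]
      by (intro nn_integral_eq_integral integrable_indicator_f) (auto simp: f_nonneg)
    finally show ?thesis using k_nonneg p by (simp add: ennreal_mult)
  qed (simp add: p)
  have "(\<integral>\<^sup>+x. ennreal (indicator {a<..} x * conv f p x) \<partial>lborel)
      = (\<integral>\<^sup>+x. \<integral>\<^sup>+y. indicator {a<..} x * ennreal (f (x - y)) * ennreal (p y) \<partial>lborel \<partial>lborel)"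
  proof (intro nn_integral_cong)
    fix x
    have "ennreal (conv f p x) = (\<integral>\<^sup>+y. ennreal (f (x - y) * p y) \<partial>lborel)"
      unfolding conv_def
      by (intro nn_integral_eq_integral[symmetric] conv_integrable causal_f p) (auto simp: f_nonneg p)
    then show "ennreal (indicator {a<..} x * conv f p x)
        = (\<integral>\<^sup>+y. indicator {a<..} x * ennreal (f (x - y)) * ennreal (p y) \<partial>lborel)"
      by (auto simp: indicator_def ennreal_mult f_nonneg p)
  qed
  also have "\<dots> = (\<integral>\<^sup>+y. \<integral>\<^sup>+x. indicator {a<..} x * ennreal (f (x - y)) * ennreal (p y) \<partial>lborel \<partial>lborel)"
    by (rule lborel_pair.Fubini') auto
  also have "\<dots> = (\<integral>\<^sup>+y. ennreal (k (a - y) * p y) \<partial>lborel)"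
    by (simp add: nn_integral_multc in1)
  also have "\<dots> = ennreal (conv k p a)"
    unfolding conv_def
    by (intro nn_integral_eq_integral conv_integrable causal_k p) (auto simp: k_nonneg p)
  finally have *: "(\<integral>\<^sup>+x. ennreal (indicator {a<..} x * conv f p x) \<partial>lborel) = ennreal (conv k p a)" .
  have nn: "0 \<le> conv f p x" "0 \<le> conv k p x" for x by (auto intro!: conv_nonneg simp: f_nonneg k_nonneg p)
  show ?int by (rule integrableI_nonneg) (auto simp: * nn)
  show ?eq unfolding tail_def by (rule integral_eq_nn_integral[THEN trans]) (auto simp: * nn)
qed

text \<open>Signed sources: \<open>p\<close> is the difference of \<open>|p|\<close> and
  \<open>|p| - p\<close>, both nonnegative and supported before \<open>u\<close>.\<close>

lemma conv_f_tail:
  assumes p: "causal p" "\<And>y. u \<le> y \<Longrightarrow> p y = 0" and a: "0 \<le> a" "u \<le> a"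
  shows "integrable lborel (\<lambda>x. indicator {a<..} x * conv f p x)" (is ?int)
    and "tail (conv f p) a = conv k p a" (is ?eq)
proof -
  let ?p = "\<lambda>y. \<bar>p y\<bar>" and ?n = "\<lambda>y. \<bar>p y\<bar> - p y"
  have cp: "causal ?p" "causal ?n" by (intro causal_abs causal_diff p)+
  have P: "integrable lborel (\<lambda>x. indicator {a<..} x * conv f ?p x)" "tail (conv f ?p) a = conv k ?p a"
    by (rule conv_f_tail_nonneg[where u=u]; use cp p a in auto)+
  have N: "integrable lborel (\<lambda>x. indicator {a<..} x * conv f ?n x)" "tail (conv f ?n) a = conv k ?n a"
    by (rule conv_f_tail_nonneg[where u=u]; use cp p a in auto)+
  have p': "p = (\<lambda>y. ?p y - ?n y)" by auto
  have eq: "conv f p x = conv f ?p x - conv f ?n x" "conv k p x = conv k ?p x - conv k ?n x" for x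
    by (subst p', intro conv_diff_right causal_f causal_k cp)+
  show ?int using Bochner_Integration.integrable_diff[OF P(1) N(1)] unfolding eq by (simp add: algebra_simps)
  show ?eq using Bochner_Integration.integral_diff[OF P(1) N(1)] P(2) N(2) unfolding eq tail_def
    by (simp add: algebra_simps)
qed

end

section \<open>The rate in the renewal theorem\<close>

text \<open>As \<open>k\<close> is the survival function of the law with density \<open>f\<close>,
  the tail bound is what a finite moment of order \<open>1 + q\<close> of that law yields.\<close>

locale renewal_density_moment = renewal_density +
  fixes q B :: real
  assumes q_pos: "q > 0" and k_integrable: "integrable lborel k"
    and k_tail_le: "R \<ge> 1 \<Longrightarrow> tail k R \<le> B * R powr (-q)"
begin

lemma B_nonneg: "B \<ge> 0"
  using k_tail_le[of 1] tail_nonneg[of k 1] k_nonneg by simp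

text \<open>Sources before \<open>u\<close> have age above \<open>r\<close> at time
  \<open>r + u\<close>, so they meet only the part of \<open>k\<close> beyond \<open>r\<close>. The
  bound does not depend on \<open>u\<close>.\<close>

lemma conv_k_le_tail:
  assumes p: "causal p" "\<And>y. y < u \<Longrightarrow> 0 \<le> p y \<and> p y \<le> G" "\<And>y. u \<le> y \<Longrightarrow> p y = 0" and r: "0 \<le> r" and G: "0 \<le> G"
  shows "conv k p (r + u) \<le> G * tail k r"
proof -
  have "conv k p (r + u) \<le> (LINT y|lborel. G * (indicator {r<..} (r + u - y) * k (r + u - y)))"
    unfolding conv_def
  proof (rule integral_mono)
    show "integrable lborel (\<lambda>y. k (r + u - y) * p y)" by (intro conv_integrable causal_k p)
    have "integrable lborel (\<lambda>y. indicator {r<..} (r + u + (-1) * y) * k (r + u + (-1) * y))"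
      by (rule lborel_integrable_real_affine) (auto intro!: integrable_indicator_mult k_integrable)
    then show "integrable lborel (\<lambda>y. G * (indicator {r<..} (r + u - y) * k (r + u - y)))" by simp
    show "k (r + u - y) * p y \<le> G * (indicator {r<..} (r + u - y) * k (r + u - y))" for y
      using p(2)[of y] p(3)[of y] k_nonneg G by (auto simp: indicator_def mult.commute[of G] mult_left_mono)
  qed
  also have "\<dots> = G * tail k r"
    unfolding tail_def
    using lborel_integral_real_affine[of "-1" "\<lambda>y. indicator {r<..} y * k y" "r + u"] by simp
  finally show ?thesis .
qed

lemma powr_small: assumes "e > 0" obtains L where "L \<ge> 1" "B * L powr (-q) \<le> e"
proof -
  have "((\<lambda>L. B * L powr (-q)) \<longlongrightarrow> B * 0) at_top"
    using q_pos by (intro tendsto_intros tendsto_neg_powr filterlim_ident) auto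
  then have "\<forall>\<^sub>F L in at_top. B * L powr (-q) < e" by (rule order_tendstoD(2)) (use assms in simp)
  then obtain N where "\<And>L. L \<ge> N \<Longrightarrow> B * L powr (-q) < e" by (auto simp: eventually_at_top_linorder)
  then show thesis using that[of "max 1 N"] by (simp add: less_imp_le)
qed

lemma k_le_powr: assumes "R \<ge> 1" shows "R * k (2 * R) \<le> B * R powr (-q)"
  using antimono_le_tail[OF k_integrable k_nonneg k_anti, of R "2 * R"] k_tail_le[OF assms] assms by simp

text \<open>For large \<open>x\<close>, \<open>conv k U = 1 - k\<close> with
  \<open>k \<le> 1\<close> forces \<open>U\<close> to have mass at least 1/2 on
  \<open>{x-L..x}\<close>. Convolution with \<open>renewal_iter (Suc n)\<close>, which is at least
  \<open>d\<close> on \<open>{0..L}\<close>, smears this mass into a pointwise bound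
  \<open>d/2\<close>; the same convolution is at most \<open>Suc n\<close> times
  \<open>U x\<close>.\<close>

lemma U_lower: obtains c where "0 < c" "c < 1" "\<And>x. 0 \<le> x \<Longrightarrow> c \<le> U x"
proof -
  \<comment> \<open>Of the total 1, a quarter is given up for \<open>k x\<close> and a quarter for
    the sources before \<open>x - L\<close>, which weigh at most
    \<open>5 * \<alpha> * tail k L\<close> since \<open>U \<le> 5 * \<alpha>\<close>. One half
    remains.\<close>
  define e where "e = min (1/4) (1 / (20 * \<alpha>))"
  have e: "e > 0" "e \<le> 1/4" "5 * \<alpha> * e \<le> 1/4"
    using alpha_pos mult_left_mono[of e "1/(20*\<alpha>)" "5*\<alpha>"] by (auto simp: e_def)
  obtain L0 where L0: "L0 \<ge> 1" "B * L0 powr (-q) \<le> e" using powr_small[OF e(1)] by blast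
  define L where "L = 2 * L0"
  have "1 * k L \<le> L0 * k L" using L0 k_nonneg by (intro mult_right_mono) auto
  then have kL: "k L \<le> 1/4" using k_le_powr[of L0] L0 e by (simp add: L_def)
  have "tail k L \<le> tail k L0" using k_integrable k_nonneg L0 by (intro tail_antimono) (auto simp: L_def)
  then have "tail k L \<le> e" using k_tail_le[OF L0(1)] L0(2) by linarith
  then have "5 * \<alpha> * tail k L \<le> 5 * \<alpha> * e" using alpha_pos by (intro mult_left_mono) auto
  then have tL: "5 * \<alpha> * tail k L \<le> 1/4" using e by linarith
  have win: "1/2 \<le> (LINT y|lborel. indicator {x-L..x} y * U y)"
    and win_int: "integrable lborel (\<lambda>y. indicator {x-L..x} y * U y)" if x: "x \<ge> L" for x
  proof -
    let ?p = "\<lambda>y. if y < x - L then U y else 0" and ?b = "\<lambda>y. if y < x - L then 0 else U y"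
    have cb: "causal ?b"
    proof -
      have "?b = (\<lambda>y. U y - ?p y)" by auto
      then show ?thesis by (simp only:) (intro causal_diff causal_U causal_truncate)
    qed
    have "conv unit_step ?b x = (LINT y|lborel. indicator {x-L..x} y * U y)"
      unfolding conv_unit_step by (intro Bochner_Integration.integral_cong) (auto simp: indicator_def)
    moreover have "conv k ?b x \<le> conv unit_step ?b x"
      by (intro conv_mono causal_k cb causal_unit_step mult_right_mono) (auto simp: k_le U_nonneg)
    moreover have "conv k U x = conv k (\<lambda>y. ?p y + ?b y) x" by (rule arg_cong[where f="\<lambda>g. conv k g x"]) auto
    moreover have "\<dots> = conv k ?p x + conv k ?b x"
      by (intro conv_add_right causal_k causal_truncate causal_U cb)
    moreover have "conv k ?p (L + (x - L)) \<le> 5 * \<alpha> * tail k L"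
      using L0 alpha_pos U_nonneg U_le
      by (intro conv_k_le_tail causal_truncate causal_U) (auto simp: L_def)
    moreover have "k x \<le> 1/4" using k_anti[of L x] kL x L0 by (auto simp: L_def)
    moreover have "conv k U x = 1 - k x" using x L0 unfolding conv_k_U conv_step_f by (auto simp: L_def)
    ultimately show "1/2 \<le> (LINT y|lborel. indicator {x-L..x} y * U y)" using tL by simp
    have "(\<lambda>y. unit_step (x - y) * ?b y) = (\<lambda>y. indicator {x-L..x} y * U y)" by (auto simp: indicator_def)
    then show "integrable lborel (\<lambda>y. indicator {x-L..x} y * U y)"
      using conv_integrable[OF causal_unit_step cb, of x] by simp
  qed
  obtain h c where hc: "h > 0" "c > 0" "\<And>x. 0 \<le> x \<Longrightarrow> x \<le> h \<Longrightarrow> c \<le> f x" using f_pos_near_0 by blast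
  obtain n where n: "L / (h/2) \<le> real n" using real_arch_simple by blast
  then have "L \<le> real (Suc n) * (h/2)" using hc by (simp add: field_simps)
  then obtain d where d: "d > 0" "\<And>x. 0 \<le> x \<Longrightarrow> x \<le> L \<Longrightarrow> d \<le> renewal_iter (Suc n) x"
    using renewal_iter_lower[OF hc, of n] by (meson order_trans)
  define c' where "c' = min (1/2) (min d (d / (2 * real (Suc n))))"
  show thesis
  proof (rule that[of c'])
    show "0 < c'" "c' < 1" using d by (auto simp: c'_def)
    fix x :: real assume x0: "0 \<le> x"
    show "c' \<le> U x"
    proof (cases "x \<le> L")
      case True then show ?thesis using d(2)[OF x0] renewal_iter_le_U[of "Suc n" x] by (simp add: c'_def del: renewal_iter.simps)
    next
      case False
      then have x: "x \<ge> L" by simp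
      have "d * (1/2) \<le> d * (LINT y|lborel. indicator {x-L..x} y * U y)" using win[OF x] d by (intro mult_left_mono) auto
      also have "\<dots> = (LINT y|lborel. d * (indicator {x-L..x} y * U y))" by simp
      also have "\<dots> \<le> conv (renewal_iter (Suc n)) U x" unfolding conv_def
      proof (rule integral_mono)
        show "integrable lborel (\<lambda>y. d * (indicator {x-L..x} y * U y))" using win_int[OF x] by simp
        show "integrable lborel (\<lambda>y. renewal_iter (Suc n) (x - y) * U y)" by (intro conv_integrable causal_renewal_iter causal_U)
        show "d * (indicator {x-L..x} y * U y) \<le> renewal_iter (Suc n) (x - y) * U y" for y
        proof (cases "y \<in> {x-L..x}")
          case True then show ?thesis using d(2)[of "x - y"] U_nonneg[of y] by (simp add: mult_right_mono del: renewal_iter.simps)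
        qed (simp add: renewal_iter_nonneg U_nonneg del: renewal_iter.simps)
      qed
      also have "\<dots> \<le> real (Suc n) * U x" by (rule conv_renewal_iter_U)
      finally have "d / (2 * real (Suc n)) \<le> U x" by (simp add: field_simps)
      then show ?thesis by (simp add: c'_def)
    qed
  qed
qed

text \<open>The number is the integral of \<open>k\<close> over \<open>{0..1}\<close>. It is
  positive because \<open>k\<close> starts at 1 and decreases at rate at most \<alpha>, so that it
  stays above 1/2 on \<open>{0..s}\<close>.\<close>

lemma kappa_bounds: "0 < conv k unit_step 1" "conv k unit_step 1 \<le> 1"
proof -
  have "conv k unit_step 1 \<le> conv unit_step unit_step 1"
    by (intro conv_mono causal_k causal_unit_step mult_right_mono) (auto simp: k_le)
  also have "(\<lambda>y. indicator {..1} y * unit_step y) = indicator {0..1::real}" by (auto simp: indicator_def)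
  then have "conv unit_step unit_step 1 = 1" unfolding conv_unit_step by simp
  finally show "conv k unit_step 1 \<le> 1" .
  define s where "s = min 1 (1 / (2 * \<alpha>))"
  have s: "0 < s" "s \<le> 1" "s * \<alpha> \<le> 1/2" using alpha_pos by (auto simp: s_def min_def field_simps)
  have ks: "1/2 \<le> k y" if "0 \<le> y" "y \<le> s" for y
  proof -
    have "y * \<alpha> \<le> s * \<alpha>" using that alpha_pos by (intro mult_right_mono) auto
    then show ?thesis using k_diff_le[of 0 y] that s(3) k_0 by simp
  qed
  have "s / 2 = (LINT y|lborel. 1/2 * indicator {1-s..1} y)" using s by simp
  also have "\<dots> \<le> conv k unit_step 1" unfolding conv_def
  proof (rule integral_mono)
    show "1/2 * indicator {1-s..1} y \<le> k (1 - y) * unit_step y" for y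
      using ks[of "1 - y"] s k_nonneg[of "1 - y"] by (auto simp: indicator_def)
  qed (auto simp: emeasure_lborel_Icc_eq intro!: conv_integrable causal_k causal_unit_step)
  finally show "0 < conv k unit_step 1" using s by simp
qed

text \<open>The truncated history is supported before \<open>u\<close>, so
  \<open>conv_f_tail\<close> turns its tail integrals into values of a convolution with
  \<open>k\<close>.\<close>

lemma flow_integrable_tail:
  assumes g: "causal g" "integrable lborel g" and d: "causal d" and u: "0 \<le> u" and r: "0 \<le> r"
  shows "integrable lborel (flow g d u)"
    and "tail (\<lambda>x. \<bar>flow g d u x\<bar>) r \<le> tail (\<lambda>x. \<bar>g x\<bar>) (r + u) + conv k (\<lambda>y. if y < u then \<bar>d y\<bar> else 0) (r + u)"
    and "tail (flow g d u) 0 = tail g u + conv k d u"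
proof -
  let ?d = "\<lambda>y. if y < u then d y else 0" and ?a = "\<lambda>y. if y < u then \<bar>d y\<bar> else 0"
  have cd: "causal ?d" "causal ?a" by (intro causal_truncate causal_abs d)+
  have [measurable]: "g \<in> borel_measurable borel" "flow g d u \<in> borel_measurable borel"
    "conv f ?d \<in> borel_measurable borel" "conv f ?a \<in> borel_measurable borel"
    by (intro causal_measurable g causal_flow d causal_conv causal_f cd)+
  have shiftint: "integrable lborel (\<lambda>x. indicator {r<..} x * F (x + u))"
    if "integrable lborel (\<lambda>x. indicator {r+u<..} x * F x)" for F :: "real \<Rightarrow> real" and r
    using lborel_integrable_real_affine[OF that, of 1 u] by (simp add: indicator_def add.commute cong: if_cong)
  have ia: "integrable lborel (\<lambda>x. indicator {r<..} x * conv f ?a (x + u))" if "0 \<le> r" for r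
    by (rule shiftint, rule conv_f_tail[where u=u]) (use cd u that in auto)
  have id: "integrable lborel (\<lambda>x. indicator {r<..} x * conv f ?d (x + u))" if "0 \<le> r" for r
    by (rule shiftint, rule conv_f_tail[where u=u]) (use cd u that in auto)
  have ig: "integrable lborel (\<lambda>x. indicator {r<..} x * g (x + u))" for r
    by (rule shiftint, rule integrable_indicator_mult[OF g(2)]) auto
  have "integrable lborel (\<lambda>x. indicator {0<..} x * g (x + u) + indicator {0<..} x * conv f ?d (x + u))"
    by (intro Bochner_Integration.integrable_add ig id) auto
  also have "(\<lambda>x. indicator {0<..} x * g (x + u) + indicator {0<..} x * conv f ?d (x + u)) =
       (\<lambda>x. indicator {0<..} x * flow g d u x)"
    by (auto simp: flow_def indicator_def)
  finally have int0: "integrable lborel (\<lambda>x. indicator {0<..} x * flow g d u x)" .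
  have ae: "AE x in lborel. flow g d u x = indicator {0<..} x * flow g d u x"
    using AE_lborel_singleton[of 0] by (rule eventually_mono) (auto simp: indicator_def flow_def)
  show int: "integrable lborel (flow g d u)"
    by (subst integrable_cong_AE[OF _ _ ae]) (auto intro: int0)
  have "tail (\<lambda>x. \<bar>flow g d u x\<bar>) r \<le> (LINT x|lborel. indicator {r<..} x * \<bar>g (x + u)\<bar> + indicator {r<..} x * conv f ?a (x + u))"
    unfolding tail_def
  proof (rule integral_mono)
    show "integrable lborel (\<lambda>x. indicator {r<..} x * \<bar>flow g d u x\<bar>)"
      using int by (intro integrable_indicator_mult integrable_abs) auto
    have "integrable lborel (\<lambda>x. indicator {r<..} x * \<bar>g (x + u)\<bar>)"
      using integrable_abs[OF ig[of r]] by (simp add: abs_mult)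
    then show "integrable lborel (\<lambda>x. indicator {r<..} x * \<bar>g (x + u)\<bar> + indicator {r<..} x * conv f ?a (x + u))"
      by (intro Bochner_Integration.integrable_add ia r)
    show "indicator {r<..} x * \<bar>flow g d u x\<bar> \<le> indicator {r<..} x * \<bar>g (x + u)\<bar> + indicator {r<..} x * conv f ?a (x + u)" for x
    proof -
      have "\<bar>conv f ?d (x + u)\<bar> \<le> conv f (\<lambda>y. \<bar>?d y\<bar>) (x + u)" by (rule conv_abs_le[OF f_nonneg])
      also have "(\<lambda>y. \<bar>?d y\<bar>) = ?a" by auto
      finally show ?thesis using r by (auto simp: flow_def indicator_def)
    qed
  qed
  also have "\<dots> = (LINT x|lborel. indicator {r<..} x * \<bar>g (x + u)\<bar>) + (LINT x|lborel. indicator {r<..} x * conv f ?a (x + u))"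
    using integrable_abs[OF ig[of r]] by (intro Bochner_Integration.integral_add ia r) (simp add: abs_mult)
  also have "\<dots> = tail (\<lambda>x. \<bar>g x\<bar>) (r + u) + tail (conv f ?a) (r + u)" by (simp add: tail_shift)
  also have "tail (conv f ?a) (r + u) = conv k ?a (r + u)"
    by (rule conv_f_tail[where u=u]) (use cd u r in auto)
  finally show "tail (\<lambda>x. \<bar>flow g d u x\<bar>) r \<le> tail (\<lambda>x. \<bar>g x\<bar>) (r + u) + conv k ?a (r + u)" .
  have "tail (flow g d u) 0 = (LINT x|lborel. indicator {0<..} x * g (x + u) + indicator {0<..} x * conv f ?d (x + u))"
    unfolding tail_def by (intro Bochner_Integration.integral_cong) (auto simp: flow_def indicator_def)
  also have "\<dots> = tail g (0 + u) + tail (conv f ?d) (0 + u)"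
    unfolding tail_shift by (intro Bochner_Integration.integral_add ig id) auto
  also have "tail (conv f ?d) (0 + u) = conv k ?d u"
    by (simp, rule conv_f_tail[where u=u]) (use cd u in auto)
  also have "conv k ?d u = conv k d u"
    unfolding conv_def
  proof (rule integral_cong_AE)
    have [measurable]: "d \<in> borel_measurable borel" by (rule causal_measurable[OF d])
    show "(\<lambda>y. k (u - y) * ?d y) \<in> borel_measurable lborel" "(\<lambda>y. k (u - y) * d y) \<in> borel_measurable lborel" by measurable
    show "AE y in lborel. k (u - y) * ?d y = k (u - y) * d y"
      using AE_lborel_singleton[of u] by (rule eventually_mono) (auto simp: k_neg)
  qed
  finally show "tail (flow g d u) 0 = tail g u + conv k d u" by simp
qed

lemma tail_0: "causal g \<Longrightarrow> integrable lborel g \<Longrightarrow> tail g 0 = (LINT x|lborel. g x)"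
proof -
  assume g: "causal g" "integrable lborel g"
  have [measurable]: "g \<in> borel_measurable borel" by (rule causal_measurable[OF g(1)])
  have "tail g 0 = (LINT x|lborel. indicator {0..} x * g x)" by (rule tail_closed[symmetric]) simp
  also have "\<dots> = (LINT x|lborel. g x)"
    by (rule Bochner_Integration.integral_cong) (auto simp: indicator_def not_le causal_neg[OF g(1)])
  finally show ?thesis .
qed

text \<open>By \<open>conv_k\<close>, \<open>conv k d u\<close> is the integral of \<open>g\<close>
  up to \<open>u\<close>, which completes \<open>tail g u\<close> to the full integral of
  \<open>g\<close>.\<close>

lemma flow_mean_zero:
  assumes g: "causal g" "integrable lborel g" and d: "causal d" and eq: "\<And>x. d x = g x + conv f d x"
    and u: "0 \<le> u" and zero: "(LINT x|lborel. g x) = 0"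
  shows "(LINT x|lborel. flow g d u x) = 0"
proof -
  have "(LINT x|lborel. flow g d u x) = tail g u + conv k d u"
    using flow_integrable_tail[OF g d u order_refl] causal_flow[OF g(1) d] tail_0 by metis
  also have "conv k d u = conv unit_step g u" by (rule conv_k[OF d g(1) eq])
  finally show ?thesis using tail_split[OF g, of u] zero by simp
qed

text \<open>
  The positive part \<open>c\<close> split off from the renewal density acts on the mean-zero function \<open>g\<close>
  through its primitive \<open>-(\<integral>\<^sub>v\<^sup>\<infinity> g)\<close> instead of through \<open>\<integral>\<^sub>0\<^sup>v \<bar>g\<bar>\<close>. This cancellation is the gain.
\<close>

lemma flow_contraction:
  assumes g: "causal g" "integrable lborel g" and d: "causal d" and eq: "\<And>x. d x = g x + conv f d x"
    and zero: "(LINT x|lborel. g x) = 0" and R: "2 \<le> R"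
    and c: "0 < c" "\<And>x. 0 \<le> x \<Longrightarrow> c \<le> U x"
  defines "\<delta> \<equiv> c * conv k unit_step 1"
  shows "(LINT x|lborel. \<bar>flow g d R x\<bar>) \<le> (1 - \<delta>) * (LINT x|lborel. \<bar>g x\<bar>) + 2 * \<delta> * tail (\<lambda>x. \<bar>g x\<bar>) (R/2)"
proof -
  let ?g = "\<lambda>x. \<bar>g x\<bar>"
  have cg: "causal ?g" by (intro causal_abs g)
  have ig: "integrable lborel ?g" by (intro integrable_abs g)
  define N where "N = (LINT x|lborel. ?g x)"
  define T where "T = tail ?g (R/2)"
  \<comment> \<open>\<open>E\<close> solves the renewal equation with free term \<open>|g|\<close>
    and dominates \<open>|d|\<close>. Used alone it would show only that restarting does not
    increase the norm.\<close>
  define E where "E = (\<lambda>x. ?g x + conv U ?g x)"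
  have cE: "causal E" unfolding E_def by (intro causal_add cg causal_conv causal_U)
  \<comment> \<open>The gain is collected on the last unit window \<open>{R-1..R}\<close> only. Its
    weight \<open>conv k J R\<close> is then the integral of \<open>k\<close> over
    \<open>{0..1}\<close>, independent of \<open>R\<close>.\<close>
  define J where "J = (\<lambda>y. if y < 0 then 0 else unit_step (-(R - 1) + y))"
  have cJ: "causal J" unfolding J_def by (intro causal_shift causal_unit_step)
  have dv: "\<bar>d v\<bar> \<le> E v" for v
  proof -
    have "d v = g v + conv U g v" by (rule renewal_unique[OF g(1) d eq order_refl])
    also have "\<bar>\<dots>\<bar> \<le> E v" unfolding E_def using conv_abs_le[of U g v, OF U_nonneg] by linarith
    finally show ?thesis .
  qed
  \<comment> \<open>Since \<open>R \<ge> 2\<close>, such \<open>v\<close> are at least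
    \<open>R/2\<close>, so the tail of \<open>|g|\<close> beyond \<open>v\<close> is at most
    \<open>T\<close>. It is paid twice: as a bound for the primitive of \<open>g\<close>, and as the
    part of the mass \<open>N\<close> lying beyond \<open>v\<close>.\<close>
  have dv': "\<bar>d v\<bar> \<le> E v - c * (N - 2 * T)" if v: "R - 1 \<le> v" for v
  proof -
    let ?W = "\<lambda>x. U x - c * unit_step x"
    have cc: "causal (\<lambda>x. c * unit_step x)" by (intro causal_mult_left causal_unit_step)
    have W: "conv ?W p v = conv U p v - c * conv unit_step p v" if "causal p" for p
      using conv_diff_left[OF that causal_U cc, where x=v] conv_mult_right[of p c unit_step v]
      by (simp add: conv_commute[of _ p])
    have Wnn: "0 \<le> ?W x" for x using c(2)[of x] U_nonneg[of x] by (auto simp: indicator_def)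
    have "d v = g v + conv U g v" by (rule renewal_unique[OF g(1) d eq order_refl])
    also have "conv U g v = conv ?W g v + c * conv unit_step g v" using W[OF g(1)] by simp
    finally have "d v = g v + (conv ?W g v + c * conv unit_step g v)" .
    moreover have "\<bar>c * conv unit_step g v\<bar> = c * \<bar>conv unit_step g v\<bar>" using c(1) by (simp add: abs_mult)
    ultimately have 1: "\<bar>d v\<bar> \<le> \<bar>g v\<bar> + \<bar>conv ?W g v\<bar> + c * \<bar>conv unit_step g v\<bar>"
      by linarith
    have 2: "\<bar>conv ?W g v\<bar> \<le> conv U ?g v - c * conv unit_step ?g v"
      using conv_abs_le[of ?W g v] Wnn W[OF cg] by simp
    have "\<bar>conv unit_step g v\<bar> = \<bar>tail g v\<bar>" using tail_split[OF g, of v] zero by simp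
    also have "\<dots> \<le> tail ?g v" by (rule tail_abs)
    finally have 3: "\<bar>conv unit_step g v\<bar> \<le> tail ?g v" .
    have 4: "tail ?g v \<le> T" unfolding T_def using v R by (intro tail_antimono ig) auto
    have 5: "conv unit_step ?g v = N - tail ?g v" using tail_split[OF cg ig, of v] by (simp add: N_def)
    have "\<bar>d v\<bar> \<le> E v - c * (N - tail ?g v) + c * tail ?g v"
    proof -
      have "c * \<bar>conv unit_step g v\<bar> \<le> c * tail ?g v" using 3 c(1) by (intro mult_left_mono) auto
      then show ?thesis using 1 2[unfolded 5] unfolding E_def by linarith
    qed
    also have "\<dots> \<le> E v - c * (N - T) + c * T"
      using 4 c(1) by (intro add_mono diff_left_mono mult_left_mono) auto
    finally show ?thesis by (simp add: algebra_simps)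
  qed
  have "conv k (\<lambda>y. if y < R then \<bar>d y\<bar> else 0) R \<le> conv k (\<lambda>y. E y - c * (N - 2 * T) * J y) R"
  proof (intro conv_mono causal_k causal_truncate causal_abs d causal_diff cE causal_mult_left cJ mult_left_mono k_nonneg)
    fix y assume y: "0 \<le> y" "y \<le> R"
    have "0 \<le> E R" using dv[of R] by simp
    show "(if y < R then \<bar>d y\<bar> else 0) \<le> E y - c * (N - 2 * T) * J y"
      using dv[of y] dv'[of y] y by (auto simp: J_def indicator_def)
  qed
  also have "\<dots> = conv k E R - c * (N - 2 * T) * conv k J R"
    using conv_diff_right[OF causal_k cE causal_mult_left[OF cJ, of "c * (N - 2 * T)"], of R]
    by (simp add: conv_mult_right)
  also have "conv k J R = conv k unit_step 1"
  proof -
    have "conv k unit_step 1 = (LINT y|lborel. k (1 - (-(R - 1) + y)) * unit_step (-(R-1) + y))"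
      unfolding conv_def using lborel_integral_real_affine[of 1 "\<lambda>y. k (1 - y) * unit_step y" "-(R-1)"] by simp
    also have "\<dots> = conv k J R"
      unfolding conv_def by (rule Bochner_Integration.integral_cong) (use R in \<open>auto simp: J_def indicator_def algebra_simps\<close>)
    finally show ?thesis by simp
  qed
  also have "conv k E R = conv unit_step ?g R"
    by (intro conv_k cE cg renewal_solution) (simp_all add: E_def)
  finally have *: "conv k (\<lambda>y. if y < R then \<bar>d y\<bar> else 0) R \<le> conv unit_step ?g R - \<delta> * (N - 2 * T)"
    by (simp add: \<delta>_def algebra_simps)
  have fl: "causal (flow g d R)" "integrable lborel (flow g d R)"
    by (intro causal_flow g d) (rule flow_integrable_tail(1)[OF g d _ order_refl], use R in simp)
  have "(LINT x|lborel. \<bar>flow g d R x\<bar>) = tail (\<lambda>x. \<bar>flow g d R x\<bar>) 0"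
    by (rule tail_0[symmetric]) (intro causal_abs integrable_abs fl)+
  also have "\<dots> \<le> tail ?g (0 + R) + conv k (\<lambda>y. if y < R then \<bar>d y\<bar> else 0) (0 + R)"
    using R by (intro flow_integrable_tail(2) g d) auto
  also have "\<dots> \<le> tail ?g R + conv unit_step ?g R - \<delta> * (N - 2 * T)" using * by simp
  also have "\<dots> = N - \<delta> * (N - 2 * T)" using tail_split[OF cg ig, of R] by (simp add: N_def)
  finally show ?thesis by (simp add: N_def T_def algebra_simps)
qed


text \<open>The class of data over which the rate has to be uniform; one number \<open>G\<close>
  bounds all sizes, so later constants can depend on \<open>G\<close> alone.\<close>

definition centred :: "real \<Rightarrow> (real \<Rightarrow> real) \<Rightarrow> (real \<Rightarrow> real) \<Rightarrow> bool" where
  "centred G g d \<longleftrightarrow> causal g \<and> integrable lborel g \<and> (LINT x|lborel. g x) = 0 \<and> causal d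
     \<and> (\<forall>x. d x = g x + conv f d x) \<and> (\<forall>x. \<bar>d x\<bar> \<le> G) \<and> (LINT x|lborel. \<bar>g x\<bar>) \<le> G
     \<and> (\<forall>R\<ge>1. tail (\<lambda>x. \<bar>g x\<bar>) R \<le> G * R powr (-q))"

text \<open>As \<open>|d| \<le> G\<close>, the tails of all restarted free terms obey one bound,
  whatever the restart time. Contraction at each restart then gives exactly the recursion of
  \<open>powr_decay_iteration\<close>.\<close>

lemma flow_decay:
  assumes G: "G \<ge> 0"
  shows "\<exists>C\<ge>0. \<forall>g d. centred G g d \<longrightarrow> (\<forall>u\<ge>1. (LINT x|lborel. \<bar>flow g d u x\<bar>) \<le> C * u powr (-q))"
proof -
  obtain c where c: "0 < c" "c < 1" "\<And>x. 0 \<le> x \<Longrightarrow> c \<le> U x" using U_lower by blast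
  define \<delta> where "\<delta> = c * conv k unit_step 1"
  have "c * conv k unit_step 1 \<le> c * 1" using c kappa_bounds by (intro mult_left_mono) auto
  then have "c * conv k unit_step 1 < 1" using c(2) by linarith
  then have \<delta>: "0 < \<delta>" "\<delta> < 1" using c(1) kappa_bounds(1) by (simp_all add: \<delta>_def)
  define A where "A = G + G * tail k 0"
  define Q where "Q = G + G * B"
  have A: "A \<ge> 0" and Q: "Q \<ge> 0"
    using G B_nonneg tail_nonneg[of k 0] k_nonneg by (auto simp: A_def Q_def)
  obtain C where C: "C \<ge> 0" "\<forall>a. (\<forall>u\<ge>0. a u \<le> A) \<longrightarrow>
     (\<forall>u\<ge>0. \<forall>R\<ge>2. a (u + R) \<le> (1 - \<delta>) * a u + 2 * \<delta> * (Q * (R/2) powr (-q))) \<longrightarrow>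
     (\<forall>t\<ge>1. a t \<le> C * t powr (-q))"
    using powr_decay_iteration[OF q_pos \<delta> Q A] by blast
  show ?thesis
  proof (intro exI[of _ C] conjI allI impI C(1))
    fix g d u
    assume cen: "centred G g d" and u: "(1::real) \<le> u"
    have g: "causal g" "integrable lborel g" and zero: "(LINT x|lborel. g x) = 0" and d: "causal d"
      and eq: "\<forall>x. d x = g x + conv f d x" and dG: "\<forall>x. \<bar>d x\<bar> \<le> G"
      and gG: "(LINT x|lborel. \<bar>g x\<bar>) \<le> G" and gt: "\<forall>R\<ge>1. tail (\<lambda>x. \<bar>g x\<bar>) R \<le> G * R powr (-q)"
      using cen unfolding centred_def by blast+
    let ?g = "\<lambda>x. \<bar>g x\<bar>"
    have cg: "causal ?g" "integrable lborel ?g" by (intro causal_abs integrable_abs g)+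
    define a where "a = (\<lambda>u. LINT x|lborel. \<bar>flow g d u x\<bar>)"
    have cf: "causal (flow g d u)" for u by (intro causal_flow g d)
    have fi: "integrable lborel (flow g d u)" if "0 \<le> u" for u
      by (rule flow_integrable_tail(1)[OF g d that order_refl])
    have ft: "tail (\<lambda>x. \<bar>flow g d u x\<bar>) r \<le> tail ?g r + G * tail k r" if "0 \<le> u" "0 \<le> r" for u r
    proof -
      have "tail (\<lambda>x. \<bar>flow g d u x\<bar>) r \<le> tail ?g (r + u) + conv k (\<lambda>y. if y < u then \<bar>d y\<bar> else 0) (r + u)"
        by (rule flow_integrable_tail(2)[OF g d that])
      also have "tail ?g (r + u) \<le> tail ?g r" by (rule tail_antimono) (use cg that in auto)
      also have "conv k (\<lambda>y. if y < u then \<bar>d y\<bar> else 0) (r + u) \<le> G * tail k r"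
        using dG that G by (intro conv_k_le_tail causal_truncate causal_abs d) auto
      finally show ?thesis by simp
    qed
    have "\<forall>u\<ge>0. a u \<le> A"
    proof (intro allI impI)
      fix u :: real assume u: "0 \<le> u"
      have "a u = tail (\<lambda>x. \<bar>flow g d u x\<bar>) 0"
        unfolding a_def by (rule tail_0[symmetric]) (intro causal_abs integrable_abs cf fi u)+
      also have "\<dots> \<le> tail ?g 0 + G * tail k 0" by (rule ft[OF u order_refl])
      also have "tail ?g 0 \<le> G" using tail_0[OF cg] gG by simp
      finally show "a u \<le> A" by (simp add: A_def)
    qed
    moreover have "\<forall>u\<ge>0. \<forall>R\<ge>2. a (u + R) \<le> (1 - \<delta>) * a u + 2 * \<delta> * (Q * (R/2) powr (-q))"
    proof (intro allI impI)
      fix u R :: real assume u: "0 \<le> u" and R: "2 \<le> R"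
      let ?d = "\<lambda>y. if y < 0 then 0 else d (u + y)"
      have cd: "causal ?d" by (intro causal_shift d)
      have "a (u + R) = (LINT x|lborel. \<bar>flow (flow g d u) ?d R x\<bar>)"
        unfolding a_def using flow_flow[OF g(1) d u, of R] R by simp
      also have "\<dots> \<le> (1 - \<delta>) * (LINT x|lborel. \<bar>flow g d u x\<bar>) + 2 * \<delta> * tail (\<lambda>x. \<bar>flow g d u x\<bar>) (R/2)"
        unfolding \<delta>_def
      proof (rule flow_contraction[OF cf fi[OF u] cd _ _ R c(1,3)])
        show "?d x = flow g d u x + conv f ?d x" for x
          by (rule flow_renewal[OF g(1) d _ u]) (use eq in blast)
        show "(LINT x|lborel. flow g d u x) = 0"
          by (rule flow_mean_zero[OF g d _ u zero]) (use eq in blast)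
      qed
      also have "tail (\<lambda>x. \<bar>flow g d u x\<bar>) (R/2) \<le> Q * (R/2) powr (-q)"
      proof -
        have R2: "1 \<le> R/2" using R by simp
        have "tail (\<lambda>x. \<bar>flow g d u x\<bar>) (R/2) \<le> tail ?g (R/2) + G * tail k (R/2)"
          using R by (intro ft u) auto
        also have "\<dots> \<le> G * (R/2) powr (-q) + G * (B * (R/2) powr (-q))"
          using gt R2 k_tail_le[OF R2] G by (intro add_mono mult_left_mono) auto
        finally show ?thesis by (simp add: Q_def algebra_simps)
      qed
      finally show "a (u + R) \<le> (1 - \<delta>) * a u + 2 * \<delta> * (Q * (R/2) powr (-q))"
        using \<delta> by (simp add: a_def)
    qed
    ultimately have "\<forall>t\<ge>1. a t \<le> C * t powr (-q)" using C(2) by blast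
    then show "(LINT x|lborel. \<bar>flow g d u x\<bar>) \<le> C * u powr (-q)" using u by (simp add: a_def)
  qed
qed

text \<open>Monotonicity used twice: the decrease of \<open>k\<close> on
  \<open>{2 * R..4 * R}\<close> pays for \<open>f (4 * R)\<close>, and the tail of \<open>k\<close>
  pays for \<open>k (2 * R)\<close>.\<close>

lemma f_le_powr: assumes "R \<ge> 1" shows "4 * R * f (4 * R) * R \<le> 2 * B * R powr (-q)"
proof -
  have "(4 * R - 2 * R) * f (4 * R) \<le> k (2 * R) - k (4 * R)" using assms by (intro k_diff_ge) auto
  then have "2 * R * f (4 * R) \<le> k (2 * R)" using k_nonneg[of "4 * R"] by simp
  then have "R * (2 * R * f (4 * R)) \<le> R * k (2 * R)" using assms by (intro mult_left_mono) auto
  then show ?thesis using k_le_powr[OF assms] by (simp add: mult_ac)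
qed

text \<open>\<open>conv f |d|\<close> is the form in which past deviations of the mass enter the
  present state. Split at \<open>v = u/2\<close>: older times meet at most \<open>f v\<close>, which
  decays fast. Later ones are dominated by the solution with free term \<open>|flow g d v|\<close>,
  whose convolution with \<open>f\<close> is \<open>conv U\<close> of that term, at most
  \<open>5 * \<alpha>\<close> times its norm.\<close>

theorem renewal_rate:
  assumes G: "G \<ge> 0"
  shows "\<exists>C\<ge>0. \<forall>g d. centred G g d \<longrightarrow> (\<forall>u\<ge>8. conv f (\<lambda>x. \<bar>d x\<bar>) u \<le> C * u powr (-q))"
proof -
  obtain C where C: "C \<ge> 0" "\<forall>g d. centred G g d \<longrightarrow> (\<forall>u\<ge>1. (LINT x|lborel. \<bar>flow g d u x\<bar>) \<le> C * u powr (-q))"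
    using flow_decay[OF G] by blast
  define K where "K = 2 * B * G * 8 powr q + 5 * \<alpha> * C * 2 powr q"
  show ?thesis
  proof (intro exI[of _ K] conjI allI impI)
    show "K \<ge> 0" using B_nonneg G C(1) alpha_pos by (auto simp: K_def)
    fix g d u
    assume cen: "centred G g d" and u: "(8::real) \<le> u"
    have g: "causal g" "integrable lborel g" and d: "causal d"
      and eq: "\<forall>x. d x = g x + conv f d x" and dG: "\<forall>x. \<bar>d x\<bar> \<le> G"
      using cen unfolding centred_def by blast+
    define v where "v = u / 2"
    have v: "0 \<le> v" "1 \<le> v" "u = v + v" using u by (auto simp: v_def)
    let ?a = "\<lambda>y. \<bar>d y\<bar>" and ?d = "\<lambda>y. if y < 0 then 0 else d (v + y)"
    let ?m = "\<lambda>x. \<bar>flow g d v x\<bar>"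
    have ca: "causal ?a" by (intro causal_abs d)
    have cm: "causal ?m" by (intro causal_abs causal_flow g d)
    have cfl: "causal (flow g d v)" by (intro causal_flow g d)
    have im: "integrable lborel ?m" by (intro integrable_abs flow_integrable_tail(1)[OF g d v(1) order_refl])
    have m: "(LINT x|lborel. ?m x) \<le> C * v powr (-q)"
      using C(2)[rule_format, OF cen v(2)] .
    have "conv f ?a (v + v) = conv f (\<lambda>y. if y < v then ?a y else 0) (v + v)
        + conv f (\<lambda>y. if y < 0 then 0 else ?a (v + y)) v"
      by (rule conv_shift[OF causal_f ca v(1)])
    also have "conv f (\<lambda>y. if y < v then ?a y else 0) (v + v) \<le> (LINT y|lborel. f v * G * indicator {0..v} y)"
      unfolding conv_def
    proof (rule integral_mono)
      show "integrable lborel (\<lambda>y. f (v + v - y) * (if y < v then ?a y else 0))"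
        by (intro conv_integrable causal_f causal_truncate ca)
      show "f (v + v - y) * (if y < v then ?a y else 0) \<le> f v * G * indicator {0..v} y" for y
      proof (cases "0 \<le> y \<and> y < v")
        case True
        then show ?thesis using f_anti[of v "v + v - y"] dG f_nonneg v by (auto intro!: mult_mono)
      qed (auto simp: causal_neg[OF d] f_nonneg G indicator_def)
    qed (auto simp: emeasure_lborel_Icc_eq)
    also have "\<dots> = f v * G * v" using v by simp
    also have "\<dots> \<le> 2 * B * G * 8 powr q * u powr (-q)"
    proof -
      have R: "1 \<le> u / 8" using u by simp
      have "v * f v \<le> (v * f v) * (u / 8)" using R v f_nonneg[of v] mult_left_mono[of 1 "u/8" "v * f v"] by simp
      also have "\<dots> = 4 * (u/8) * f (4 * (u/8)) * (u/8)" by (simp add: v_def)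
      also have "\<dots> \<le> 2 * B * (u/8) powr (-q)" by (rule f_le_powr[OF R])
      also have "(u/8) powr (-q) = 8 powr q * u powr (-q)" using u by (simp add: powr_divide powr_minus_divide)
      finally have "v * f v \<le> 2 * B * (8 powr q * u powr (-q))" .
      from mult_left_mono[OF this G] show ?thesis by (simp add: mult_ac)
    qed
    also have "conv f (\<lambda>y. if y < 0 then 0 else ?a (v + y)) v \<le> conv f (\<lambda>y. ?m y + conv U ?m y) v"
    proof (intro conv_mono causal_f causal_shift ca causal_add cm causal_conv causal_U mult_left_mono f_nonneg)
      fix y assume y: "0 \<le> y" "y \<le> v"
      have cd: "causal ?d" by (intro causal_shift d)
      have "?d y = flow g d v y + conv U (flow g d v) y"
        by (rule renewal_unique[OF cfl cd flow_renewal[OF g(1) d _ v(1)] order_refl]) (use eq in blast)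
      then have "?a (v + y) = \<bar>flow g d v y + conv U (flow g d v) y\<bar>" using y by simp
      also have "\<dots> \<le> ?m y + conv U ?m y"
        using conv_abs_le[of U "flow g d v" y, OF U_nonneg] by linarith
      finally show "(if y < 0 then 0 else ?a (v + y)) \<le> ?m y + conv U ?m y" using y by simp
    qed
    also have "\<dots> = conv U ?m v"
      using renewal_solution[OF cm refl, of v] by simp
    also have "\<dots> \<le> (LINT y|lborel. 5 * \<alpha> * ?m y)"
      unfolding conv_def
      by (rule integral_mono[OF conv_integrable[OF causal_U cm]]) (auto simp: im intro: mult_right_mono U_le)
    also have "\<dots> = 5 * \<alpha> * (LINT y|lborel. ?m y)" by simp
    also have "\<dots> \<le> 5 * \<alpha> * (C * (2 powr q * u powr (-q)))"
    proof -
      have "v powr (-q) = 2 powr q * u powr (-q)" using u by (simp add: v_def powr_divide powr_minus_divide)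
      with m show ?thesis using alpha_pos by (intro mult_left_mono) auto
    qed
    finally show "conv f ?a u \<le> K * u powr (-q)"
      using v(3) by (simp add: K_def algebra_simps)
  qed
qed

end

section \<open>Survival functions and the excess lifetime\<close>

text \<open>For negative \<open>x\<close> the set \<open>{x<..}\<close> leaves the space
  \<open>{0..}\<close>; the value 0 makes the function causal.\<close>

definition survival :: "real measure \<Rightarrow> real \<Rightarrow> real" where
  "survival \<xi> x = (if x < 0 then 0 else measure \<xi> {x<..})"

lemma M_F_space: "\<xi> \<in> M_F \<Longrightarrow> space \<xi> = {0..}"
  and M_F_finite: "\<xi> \<in> M_F \<Longrightarrow> finite_measure \<xi>"
  and M_F_sets: "\<xi> \<in> M_F \<Longrightarrow> sets \<xi> = sets borel_Rplus"
  unfolding M_F_def using sets_eq_imp_space_eq[of \<xi> borel_Rplus] by (auto simp: space_restrict_space)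

lemma M_F_measurable: "\<xi> \<in> M_F \<Longrightarrow> h \<in> borel_measurable borel \<Longrightarrow> h \<in> borel_measurable \<xi>"
  using measurable_cong_sets[OF M_F_sets refl, of \<xi>] measurable_restrict_space1 by blast

lemma M_F_in_sets: "\<xi> \<in> M_F \<Longrightarrow> E \<in> sets borel \<Longrightarrow> E \<subseteq> {0..} \<Longrightarrow> E \<in> sets \<xi>"
  by (simp add: M_F_sets sets_restrict_space_iff)

lemma survival_nonneg: "0 \<le> survival \<xi> x" by (simp add: survival_def)

lemma survival_anti: assumes "\<xi> \<in> M_F" "0 \<le> x" "x \<le> y" shows "survival \<xi> y \<le> survival \<xi> x"
proof -
  interpret finite_measure \<xi> by (rule M_F_finite) fact
  show ?thesis using assms by (auto simp: survival_def intro!: finite_measure_mono M_F_in_sets[OF assms(1)])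
qed

lemma survival_le: assumes "\<xi> \<in> M_F" shows "survival \<xi> x \<le> measure \<xi> {0..}"
proof -
  interpret finite_measure \<xi> by (rule M_F_finite) fact
  show ?thesis using assms by (auto simp: survival_def intro!: finite_measure_mono M_F_in_sets[OF assms])
qed

lemma causal_survival: assumes "\<xi> \<in> M_F" shows "causal (survival \<xi>)"
proof (rule causalI)
  have "mono_on {0..} (\<lambda>x. - survival \<xi> x)" using survival_anti[OF assms] by (auto simp: mono_on_def)
  then have "(\<lambda>x. - survival \<xi> x) \<in> borel_measurable borel_Rplus" by (rule borel_measurable_mono_on_fnc)
  then have "(\<lambda>x. - (- survival \<xi> x)) \<in> borel_measurable borel_Rplus" by (rule borel_measurable_uminus)
  then have "(\<lambda>x. indicator {0..} x *\<^sub>R survival \<xi> x) \<in> borel_measurable borel"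
    by (simp add: borel_measurable_restrict_space_iff)
  also have "(\<lambda>x. indicator {0..} x *\<^sub>R survival \<xi> x) = survival \<xi>" by (auto simp: survival_def indicator_def)
  finally show "survival \<xi> \<in> borel_measurable borel" .
  show "\<bar>survival \<xi> y\<bar> \<le> measure \<xi> {0..}" for y using survival_le[OF assms, of y] survival_nonneg[of \<xi> y] by simp
qed (simp add: survival_def)

text \<open>Tonelli over the region \<open>R < x < y\<close>, in \<open>ennreal\<close>, so that
  integrability can be concluded from it.\<close>

lemma nn_integral_survival:
  assumes \<xi>: "\<xi> \<in> M_F" and R: "0 \<le> R"
  shows "(\<integral>\<^sup>+x. ennreal (indicator {R<..} x * survival \<xi> x) \<partial>lborel) = (\<integral>\<^sup>+y. ennreal (max 0 (y - R)) \<partial>\<xi>)"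
proof -
  interpret finite_measure \<xi> by (rule M_F_finite[OF \<xi>])
  interpret pair_sigma_finite lborel \<xi> by unfold_locales
  have [measurable]: "(\<lambda>y. y) \<in> borel_measurable \<xi>" by (rule M_F_measurable[OF \<xi>]) simp
  have "(\<integral>\<^sup>+x. ennreal (indicator {R<..} x * survival \<xi> x) \<partial>lborel)
    = (\<integral>\<^sup>+x. \<integral>\<^sup>+y. (if R < x \<and> x < y then 1 else 0) \<partial>\<xi> \<partial>lborel)"
  proof (rule nn_integral_cong)
    fix x
    have "(\<integral>\<^sup>+y. (if R < x \<and> x < y then 1 else 0) \<partial>\<xi>) = (if R < x then emeasure \<xi> {x<..} else 0)"
    proof (cases "R < x")
      case True
      have "(\<integral>\<^sup>+y. (if R < x \<and> x < y then 1 else 0) \<partial>\<xi>) = (\<integral>\<^sup>+y. indicator {x<..} y \<partial>\<xi>)"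
        using True by (intro nn_integral_cong) (auto simp: indicator_def)
      also have "\<dots> = emeasure \<xi> {x<..}" using True R by (intro nn_integral_indicator M_F_in_sets[OF \<xi>]) auto
      finally show ?thesis using True by simp
    qed simp
    also have "\<dots> = ennreal (indicator {R<..} x * survival \<xi> x)"
      using R by (auto simp: survival_def emeasure_eq_measure)
    finally show "ennreal (indicator {R<..} x * survival \<xi> x) = (\<integral>\<^sup>+y. (if R < x \<and> x < y then 1 else 0) \<partial>\<xi>)" by simp
  qed
  also have "\<dots> = (\<integral>\<^sup>+y. \<integral>\<^sup>+x. (if R < x \<and> x < y then 1 else 0) \<partial>lborel \<partial>\<xi>)"
    by (rule Fubini'[symmetric]) measurable
  also have "\<dots> = (\<integral>\<^sup>+y. ennreal (max 0 (y - R)) \<partial>\<xi>)"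
  proof (rule nn_integral_cong)
    fix y
    have "(\<integral>\<^sup>+x. (if R < x \<and> x < y then 1 else 0) \<partial>lborel) = (\<integral>\<^sup>+x. indicator {R<..<y} x \<partial>lborel)"
      by (intro nn_integral_cong) (auto simp: indicator_def)
    also have "\<dots> = emeasure lborel {R<..<y}" by (intro nn_integral_indicator) auto
    also have "\<dots> = ennreal (max 0 (y - R))" by (cases "R \<le> y") (auto simp: max_def)
    finally show "(\<integral>\<^sup>+x. (if R < x \<and> x < y then 1 else 0) \<partial>lborel) = ennreal (max 0 (y - R))" .
  qed
  finally show ?thesis .
qed

lemma nn_integral_survival_0:
  assumes \<xi>: "\<xi> \<in> M_F"
  shows "(\<integral>\<^sup>+x. ennreal (survival \<xi> x) \<partial>lborel) = epairing (\<lambda>x. x) \<xi>"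
proof -
  have "(\<integral>\<^sup>+x. ennreal (survival \<xi> x) \<partial>lborel) = (\<integral>\<^sup>+x. ennreal (indicator {0<..} x * survival \<xi> x) \<partial>lborel)"
    using AE_lborel_singleton[of "0::real"]
    by (intro nn_integral_cong_AE) (auto elim!: eventually_mono simp: survival_def indicator_def)
  also have "\<dots> = (\<integral>\<^sup>+y. ennreal (max 0 (y - 0)) \<partial>\<xi>)" by (rule nn_integral_survival[OF \<xi> order_refl])
  also have "\<dots> = epairing (\<lambda>x. x) \<xi>"
    unfolding epairing_def by (intro nn_integral_cong) (auto simp: M_F_space[OF \<xi>])
  finally show ?thesis .
qed

lemma pairing_id_eq:
  assumes \<xi>: "\<xi> \<in> M_F" shows "pairing (\<lambda>x. x) \<xi> = enn2real (epairing (\<lambda>x. x) \<xi>)"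
  unfolding pairing_def epairing_def
  by (rule integral_eq_nn_integral) (auto simp: M_F_space[OF \<xi>] M_F_measurable[OF \<xi>])

lemma survival_integrable:
  assumes \<xi>: "\<xi> \<in> M_F" and fin: "epairing (\<lambda>x. x) \<xi> < \<infinity>"
  shows "integrable lborel (survival \<xi>)" "(LINT x|lborel. survival \<xi> x) = pairing (\<lambda>x. x) \<xi>"
proof -
  have [measurable]: "survival \<xi> \<in> borel_measurable borel" by (rule causal_measurable[OF causal_survival[OF \<xi>]])
  show "integrable lborel (survival \<xi>)"
    by (rule integrableI_nonneg) (use fin in \<open>auto simp: nn_integral_survival_0[OF \<xi>] survival_nonneg\<close>)
  show "(LINT x|lborel. survival \<xi> x) = pairing (\<lambda>x. x) \<xi>"
    unfolding pairing_id_eq[OF \<xi>] nn_integral_survival_0[OF \<xi>, symmetric]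
    by (rule integral_eq_nn_integral) (auto simp: survival_nonneg)
qed

text \<open>A Markov-type estimate: for \<open>y > R\<close>, the excess \<open>y - R\<close> is at
  most \<open>y * (y / R) powr q\<close>.\<close>

lemma tail_survival_le:
  assumes \<xi>: "\<xi> \<in> M_F" and q: "0 \<le> q" and K: "0 \<le> K" and mom: "epairing (\<lambda>x. x powr (1 + q)) \<xi> \<le> ennreal K" and R: "0 < R"
  shows "tail (survival \<xi>) R \<le> K * R powr (-q)"
proof -
  have [measurable]: "survival \<xi> \<in> borel_measurable borel" by (rule causal_measurable[OF causal_survival[OF \<xi>]])
  have "(\<integral>\<^sup>+x. ennreal (indicator {R<..} x * survival \<xi> x) \<partial>lborel) = (\<integral>\<^sup>+y. ennreal (max 0 (y - R)) \<partial>\<xi>)"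
    using R by (intro nn_integral_survival \<xi>) simp
  also have "\<dots> \<le> (\<integral>\<^sup>+y. ennreal (y powr (1 + q)) * ennreal (R powr (-q)) \<partial>\<xi>)"
  proof (rule nn_integral_mono)
    fix y assume "y \<in> space \<xi>"
    then have y: "0 \<le> y" by (simp add: M_F_space[OF \<xi>])
    have "max 0 (y - R) \<le> y powr (1 + q) * R powr (-q)"
    proof (cases "y \<le> R")
      case False
      then have "y * 1 \<le> y * (y / R) powr q" using R q by (intro mult_left_mono ge_one_powr_ge_zero) auto
      also have "\<dots> = y powr (1 + q) * R powr (-q)"
        using False R by (simp add: powr_add powr_divide powr_minus_divide)
      finally show ?thesis using R y by auto
    qed simp
    then show "ennreal (max 0 (y - R)) \<le> ennreal (y powr (1 + q)) * ennreal (R powr (-q))"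
      by (simp add: ennreal_leI flip: ennreal_mult)
  qed
  also have "\<dots> = epairing (\<lambda>x. x powr (1 + q)) \<xi> * ennreal (R powr (-q))"
    unfolding epairing_def by (intro nn_integral_multc) (auto intro!: M_F_measurable[OF \<xi>])
  also have "\<dots> \<le> ennreal K * ennreal (R powr (-q))" by (intro mult_right_mono mom) auto
  also have "\<dots> = ennreal (K * R powr (-q))" using K by (simp add: ennreal_mult)
  finally have le: "(\<integral>\<^sup>+x. ennreal (indicator {R<..} x * survival \<xi> x) \<partial>lborel) \<le> ennreal (K * R powr (-q))" .
  have "tail (survival \<xi>) R = enn2real (\<integral>\<^sup>+x. ennreal (indicator {R<..} x * survival \<xi> x) \<partial>lborel)"
    unfolding tail_def by (rule integral_eq_nn_integral) (auto simp: survival_nonneg)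
  also have "\<dots> \<le> enn2real (ennreal (K * R powr (-q)))" using le by (intro enn2real_mono) auto
  finally show ?thesis using K by simp
qed

locale ps_data =
  fixes \<alpha> :: real and \<nu> :: "real measure"
  assumes crit: "critical_data \<alpha> \<nu>"
begin

definition f :: "real \<Rightarrow> real" where "f x = \<alpha> * survival \<nu> x"

lemma nu_M_F: "\<nu> \<in> M_F"
  using crit unfolding critical_data_def M_F_def by (auto intro: prob_space.finite_measure)

lemma nu_prob: "prob_space \<nu>" and nu_0: "measure \<nu> {0} = 0" and nu_fin: "epairing (\<lambda>x. x) \<nu> < \<infinity>"
  and alpha_eq: "\<alpha> = 1 / pairing (\<lambda>x. x) \<nu>"
  using crit unfolding critical_data_def by auto

lemma nu_space: "measure \<nu> {0..} = 1"
  using prob_space.prob_space[OF nu_prob] M_F_space[OF nu_M_F] by simp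

text \<open>A vanishing mean would put all mass at 0, which critical data exclude. This keeps
  \<alpha> from being the default value of a division by 0.\<close>

lemma mean_pos: "pairing (\<lambda>x. x) \<nu> > 0"
proof -
  interpret prob_space \<nu> by (rule nu_prob)
  have nn: "0 \<le> pairing (\<lambda>x. x) \<nu>" unfolding pairing_id_eq[OF nu_M_F] by simp
  moreover have "pairing (\<lambda>x. x) \<nu> \<noteq> 0"
  proof
    assume 0: "pairing (\<lambda>x. x) \<nu> = 0"
    then have "epairing (\<lambda>x. x) \<nu> = 0"
      using nu_fin unfolding pairing_id_eq[OF nu_M_F] by (auto simp: enn2real_eq_0_iff)
    then have "AE x in \<nu>. ennreal x = 0"
      unfolding epairing_def by (subst (asm) nn_integral_0_iff_AE) (auto intro!: M_F_measurable[OF nu_M_F])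
    then have "AE x in \<nu>. x \<in> {0}" by (rule AE_mp) (auto intro!: AE_I2 simp: M_F_space[OF nu_M_F])
    moreover have "{0} \<in> sets \<nu>" by (rule M_F_in_sets[OF nu_M_F]) auto
    ultimately have "prob {0} = 1" using prob_eq_1 by blast
    then show False using nu_0 by simp
  qed
  ultimately show ?thesis by simp
qed

lemma alpha_pos': "\<alpha> > 0" using mean_pos alpha_eq by simp

lemma renewal_density_f: "renewal_density f \<alpha>"
proof
  show "causal f" unfolding f_def[abs_def] by (intro causal_mult_left causal_survival nu_M_F)
  show "0 \<le> f x" for x using alpha_pos' survival_nonneg[of \<nu> x] by (simp add: f_def)
  show "f x \<le> \<alpha>" for x using alpha_pos' survival_le[OF nu_M_F, of x] nu_space by (simp add: f_def)
  show "f y \<le> f x" if "0 \<le> x" "x \<le> y" for x y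
    using alpha_pos' survival_anti[OF nu_M_F that] by (simp add: f_def)
  show "integrable lborel f" unfolding f_def[abs_def] using survival_integrable(1)[OF nu_M_F nu_fin] by simp
  show "(LINT x|lborel. f x) = 1"
    unfolding f_def using survival_integrable(2)[OF nu_M_F nu_fin] alpha_eq mean_pos by simp
qed

sublocale renewal_density f \<alpha> by (rule renewal_density_f)

lemma space_excess: "space (excess_lifetime \<alpha> \<nu>) = {0..}"
  and sets_excess: "sets (excess_lifetime \<alpha> \<nu>) = sets borel_Rplus"
  unfolding excess_lifetime_def by (auto simp: space_restrict_space sets_restrict_space)

lemma density_eq: assumes "0 \<le> x" shows "\<alpha> * (1 - measure \<nu> {0..x}) = f x"
proof -
  interpret prob_space \<nu> by (rule nu_prob)
  have "measure \<nu> {0..} = measure \<nu> ({0..x} \<union> {x<..})" using assms by (intro arg_cong[where f="measure \<nu>"]) auto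
  also have "\<dots> = measure \<nu> {0..x} + measure \<nu> {x<..}"
    using assms by (intro finite_measure_Union M_F_in_sets[OF nu_M_F]) auto
  finally show ?thesis using assms nu_space by (simp add: f_def survival_def)
qed

lemma nn_integral_excess:
  assumes [measurable]: "h \<in> borel_measurable borel"
  shows "(\<integral>\<^sup>+x. h x \<partial>excess_lifetime \<alpha> \<nu>) = (\<integral>\<^sup>+x. ennreal (f x) * h x \<partial>lborel)"
proof -
  have m: "h \<in> borel_measurable (restrict_space lborel {0..})" by (intro measurable_restrict_space1) simp
  have m2: "(\<lambda>x. ennreal (\<alpha> * (1 - measure \<nu> {0..x}))) \<in> borel_measurable (restrict_space lborel {0..})"
  proof (subst measurable_cong)
    show "ennreal (\<alpha> * (1 - measure \<nu> {0..x})) = ennreal (f x)" if "x \<in> space (restrict_space lborel {0..})" for x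
      using that density_eq by (simp add: space_restrict_space)
    show "(\<lambda>x. ennreal (f x)) \<in> borel_measurable (restrict_space lborel {0..})"
      by (intro measurable_restrict_space1) simp
  qed
  have "(\<integral>\<^sup>+x. h x \<partial>excess_lifetime \<alpha> \<nu>)
     = (\<integral>\<^sup>+x. ennreal (\<alpha> * (1 - measure \<nu> {0..x})) * h x \<partial>restrict_space lborel {0..})"
    unfolding excess_lifetime_def by (rule nn_integral_density[OF m2 m])
  also have "\<dots> = (\<integral>\<^sup>+x. ennreal (\<alpha> * (1 - measure \<nu> {0..x})) * h x * indicator {0..} x \<partial>lborel)"
    by (subst nn_integral_restrict_space) auto
  also have "\<dots> = (\<integral>\<^sup>+x. ennreal (f x) * h x \<partial>lborel)"
    by (intro nn_integral_cong) (auto simp: indicator_def density_eq causal_neg[OF causal_f])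
  finally show ?thesis .
qed

lemma emeasure_excess:
  assumes "E \<in> sets borel" "E \<subseteq> {0..}"
  shows "emeasure (excess_lifetime \<alpha> \<nu>) E = (\<integral>\<^sup>+x. ennreal (f x) * indicator E x \<partial>lborel)"
proof -
  have "emeasure (excess_lifetime \<alpha> \<nu>) E = (\<integral>\<^sup>+x. indicator E x \<partial>excess_lifetime \<alpha> \<nu>)"
    using assms by (intro nn_integral_indicator[symmetric]) (auto simp: sets_excess sets_restrict_space_iff)
  also have "\<dots> = (\<integral>\<^sup>+x. ennreal (f x) * indicator E x \<partial>lborel)" using assms by (intro nn_integral_excess) simp
  finally show ?thesis .
qed

lemma excess_M_F: "excess_lifetime \<alpha> \<nu> \<in> M_F"
proof -
  have "emeasure (excess_lifetime \<alpha> \<nu>) {0..} = (\<integral>\<^sup>+x. ennreal (f x) \<partial>lborel)"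
    by (subst emeasure_excess) (auto intro!: nn_integral_cong simp: indicator_def causal_neg[OF causal_f])
  also have "\<dots> < \<infinity>" using f_integrable f_nonneg by (simp add: nn_integral_eq_integral)
  finally show ?thesis unfolding M_F_def by (auto intro!: finite_measureI simp: space_excess sets_excess)
qed

text \<open>Links the abstract kernel to the excess lifetime, so that moments of that law become
  integrability and tail decay of \<open>k\<close>.\<close>

lemma survival_excess: "survival (excess_lifetime \<alpha> \<nu>) = k"
proof
  fix x
  show "survival (excess_lifetime \<alpha> \<nu>) x = k x"
  proof (cases "x < 0")
    case False
    have "emeasure (excess_lifetime \<alpha> \<nu>) {x<..} = (\<integral>\<^sup>+y. ennreal (indicator {x<..} y * f y) \<partial>lborel)"
      using False by (subst emeasure_excess) (auto intro!: nn_integral_cong simp: indicator_def)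
    also have "\<dots> = ennreal (k x)"
      using False unfolding k_tail[of x, OF leI[OF False]]
      by (intro nn_integral_eq_integral integrable_indicator_f) (auto simp: f_nonneg)
    finally show ?thesis using False k_nonneg by (simp add: survival_def measure_def)
  qed (simp add: survival_def k_neg)
qed

text \<open>Tonelli over \<open>0 \<le> x < y\<close>, with \<open>x powr s\<close> replaced by its
  upper bound \<open>y powr s\<close>; the sharp factor \<open>1 / (1 + s)\<close> is given
  up.\<close>

lemma excess_moment:
  assumes s: "0 \<le> s"
  shows "epairing (\<lambda>x. x powr s) (excess_lifetime \<alpha> \<nu>) \<le> ennreal \<alpha> * epairing (\<lambda>x. x powr (1 + s)) \<nu>"
proof -
  interpret prob_space \<nu> by (rule nu_prob)
  interpret pair_sigma_finite lborel \<nu> by unfold_locales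
  have [measurable]: "(\<lambda>y. y) \<in> borel_measurable \<nu>" by (rule M_F_measurable[OF nu_M_F]) simp
  have "epairing (\<lambda>x. x powr s) (excess_lifetime \<alpha> \<nu>) = (\<integral>\<^sup>+x. ennreal (f x) * ennreal (x powr s) \<partial>lborel)"
    unfolding epairing_def by (intro nn_integral_excess) auto
  also have "\<dots> = (\<integral>\<^sup>+x. \<integral>\<^sup>+y. ennreal \<alpha> * ennreal (x powr s) * (if 0 \<le> x \<and> x < y then 1 else 0) \<partial>\<nu> \<partial>lborel)"
  proof (rule nn_integral_cong)
    fix x
    show "ennreal (f x) * ennreal (x powr s) = (\<integral>\<^sup>+y. ennreal \<alpha> * ennreal (x powr s) * (if 0 \<le> x \<and> x < y then 1 else 0) \<partial>\<nu>)"
    proof (cases "0 \<le> x")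
      case True
      have "(\<integral>\<^sup>+y. ennreal \<alpha> * ennreal (x powr s) * (if 0 \<le> x \<and> x < y then 1 else 0) \<partial>\<nu>)
         = ennreal \<alpha> * ennreal (x powr s) * (\<integral>\<^sup>+y. (if 0 \<le> x \<and> x < y then 1 else 0) \<partial>\<nu>)"
        by (rule nn_integral_cmult) measurable
      also have "(\<integral>\<^sup>+y. (if 0 \<le> x \<and> x < y then 1 else 0) \<partial>\<nu>) = (\<integral>\<^sup>+y. indicator {x<..} y \<partial>\<nu>)"
        using True by (intro nn_integral_cong) (auto simp: indicator_def)
      also have "\<dots> = emeasure \<nu> {x<..}" using True by (intro nn_integral_indicator M_F_in_sets[OF nu_M_F]) auto
      also have "\<dots> = ennreal (survival \<nu> x)" using True by (simp add: survival_def emeasure_eq_measure)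
      finally show ?thesis using alpha_pos' survival_nonneg by (simp add: f_def ennreal_mult ac_simps)
    qed (simp add: causal_neg[OF causal_f])
  qed
  also have "\<dots> = (\<integral>\<^sup>+y. \<integral>\<^sup>+x. ennreal \<alpha> * ennreal (x powr s) * (if 0 \<le> x \<and> x < y then 1 else 0) \<partial>lborel \<partial>\<nu>)"
    by (rule Fubini'[symmetric]) measurable
  also have "\<dots> \<le> (\<integral>\<^sup>+y. ennreal \<alpha> * ennreal (y powr (1 + s)) \<partial>\<nu>)"
  proof (rule nn_integral_mono)
    fix y assume "y \<in> space \<nu>"
    then have y: "0 \<le> y" by (simp add: M_F_space[OF nu_M_F])
    have "(\<integral>\<^sup>+x. ennreal \<alpha> * ennreal (x powr s) * (if 0 \<le> x \<and> x < y then 1 else 0) \<partial>lborel)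
        \<le> (\<integral>\<^sup>+x. ennreal \<alpha> * ennreal (y powr s) * indicator {0..<y} x \<partial>lborel)"
      using s by (intro nn_integral_mono) (auto simp: indicator_def intro!: mult_left_mono ennreal_leI powr_mono2)
    also have "\<dots> = ennreal \<alpha> * ennreal (y powr s) * ennreal y"
      using y by (subst nn_integral_cmult_indicator) auto
    also have "\<dots> = ennreal \<alpha> * ennreal (y powr (1 + s))"
      using y alpha_pos' by (auto simp: powr_add ennreal_mult ac_simps powr_one_gt_zero_iff le_less)
    finally show "(\<integral>\<^sup>+x. ennreal \<alpha> * ennreal (x powr s) * (if 0 \<le> x \<and> x < y then 1 else 0) \<partial>lborel)
        \<le> ennreal \<alpha> * ennreal (y powr (1 + s))" .
  qed
  also have "\<dots> = ennreal \<alpha> * epairing (\<lambda>x. x powr (1 + s)) \<nu>"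
    unfolding epairing_def by (intro nn_integral_cmult) measurable
  finally show ?thesis .
qed

text \<open>The first moment follows from \<open>x \<le> 1 + x powr (1 + q)\<close>; its finiteness
  keeps \<open>beta_e\<close> out of its default branch.\<close>

lemma excess_id_finite:
  assumes q: "0 \<le> q" and fin: "epairing (\<lambda>x. x powr (2 + q)) \<nu> < \<infinity>"
  shows "epairing (\<lambda>x. x powr (1 + q)) (excess_lifetime \<alpha> \<nu>) < \<infinity>" (is ?A)
    and "epairing (\<lambda>x. x) (excess_lifetime \<alpha> \<nu>) < \<infinity>" (is ?B)
proof -
  let ?e = "excess_lifetime \<alpha> \<nu>"
  have "epairing (\<lambda>x. x powr (1 + q)) ?e \<le> ennreal \<alpha> * epairing (\<lambda>x. x powr (1 + (1 + q))) \<nu>"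
    using q by (intro excess_moment) simp
  also have "\<dots> < \<infinity>" using fin by (simp add: ennreal_mult_less_top add.assoc[symmetric])
  finally show A: ?A .
  have "epairing (\<lambda>x. x) ?e \<le> (\<integral>\<^sup>+x. 1 + ennreal (x powr (1 + q)) \<partial>?e)"
    unfolding epairing_def
  proof (rule nn_integral_mono)
    fix x assume "x \<in> space ?e"
    then have x: "0 \<le> x" by (simp add: space_excess)
    have "x \<le> 1 + x powr (1 + q)"
    proof (cases "x \<le> 1")
      case False
      then have "x powr 1 \<le> x powr (1 + q)" using q by (intro powr_mono) auto
      then show ?thesis using False by simp
    qed (simp add: add_increasing2)
    then have "ennreal x \<le> ennreal (1 + x powr (1 + q))" by (rule ennreal_leI)
    then show "ennreal x \<le> 1 + ennreal (x powr (1 + q))" by simp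
  qed
  also have "\<dots> = emeasure ?e (space ?e) + epairing (\<lambda>x. x powr (1 + q)) ?e"
    unfolding epairing_def by (subst nn_integral_add) (auto intro!: M_F_measurable[OF excess_M_F])
  also have "\<dots> < \<infinity>"
    using A finite_measure.finite_emeasure_space[OF M_F_finite[OF excess_M_F]] by (simp add: less_top)
  finally show ?B .
qed

lemma moment_locale:
  assumes q: "0 < q" and fin: "epairing (\<lambda>x. x powr (2 + q)) \<nu> < \<infinity>"
  obtains B where "renewal_density_moment f \<alpha> q B"
proof -
  let ?e = "excess_lifetime \<alpha> \<nu>"
  have q': "0 \<le> q" using q by simp
  obtain B where B: "0 \<le> B" "epairing (\<lambda>x. x powr (1 + q)) ?e = ennreal B"
    using excess_id_finite(1)[OF q' fin] by (cases "epairing (\<lambda>x. x powr (1 + q)) ?e") auto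
  show thesis
  proof (rule that[of B], unfold_locales)
    show "integrable lborel k"
      using survival_integrable(1)[OF excess_M_F excess_id_finite(2)[OF q' fin]] by (simp add: survival_excess)
    show "tail k R \<le> B * R powr (-q)" if "1 \<le> R" for R
      using tail_survival_le[OF excess_M_F q' B(1), of R] B(2) that by (simp add: survival_excess)
  qed fact
qed

lemma beta_e_eq:
  assumes q: "0 < q" and fin: "epairing (\<lambda>x. x powr (2 + q)) \<nu> < \<infinity>"
  shows "beta_e \<alpha> \<nu> * (LINT x|lborel. k x) = 1" "beta_e \<alpha> \<nu> > 0"
proof -
  let ?e = "excess_lifetime \<alpha> \<nu>"
  have q': "0 \<le> q" using q by simp
  note fe = excess_id_finite(2)[OF q' fin]
  have I: "(LINT x|lborel. k x) = pairing (\<lambda>x. x) ?e"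
    using survival_integrable(2)[OF excess_M_F fe] by (simp add: survival_excess)
  obtain B where "renewal_density_moment f \<alpha> q B" using moment_locale[OF assms] .
  then interpret renewal_density_moment f \<alpha> q B .
  have "0 < conv k unit_step 1" by (rule kappa_bounds)
  also have "\<dots> = conv unit_step k 1" by (simp add: conv_commute)
  also have "\<dots> \<le> (LINT x|lborel. k x)"
    unfolding conv_unit_step by (intro integral_mono integrable_indicator_mult k_integrable) (auto simp: indicator_def k_nonneg)
  finally have pos: "0 < (LINT x|lborel. k x)" .
  show "beta_e \<alpha> \<nu> * (LINT x|lborel. k x) = 1" "beta_e \<alpha> \<nu> > 0"
    using fe pos unfolding beta_e_def I by auto
qed

end

section \<open>From the fluid equation to a renewal equation\<close>

lemma pairing_integrable:
  fixes L :: real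
  assumes \<xi>: "\<xi> \<in> M_F" and h: "h \<in> borel_measurable borel" "\<And>x. \<bar>h x\<bar> \<le> L"
  shows "integrable \<xi> h"
proof -
  interpret finite_measure \<xi> by (rule M_F_finite[OF \<xi>])
  show ?thesis
    by (rule integrable_const_bound[where B=L]) (use h M_F_measurable[OF \<xi> h(1)] in auto)
qed

lemma pairing_one: assumes "\<xi> \<in> M_F" shows "pairing (\<lambda>_. 1) \<xi> = measure \<xi> {0..}"
proof -
  interpret finite_measure \<xi> by (rule M_F_finite[OF assms])
  show ?thesis unfolding pairing_def using M_F_space[OF assms] by simp
qed

lemma pairing_abs_le:
  assumes \<xi>: "\<xi> \<in> M_F" and h: "h \<in> borel_measurable borel" "\<And>x. \<bar>h x\<bar> \<le> L"
  shows "\<bar>pairing h \<xi>\<bar> \<le> L * pairing (\<lambda>_. 1) \<xi>"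
proof -
  have i: "integrable \<xi> (\<lambda>x. \<bar>h x\<bar>)" by (rule integrable_abs[OF pairing_integrable[OF assms]])
  have "\<bar>pairing h \<xi>\<bar> \<le> (LINT x|\<xi>. \<bar>h x\<bar>)" unfolding pairing_def by (rule integral_abs_bound)
  also have "\<dots> \<le> (LINT x|\<xi>. L * 1)"
    by (rule integral_mono[OF i]) (use pairing_integrable[OF \<xi>, of "\<lambda>_. L * 1" "\<bar>L\<bar>"] h(2) in auto)
  also have "\<dots> = L * pairing (\<lambda>_. 1) \<xi>" unfolding pairing_def by (rule integral_mult_right_zero)
  finally show ?thesis .
qed

text \<open>Vanishing on the whole negative axis makes the class stable under shifts to the right,
  with the boundary conditions of \<open>test_pair\<close> kept. The Lipschitz bound on
  \<open>g'\<close> is there for a quadratic Taylor remainder.\<close>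

definition smooth_test :: "(real \<Rightarrow> real) \<Rightarrow> (real \<Rightarrow> real) \<Rightarrow> real \<Rightarrow> bool" where
  "smooth_test g g' L \<longleftrightarrow> (\<forall>x. (g has_real_derivative g' x) (at x)) \<and> (\<forall>x\<le>0. g x = 0 \<and> g' x = 0) \<and>
     (\<forall>x. \<bar>g x\<bar> \<le> L \<and> \<bar>g' x\<bar> \<le> L) \<and> (\<forall>x y. \<bar>g' x - g' y\<bar> \<le> L * \<bar>x - y\<bar>)"

lemma smooth_testD:
  assumes "smooth_test g g' L"
  shows "(g has_real_derivative g' x) (at x)" "x \<le> 0 \<Longrightarrow> g x = 0" "x \<le> 0 \<Longrightarrow> g' x = 0"
    "\<bar>g x\<bar> \<le> L" "\<bar>g' x\<bar> \<le> L" "\<bar>g' x - g' y\<bar> \<le> L * \<bar>x - y\<bar>" "L \<ge> 0"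
proof -
  show "(g has_real_derivative g' x) (at x)" "x \<le> 0 \<Longrightarrow> g x = 0" "x \<le> 0 \<Longrightarrow> g' x = 0"
    "\<bar>g x\<bar> \<le> L" "\<bar>g' x\<bar> \<le> L" "\<bar>g' x - g' y\<bar> \<le> L * \<bar>x - y\<bar>"
    using assms unfolding smooth_test_def by blast+
  then show "L \<ge> 0" by linarith
qed

lemma smooth_test_continuous:
  assumes "smooth_test g g' L"
  shows "continuous_on A g" "continuous_on A g'"
proof -
  show "continuous_on A g" using smooth_testD(1)[OF assms] by (meson DERIV_isCont continuous_at_imp_continuous_on)
  have "L-lipschitz_on A g'"
    by (rule lipschitz_onI) (use smooth_testD(6,7)[OF assms] in \<open>auto simp: dist_real_def\<close>)
  then show "continuous_on A g'" by (rule lipschitz_on_continuous_on)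
qed

lemma smooth_test_measurable:
  assumes "smooth_test g g' L"
  shows "g \<in> borel_measurable borel" "g' \<in> borel_measurable borel"
  using smooth_test_continuous[OF assms, of UNIV] by (auto intro: borel_measurable_continuous_onI)

text \<open>Mean value theorem, then the Lipschitz bound between the intermediate point and
  \<open>x\<close>.\<close>

lemma smooth_test_taylor:
  assumes g: "smooth_test g g' L"
  shows "\<bar>g (x + h) - g x - h * g' x\<bar> \<le> L * h\<^sup>2"
proof -
  obtain z where z: "\<bar>z - x\<bar> \<le> \<bar>h\<bar>" "g (x + h) - g x = h * g' z"
  proof (cases h "0::real" rule: linorder_cases)
    case less
    then obtain z where "x + h < z" "z < x" "g x - g (x + h) = (x - (x + h)) * g' z"
      using MVT2[of "x + h" x g g'] smooth_testD(1)[OF g] by auto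
    then show thesis using that[of z] less by (auto simp: algebra_simps)
  next
    case equal then show thesis using that[of x] by simp
  next
    case greater
    then obtain z where "x < z" "z < x + h" "g (x + h) - g x = (x + h - x) * g' z"
      using MVT2[of x "x + h" g g'] smooth_testD(1)[OF g] by auto
    then show thesis using that[of z] greater by auto
  qed
  have "\<bar>g (x + h) - g x - h * g' x\<bar> = \<bar>h\<bar> * \<bar>g' z - g' x\<bar>"
    unfolding z(2) by (simp add: abs_mult[symmetric] algebra_simps)
  also have "\<dots> \<le> \<bar>h\<bar> * (L * \<bar>h\<bar>)"
    using smooth_testD(6)[OF g, of z x] mult_left_mono[OF z(1) smooth_testD(7)[OF g]]
    by (intro mult_left_mono) auto
  also have "\<dots> = L * h\<^sup>2" by (simp add: power2_eq_square)
  finally show ?thesis .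
qed

lemma smooth_test_shift:
  assumes g: "smooth_test g g' L" and r: "0 \<le> r"
  shows "smooth_test (\<lambda>x. g (x - r)) (\<lambda>x. g' (x - r)) L"
  unfolding smooth_test_def
proof (intro conjI allI impI)
  show "((\<lambda>x. g (x - r)) has_real_derivative g' (x - r)) (at x)" for x
    using smooth_testD(1)[OF g, of "x + (-r)"] unfolding DERIV_shift by simp
  show "\<bar>g' (x - r) - g' (y - r)\<bar> \<le> L * \<bar>x - y\<bar>" for x y
    using smooth_testD(6)[OF g, of "x - r" "y - r"] by simp
qed (use smooth_testD[OF g] r in auto)

lemma smooth_test_pair:
  assumes g: "smooth_test g g' L" shows "test_pair g g'"
  unfolding test_pair_def bdd_cont_def
proof (intro conjI allI impI)
  show "(g has_real_derivative g' x) (at x within {0..})" for x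
    by (rule has_field_derivative_at_within[OF smooth_testD(1)[OF g]])
  show "bounded (g ` {0..})" "bounded (g' ` {0..})"
    unfolding bounded_iff using smooth_testD(4,5)[OF g] by auto
qed (use smooth_test_continuous[OF g] smooth_testD(2,3)[OF g] in auto)

text \<open>A piecewise quadratic, continuously differentiable step from 0 on the negative axis to 1
  beyond 1; its derivative is a hat of height 2 over \<open>{0..1}\<close>.\<close>

definition ramp :: "real \<Rightarrow> real" where
  "ramp z = 2 * ((max 0 z)\<^sup>2 - 2 * (max 0 (z - 1/2))\<^sup>2 + (max 0 (z - 1))\<^sup>2)"

definition ramp' :: "real \<Rightarrow> real" where
  "ramp' z = 4 * (max 0 z - 2 * max 0 (z - 1/2) + max 0 (z - 1))"

lemma DERIV_max_sq: "((\<lambda>z::real. (max 0 (z - a))\<^sup>2) has_real_derivative 2 * max 0 (z - a)) (at z)"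
proof (cases z a rule: linorder_cases)
  case less
  have "((\<lambda>_. 0) has_real_derivative 0) (at z)" by simp
  then have "((\<lambda>z::real. (max 0 (z - a))\<^sup>2) has_real_derivative 0) (at z)"
    by (rule DERIV_cong_ev[THEN iffD1, rotated 3, OF _ refl _ refl])
      (use less in \<open>auto intro!: eventually_mono[OF order_tendstoD(2)[OF tendsto_ident_at less]] simp: eventually_nhds_conv_at\<close>)
  then show ?thesis using less by simp
next
  case greater
  have "((\<lambda>z. (z - a)\<^sup>2) has_real_derivative 2 * (z - a)) (at z)"
    by (auto intro!: derivative_eq_intros)
  then have "((\<lambda>z::real. (max 0 (z - a))\<^sup>2) has_real_derivative 2 * (z - a)) (at z)"
    by (rule has_field_derivative_transform_within[where d="z - a"])
      (use greater in \<open>auto simp: dist_real_def max_def\<close>)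
  then show ?thesis using greater by simp
next
  case equal
  have "((\<lambda>h. (max 0 (z + h - a))\<^sup>2 / h) \<longlongrightarrow> 0) (at 0)"
  proof (rule Lim_null_comparison)
    show "\<forall>\<^sub>F h in at 0. norm ((max 0 (z + h - a))\<^sup>2 / h) \<le> \<bar>h\<bar>"
      using equal by (auto simp: max_def power2_eq_square)
    show "((\<lambda>h::real. \<bar>h\<bar>) \<longlongrightarrow> 0) (at 0)" by (auto intro!: tendsto_eq_intros)
  qed
  then show ?thesis using equal by (simp add: DERIV_def)
qed

lemma ramp_le0: "z \<le> 0 \<Longrightarrow> ramp z = 0" "z \<le> 0 \<Longrightarrow> ramp' z = 0"
  by (auto simp: ramp_def ramp'_def)

lemma ramp_ge1: "z \<ge> 1 \<Longrightarrow> ramp z = 1"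
  by (auto simp: ramp_def power2_eq_square algebra_simps)

lemma ramp_abs_le: "\<bar>ramp z\<bar> \<le> 1"
proof -
  consider "z \<le> 0" | "0 \<le> z" "z \<le> 1/2" | "1/2 \<le> z" "z \<le> 1" | "1 \<le> z" by linarith
  then show ?thesis
  proof cases
    case 2
    then have "z * z \<le> 1/2 * 1" by (intro mult_mono) auto
    then show ?thesis using 2 by (simp add: ramp_def power2_eq_square)
  next
    case 3
    have "(1 - z) * (1 - z) \<le> 1/2 * 1" using 3 by (intro mult_mono) auto
    moreover have "ramp z = 1 - 2 * ((1 - z) * (1 - z))"
      using 3 by (simp add: ramp_def power2_eq_square algebra_simps)
    moreover have "0 \<le> (1 - z) * (1 - z)" using 3 by simp
    ultimately show ?thesis by simp
  qed (auto simp: ramp_le0 ramp_ge1)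
qed

lemma ramp'_abs_le: "\<bar>ramp' z\<bar> \<le> 2"
  unfolding ramp'_def by (auto simp: max_def)

lemma ramp'_lipschitz: "\<bar>ramp' x - ramp' y\<bar> \<le> 16 * \<bar>x - y\<bar>"
proof -
  define d where "d = (\<lambda>a. max 0 (x - a) - max 0 (y - a))"
  have d: "\<bar>d a\<bar> \<le> \<bar>x - y\<bar>" for a by (simp add: d_def max_def)
  have "ramp' x - ramp' y = 4 * (d 0 - 2 * d (1/2) + d 1)" by (simp add: d_def ramp'_def algebra_simps)
  moreover have "\<bar>4 * (p - 2 * q + r)\<bar> \<le> 16 * e" if "\<bar>p\<bar> \<le> e" "\<bar>q\<bar> \<le> e" "\<bar>r\<bar> \<le> e" for p q r e :: real
    using that unfolding abs_le_iff by (simp add: algebra_simps)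
  ultimately show ?thesis using d by presburger
qed

text \<open>The triangle inequality gives \<open>ramp'\<close> the Lipschitz constant
  \<open>4 * (1 + 2 + 1)\<close>; steepening by \<open>n\<close> multiplies it by the square of
  \<open>n\<close>, and \<open>n \<ge> 1\<close> lets the same constant bound the function and its
  derivative.\<close>

lemma smooth_test_ramp:
  assumes a: "0 \<le> a" and n: "1 \<le> n"
  shows "smooth_test (\<lambda>x. ramp (n * (x - a))) (\<lambda>x. n * ramp' (n * (x - a))) (16 * n\<^sup>2)"
  unfolding smooth_test_def
proof (intro conjI allI impI)
  have D: "(ramp has_real_derivative ramp' z) (at z)" for z
  proof -
    have "((\<lambda>z. 2 * ((max 0 (z - 0))\<^sup>2 - 2 * (max 0 (z - 1/2))\<^sup>2 + (max 0 (z - 1))\<^sup>2)) has_real_derivative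
        2 * (2 * max 0 (z - 0) - 2 * (2 * max 0 (z - 1/2)) + 2 * max 0 (z - 1))) (at z)"
      by (rule DERIV_cmult[OF DERIV_add[OF DERIV_diff[OF DERIV_max_sq DERIV_cmult[OF DERIV_max_sq]] DERIV_max_sq]])
    then show ?thesis by (simp add: ramp_def[abs_def] ramp'_def algebra_simps)
  qed
  have n2: "1 \<le> n\<^sup>2" "n \<le> n\<^sup>2" using n by (auto intro: one_le_power self_le_power)
  show "((\<lambda>x. ramp (n * (x - a))) has_real_derivative n * ramp' (n * (x - a))) (at x)" for x
    by (rule DERIV_cong[OF DERIV_chain2[OF D]]) (auto intro!: derivative_eq_intros)
  show "ramp (n * (x - a)) = 0" "n * ramp' (n * (x - a)) = 0" if "x \<le> 0" for x
    using that a n by (auto intro!: ramp_le0 simp: mult_nonneg_nonpos)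
  show "\<bar>ramp (n * (x - a))\<bar> \<le> 16 * n\<^sup>2" for x using ramp_abs_le[of "n * (x - a)"] n2 by linarith
  show "\<bar>n * ramp' (n * (x - a))\<bar> \<le> 16 * n\<^sup>2" for x
  proof -
    have "\<bar>n * ramp' (n * (x - a))\<bar> \<le> n * 2" using ramp'_abs_le n by (simp add: abs_mult)
    then show ?thesis using n2 by linarith
  qed
  show "\<bar>n * ramp' (n * (x - a)) - n * ramp' (n * (y - a))\<bar> \<le> 16 * n\<^sup>2 * \<bar>x - y\<bar>" for x y
  proof -
    have "\<bar>n * ramp' (n * (x - a)) - n * ramp' (n * (y - a))\<bar> = n * \<bar>ramp' (n * (x - a)) - ramp' (n * (y - a))\<bar>"
      using n by (simp add: abs_mult flip: right_diff_distrib)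
    also have "\<dots> \<le> n * (16 * \<bar>n * (x - a) - n * (y - a)\<bar>)"
      using n ramp'_lipschitz by (intro mult_left_mono) auto
    also have "n * (x - a) - n * (y - a) = n * (x - y)" by (simp add: algebra_simps)
    also have "n * (16 * \<bar>n * (x - y)\<bar>) = 16 * n\<^sup>2 * \<bar>x - y\<bar>"
      using n by (simp add: abs_mult power2_eq_square)
    finally show ?thesis .
  qed
qed

text \<open>The limit is the indicator of the open half-line because \<open>ramp\<close> vanishes at
  0; this matches the open sets in \<open>survival\<close>.\<close>

lemma ramp_LIMSEQ: "(\<lambda>n. ramp (real (Suc n) * x)) \<longlonglongrightarrow> indicator {0<..} x"
proof (cases "x \<le> 0")
  case True
  then have "ramp (real (Suc n) * x) = 0" for n by (intro ramp_le0) (simp add: mult_nonneg_nonpos)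
  then show ?thesis using True by simp
next
  case False
  obtain N where N: "1 / x \<le> real N" using real_arch_simple by blast
  have "ramp (real (Suc n) * x) = 1" if "N \<le> n" for n
  proof (rule ramp_ge1)
    have "1 / x \<le> real (Suc n)" using N that by simp
    then show "1 \<le> real (Suc n) * x" using False by (simp add: field_simps)
  qed
  then have "\<forall>\<^sub>F n in sequentially. ramp (real (Suc n) * x) = 1" by (auto simp: eventually_sequentially)
  then show ?thesis using False by (simp add: tendsto_eventually)
qed

lemma pairing_ramp_LIMSEQ:
  assumes \<xi>: "\<xi> \<in> M_F" and a: "0 \<le> a"
  shows "(\<lambda>n. pairing (\<lambda>x. ramp (real (Suc n) * (x - a))) \<xi>) \<longlonglongrightarrow> survival \<xi> a"
proof -
  interpret finite_measure \<xi> by (rule M_F_finite[OF \<xi>])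
  have m: "(\<lambda>x. ramp (c * (x - a))) \<in> borel_measurable \<xi>" for c
    unfolding ramp_def[abs_def] by (rule M_F_measurable[OF \<xi>]) measurable
  have "(\<lambda>n. LINT x|\<xi>. ramp (real (Suc n) * (x - a))) \<longlonglongrightarrow> (LINT x|\<xi>. indicator {a<..} x)"
  proof (rule integral_dominated_convergence[where w="\<lambda>_. 1"])
    show "AE x in \<xi>. (\<lambda>n. ramp (real (Suc n) * (x - a))) \<longlonglongrightarrow> indicator {a<..} x"
    proof (rule AE_I2)
      fix x
      have "indicator {a<..} x = (indicator {0<..} (x - a) :: real)" by (simp add: indicator_def)
      then show "(\<lambda>n. ramp (real (Suc n) * (x - a))) \<longlonglongrightarrow> indicator {a<..} x"
        using ramp_LIMSEQ[of "x - a"] by simp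
    qed
    show "AE x in \<xi>. norm (ramp (real (Suc n) * (x - a))) \<le> 1" for n
      using ramp_abs_le by auto
    show "(indicator {a<..} :: real \<Rightarrow> real) \<in> borel_measurable \<xi>" by (rule M_F_measurable[OF \<xi>]) simp
  qed (use m in auto)
  moreover have "(LINT x|\<xi>. indicator {a<..} x) = survival \<xi> a"
  proof -
    have "{a<..} \<inter> {0..} = {a<..}" using a by auto
    then show ?thesis using a M_F_space[OF \<xi>] by (simp add: survival_def)
  qed
  ultimately show ?thesis by (simp add: pairing_def)
qed

section \<open>The fluid model in the time of the service clock\<close>

locale ps_solution = ps_data +
  fixes \<mu> :: "real \<Rightarrow> real measure" and T :: real
  assumes sol: "fluid_model_solution \<alpha> \<nu> \<mu>" and T_nonneg: "0 \<le> T" and T_less: "ereal T < t_star \<mu>"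
begin

lemma mu_M_F: "0 \<le> t \<Longrightarrow> \<mu> t \<in> M_F"
  and mu_0: "0 \<le> t \<Longrightarrow> measure (\<mu> t) {0} = 0"
  and mu_weak: "bdd_cont h \<Longrightarrow> continuous_on {0..} (\<lambda>t. pairing h (\<mu> t))"
  using sol unfolding fluid_model_solution_def continuous_map_weak_topology by auto

lemma mu_eq: 
  "test_pair g g' \<Longrightarrow> 0 \<le> t \<Longrightarrow> t \<le> T \<Longrightarrow> pairing g (\<mu> t) = pairing g (\<mu> 0)
          - (LINT s:{0..t}|lborel. pairing g' (\<mu> s) / pairing (\<lambda>_. 1) (\<mu> s))
          + \<alpha> * t * pairing g \<nu>"
  using sol T_less unfolding fluid_model_solution_def by (meson ereal_less_eq(3) order_le_less_trans)

definition Z :: "real \<Rightarrow> real" where "Z s = pairing (\<lambda>_. 1) (\<mu> s)"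

lemma Z_continuous: "continuous_on {0..} Z"
  unfolding Z_def[abs_def] by (rule mu_weak) (auto simp: bdd_cont_def image_constant_conv)

lemma Z_pos: assumes "0 \<le> s" "s \<le> T" shows "Z s > 0"
proof -
  have "Z s \<noteq> 0"
  proof
    assume "Z s = 0"
    then have "t_star \<mu> \<le> ereal s" unfolding t_star_def using assms by (intro INF_lower) (auto simp: Z_def)
    then show False using T_less assms(2) by (meson ereal_less_eq(3) leD order_trans)
  qed
  moreover have "0 \<le> Z s" unfolding Z_def pairing_one[OF mu_M_F[OF assms(1)]] by simp
  ultimately show ?thesis by simp
qed

text \<open>\<open>Zc\<close> continues \<open>Z\<close> to the whole line, so that \<open>S\<close> has two-sided derivatives on \<open>{0..T}\<close>.\<close>

definition Zc :: "real \<Rightarrow> real" where "Zc s = Z (max 0 (min T s))"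

lemma Zc_eq: "0 \<le> s \<Longrightarrow> s \<le> T \<Longrightarrow> Zc s = Z s" by (simp add: Zc_def)

lemma Zc_pos: "Zc s > 0" unfolding Zc_def using T_nonneg by (intro Z_pos) auto

lemma Zc_continuous: "continuous_on A Zc"
  unfolding Zc_def[abs_def]
  by (rule continuous_on_compose2[OF Z_continuous]) (auto intro!: continuous_intros)

lemma inverse_Zc_continuous: "continuous_on A (\<lambda>s. 1 / Zc s)"
  by (intro continuous_on_divide continuous_on_const Zc_continuous) (use Zc_pos in \<open>auto simp: less_imp_neq[THEN not_sym]\<close>)

text \<open>Integration from \<open>-1\<close> puts 0 in the interior of the interval, which gives a
  two-sided derivative there; the subtracted constant makes the clock start at 0.\<close>

definition S :: "real \<Rightarrow> real" where
  "S t = integral {-1..t} (\<lambda>s. 1 / Zc s) - integral {-1..0} (\<lambda>s. 1 / Zc s)"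

lemma S_0: "S 0 = 0" by (simp add: S_def)

lemma S_deriv: assumes "0 \<le> t" "t \<le> T" shows "(S has_real_derivative 1 / Zc t) (at t)"
proof -
  have "((\<lambda>x. integral {-1..x} (\<lambda>s. 1 / Zc s)) has_real_derivative 1 / Zc t) (at t within {-1..T+1})"
    by (rule integral_has_real_derivative[OF inverse_Zc_continuous]) (use assms in auto)
  moreover have "at t within {-1..T+1} = at t" using assms by (intro at_within_Icc_at) auto
  ultimately have "((\<lambda>x. integral {-1..x} (\<lambda>s. 1 / Zc s)) has_real_derivative 1 / Zc t) (at t)" by simp
  from DERIV_diff[OF this DERIV_const[of "integral {-1..0} (\<lambda>s. 1 / Zc s)"]] show ?thesis
    by (simp add: S_def[abs_def])
qed

lemma S_strict_mono: assumes "0 \<le> s" "s < t" "t \<le> T" shows "S s < S t"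
proof (rule DERIV_pos_imp_increasing[OF assms(2)])
  fix x assume "s \<le> x" "x \<le> t"
  then show "\<exists>y. (S has_real_derivative y) (at x) \<and> 0 < y"
    using S_deriv[of x] assms Zc_pos[of x] by (intro exI[of _ "1 / Zc x"]) auto
qed

lemma S_mono: assumes "0 \<le> s" "s \<le> t" "t \<le> T" shows "S s \<le> S t"
  using S_strict_mono[of s t] assms by (cases "s = t") auto

lemma S_nonneg: "0 \<le> s \<Longrightarrow> s \<le> T \<Longrightarrow> 0 \<le> S s" using S_mono[of 0 s] S_0 by simp

lemma S_continuous: "continuous_on {0..T} S"
  by (rule DERIV_continuous_on) (use S_deriv has_field_derivative_at_within in fastforce)

text \<open>
  Moving the test function along with the service clock \<open>S\<close> cancels the transport term of the
  fluid equation.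
\<close>

lemma moving_test_deriv:
  assumes g: "smooth_test g g' L" and t: "t \<le> T" and s: "0 \<le> s" "s \<le> t"
  shows "((\<lambda>s. pairing (\<lambda>x. g (x - (S t - S s))) (\<mu> s)) has_real_derivative
     \<alpha> * pairing (\<lambda>x. g (x - (S t - S s))) \<nu>) (at s within {0..t})"
proof -
  \<comment> \<open>Freezing the shift at its value at time \<open>s\<close> gives a fixed test
    function, to which the fluid equation applies; the motion is restored by a first-order
    expansion.\<close>
  define r where "r = S t - S s"
  have r: "0 \<le> r" using S_mono[of s t] s t by (simp add: r_def)
  let ?G = "\<lambda>x. g (x - r)" and ?G' = "\<lambda>x. g' (x - r)"
  let ?F = "at s within {0..t}"
  have G: "smooth_test ?G ?G' L" by (rule smooth_test_shift[OF g r])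
  have tp: "test_pair ?G ?G'" by (rule smooth_test_pair[OF G])
  have bc: "bdd_cont ?G" "bdd_cont ?G'" using tp unfolding test_pair_def by auto
  define A where "A = (\<lambda>y. pairing ?G (\<mu> y))"
  define c where "c = (\<lambda>y. pairing ?G' (\<mu> y))"
  have ccont: "continuous_on {0..t} c" unfolding c_def
    by (rule continuous_on_subset[OF mu_weak[OF bc(2)]]) auto
  have Zcont: "continuous_on {0..t} Z" by (rule continuous_on_subset[OF Z_continuous]) auto
  have cz: "continuous_on {0..t} (\<lambda>y. c y / Z y)"
    by (intro continuous_on_divide ccont Zcont) (use Z_pos t in \<open>auto simp: less_imp_neq[THEN not_sym]\<close>)
  have sI: "s \<in> {0..t}" using s by simp
  have dA: "(A has_real_derivative - (c s / Z s) + \<alpha> * pairing ?G \<nu>) ?F"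
  proof (rule has_field_derivative_transform_within[where d=1])
    show "((\<lambda>y. A 0 - integral {0..y} (\<lambda>y. c y / Z y) + \<alpha> * y * pairing ?G \<nu>)
        has_real_derivative - (c s / Z s) + \<alpha> * pairing ?G \<nu>) ?F"
      by (auto intro!: derivative_eq_intros integral_has_real_derivative[OF cz sI])
    fix y assume y: "y \<in> {0..t}"
    have "continuous_on {0..y} (\<lambda>y. c y / Z y)" by (rule continuous_on_subset[OF cz]) (use y in auto)
    then have "(LINT s:{0..y}|lborel. c s / Z s) = integral {0..y} (\<lambda>y. c y / Z y)"
      by (intro set_borel_integral_eq_integral(2) borel_integrable_atLeastAtMost')
    then show "A 0 - integral {0..y} (\<lambda>y. c y / Z y) + \<alpha> * y * pairing ?G \<nu> = A y"
      using mu_eq[OF tp, of y] y t by (simp add: A_def c_def Z_def)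
  qed (use sI in auto)
  have dS: "((\<lambda>y. (S y - S s) / (y - s)) \<longlongrightarrow> 1 / Z s) ?F"
    using has_field_derivative_at_within[OF S_deriv[of s]] s t
    by (simp add: has_field_derivative_iff Zc_eq)
  have cS: "((\<lambda>y. S y - S s) \<longlongrightarrow> 0) ?F"
  proof -
    have "continuous_on {0..t} S" by (rule continuous_on_subset[OF S_continuous]) (use t in auto)
    then have "(S \<longlongrightarrow> S s) ?F" using sI by (simp add: continuous_on_def)
    then show ?thesis by (simp add: LIM_zero_iff)
  qed
  have lc: "(c \<longlongrightarrow> c s) ?F" "(Z \<longlongrightarrow> Z s) ?F" using ccont Zcont sI by (auto simp: continuous_on_def)
  define \<phi> where "\<phi> = (\<lambda>s. pairing (\<lambda>x. g (x - (S t - S s))) (\<mu> s))"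
  \<comment> \<open>The Taylor remainder of the motion. It is quadratic in the clock increment,
    hence negligible after division by \<open>y - s\<close>.\<close>
  define rem where "rem = (\<lambda>y. \<phi> y - A y - (S y - S s) * c y)"
  have rem: "\<bar>rem y\<bar> \<le> L * (S y - S s)\<^sup>2 * Z y" if y: "y \<in> {0..t}" for y
  proof -
    define h where "h = S y - S s"
    have M: "\<mu> y \<in> M_F" using y by (intro mu_M_F) auto
    have ry: "0 \<le> S t - S y" using S_mono[of y t] y t by simp
    let ?H = "\<lambda>x. g (x - (S t - S y))"
    have H: "smooth_test ?H (\<lambda>x. g' (x - (S t - S y))) L" by (rule smooth_test_shift[OF g ry])
    have i1: "integrable (\<mu> y) ?G" "integrable (\<mu> y) ?G'" "integrable (\<mu> y) ?H"
      by (rule pairing_integrable[OF M smooth_test_measurable(1)[OF G] smooth_testD(4)[OF G]]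
               pairing_integrable[OF M smooth_test_measurable(2)[OF G] smooth_testD(5)[OF G]]
               pairing_integrable[OF M smooth_test_measurable(1)[OF H] smooth_testD(4)[OF H]])+
    have "rem y = pairing (\<lambda>x. ?H x - ?G x - h * ?G' x) (\<mu> y)"
      unfolding pairing_def rem_def \<phi>_def A_def c_def h_def using i1 by simp
    also have "\<bar>\<dots>\<bar> \<le> (L * h\<^sup>2) * pairing (\<lambda>_. 1) (\<mu> y)"
    proof (rule pairing_abs_le[OF M])
      show "(\<lambda>x. ?H x - ?G x - h * ?G' x) \<in> borel_measurable borel"
        by (intro borel_measurable_diff borel_measurable_times borel_measurable_const
            smooth_test_measurable(1)[OF G] smooth_test_measurable(2)[OF G] smooth_test_measurable(1)[OF H])
      show "\<bar>?H x - ?G x - h * ?G' x\<bar> \<le> L * h\<^sup>2" for x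
        using smooth_test_taylor[OF g, of "x - r" h] by (simp add: h_def r_def algebra_simps)
    qed
    finally show ?thesis by (simp add: h_def Z_def)
  qed
  have "((\<lambda>y. rem y / (y - s)) \<longlongrightarrow> 0) ?F"
  proof (rule Lim_null_comparison)
    show "\<forall>\<^sub>F y in ?F. norm (rem y / (y - s)) \<le> L * \<bar>S y - S s\<bar> * \<bar>(S y - S s) / (y - s)\<bar> * Z y"
      unfolding eventually_at_filter
    proof (intro always_eventually allI impI)
      fix y assume y: "y \<noteq> s" "y \<in> {0..t}"
      have sq: "(S y - S s)\<^sup>2 = \<bar>S y - S s\<bar> * \<bar>S y - S s\<bar>" by (simp add: power2_eq_square)
      have "norm (rem y / (y - s)) = \<bar>rem y\<bar> / \<bar>y - s\<bar>" by (simp add: abs_divide)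
      also have "\<dots> \<le> (L * (S y - S s)\<^sup>2 * Z y) / \<bar>y - s\<bar>" by (intro divide_right_mono rem y) auto
      also have "\<dots> = L * \<bar>S y - S s\<bar> * \<bar>(S y - S s) / (y - s)\<bar> * Z y"
        unfolding sq by (simp add: abs_divide)
      finally show "norm (rem y / (y - s)) \<le> L * \<bar>S y - S s\<bar> * \<bar>(S y - S s) / (y - s)\<bar> * Z y" .
    qed
    show "((\<lambda>y. L * \<bar>S y - S s\<bar> * \<bar>(S y - S s) / (y - s)\<bar> * Z y) \<longlongrightarrow> 0) ?F"
      using tendsto_mult[OF tendsto_mult[OF tendsto_mult[OF tendsto_const[of L] tendsto_rabs[OF cS]] tendsto_rabs[OF dS]] lc(2)]
      by simp
  qed
  moreover have "((\<lambda>y. (A y - A s) / (y - s)) \<longlongrightarrow> - (c s / Z s) + \<alpha> * pairing ?G \<nu>) ?F"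
    using dA by (simp add: has_field_derivative_iff)
  ultimately have "((\<lambda>y. (A y - A s) / (y - s) + (S y - S s) / (y - s) * c y + rem y / (y - s))
      \<longlongrightarrow> (- (c s / Z s) + \<alpha> * pairing ?G \<nu>) + 1 / Z s * c s + 0) ?F"
    by (intro tendsto_add tendsto_mult dS lc)
  moreover have "\<phi> s = A s" by (simp add: \<phi>_def A_def r_def)
  then have "(A y - A s) / (y - s) + (S y - S s) / (y - s) * c y + rem y / (y - s) = (\<phi> y - \<phi> s) / (y - s)" for y
    by (simp add: rem_def flip: add_divide_distrib)
  ultimately have "((\<lambda>y. (\<phi> y - \<phi> s) / (y - s)) \<longlongrightarrow> \<alpha> * pairing ?G \<nu>) ?F" by simp
  then show ?thesis unfolding \<phi>_def has_field_derivative_iff r_def .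
qed

lemma moving_test_integral:
  assumes g: "smooth_test g g' L" and t: "0 \<le> t" "t \<le> T"
  shows "((\<lambda>s. \<alpha> * pairing (\<lambda>x. g (x - (S t - S s))) \<nu>) has_integral
     (pairing g (\<mu> t) - pairing (\<lambda>x. g (x - S t)) (\<mu> 0))) {0..t}"
proof -
  have "((\<lambda>s. \<alpha> * pairing (\<lambda>x. g (x - (S t - S s))) \<nu>) has_integral
     (pairing (\<lambda>x. g (x - (S t - S t))) (\<mu> t) - pairing (\<lambda>x. g (x - (S t - S 0))) (\<mu> 0))) {0..t}"
  proof (rule fundamental_theorem_of_calculus[OF t(1)])
    fix s assume "s \<in> {0..t}"
    then show "((\<lambda>s. pairing (\<lambda>x. g (x - (S t - S s))) (\<mu> s)) has_vector_derivative
     \<alpha> * pairing (\<lambda>x. g (x - (S t - S s))) \<nu>) (at s within {0..t})"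
      unfolding has_real_derivative_iff_has_vector_derivative[symmetric]
      using moving_test_deriv[OF g t(2)] by simp
  qed
  then show ?thesis by (simp add: S_0)
qed

text \<open>Steepened ramps are admissible test functions. The passage to the indicator of
  \<open>{a<..}\<close> is dominated by \<alpha>, as \<open>ramp\<close> is bounded by 1 and \<nu>
  has mass 1.\<close>

lemma survival_mu:
  assumes t: "0 \<le> t" "t \<le> T" and a: "0 \<le> a"
  shows "((\<lambda>s. f (a + (S t - S s))) has_integral (survival (\<mu> t) a - survival (\<mu> 0) (a + S t))) {0..t}"
proof -
  define g where "g = (\<lambda>n x. ramp (real (Suc n) * (x - a)))"
  define q where "q = (\<lambda>n s. \<alpha> * pairing (\<lambda>x. g n (x - (S t - S s))) \<nu>)"
  have st: "smooth_test (g n) (\<lambda>x. real (Suc n) * ramp' (real (Suc n) * (x - a))) (16 * (real (Suc n))\<^sup>2)" for n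
    unfolding g_def by (rule smooth_test_ramp[OF a]) simp
  have hi: "(q n has_integral (pairing (g n) (\<mu> t) - pairing (\<lambda>x. g n (x - S t)) (\<mu> 0))) {0..t}" for n
    unfolding q_def by (rule moving_test_integral[OF st t])
  have St: "0 \<le> S t" by (rule S_nonneg[OF t])
  have shift: "(\<lambda>n. pairing (\<lambda>x. g n (x - r)) \<xi>) \<longlonglongrightarrow> survival \<xi> (a + r)" if "\<xi> \<in> M_F" "0 \<le> r" for \<xi> r
    using pairing_ramp_LIMSEQ[OF that(1), of "a + r"] a that(2) by (simp add: g_def algebra_simps)
  have lim: "(\<lambda>n. q n s) \<longlonglongrightarrow> f (a + (S t - S s))" if "s \<in> {0..t}" for s
    unfolding q_def f_def
    by (intro tendsto_mult tendsto_const shift nu_M_F) (use S_mono[of s t] that t in auto)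
  have bound: "norm (q n s) \<le> \<alpha>" for n s
  proof -
    have "\<bar>pairing (\<lambda>x. g n (x - (S t - S s))) \<nu>\<bar> \<le> 1 * pairing (\<lambda>_. 1) \<nu>"
    proof (rule pairing_abs_le[OF nu_M_F])
      show "(\<lambda>x. g n (x - (S t - S s))) \<in> borel_measurable borel"
        unfolding g_def ramp_def[abs_def] by measurable
    qed (simp add: g_def ramp_abs_le)
    then have "\<alpha> * \<bar>pairing (\<lambda>x. g n (x - (S t - S s))) \<nu>\<bar> \<le> \<alpha> * 1"
      using alpha_pos by (intro mult_left_mono) (auto simp: pairing_one[OF nu_M_F] nu_space)
    then show ?thesis using alpha_pos by (simp add: q_def abs_mult)
  qed
  have dc: "(\<lambda>s. f (a + (S t - S s))) integrable_on {0..t}"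
    "(\<lambda>n. integral {0..t} (q n)) \<longlonglongrightarrow> integral {0..t} (\<lambda>s. f (a + (S t - S s)))"
    by (rule dominated_convergence[where h="\<lambda>_. \<alpha>" and f=q and g="\<lambda>s. f (a + (S t - S s))" and S="{0..t}"];
        use hi bound lim in \<open>auto intro: integrable_const_ivl simp: integrable_on_def\<close>)+
  have "integral {0..t} (q n) = pairing (g n) (\<mu> t) - pairing (\<lambda>x. g n (x - S t)) (\<mu> 0)" for n
    by (rule integral_unique[OF hi])
  moreover have "(\<lambda>n. pairing (g n) (\<mu> t) - pairing (\<lambda>x. g n (x - S t)) (\<mu> 0)) \<longlonglongrightarrow> survival (\<mu> t) a - survival (\<mu> 0) (a + S t)"
    using shift[OF mu_M_F[OF t(1)], of 0] by (intro tendsto_diff shift mu_M_F St) auto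
  ultimately have "integral {0..t} (\<lambda>s. f (a + (S t - S s))) = survival (\<mu> t) a - survival (\<mu> 0) (a + S t)"
    using dc(2) LIMSEQ_unique by fastforce
  then show ?thesis using dc(1) by (simp add: has_integral_iff)
qed


definition \<tau> :: "real \<Rightarrow> real" where "\<tau> = the_inv_into {0..T} S"

lemma S_inj: "inj_on S {0..T}"
proof (rule linorder_inj_onI)
  fix x y assume "x < y" "x \<in> {0..T}" "y \<in> {0..T}"
  then show "S x \<noteq> S y" using S_strict_mono[of x y] by auto
qed auto

lemma tau_S: "0 \<le> s \<Longrightarrow> s \<le> T \<Longrightarrow> \<tau> (S s) = s"
  unfolding \<tau>_def by (rule the_inv_into_f_f[OF S_inj]) simp

lemma S_image: "S ` {0..T} = {0..S T}"
proof
  show "S ` {0..T} \<subseteq> {0..S T}" using S_mono S_nonneg by auto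
  show "{0..S T} \<subseteq> S ` {0..T}"
  proof
    fix v assume "v \<in> {0..S T}"
    then have "\<exists>x. 0 \<le> x \<and> x \<le> T \<and> S x = v"
      using IVT'[of S 0 v T] S_continuous S_0 T_nonneg by auto
    then show "v \<in> S ` {0..T}" by force
  qed
qed

text \<open>\<open>\<zeta>\<close> is the total mass in the time scale of the service clock.\<close>

definition \<zeta> :: "real \<Rightarrow> real" where "\<zeta> v = (if v \<in> {0..S T} then Z (\<tau> v) else 0)"

lemma zeta_S: "0 \<le> s \<Longrightarrow> s \<le> T \<Longrightarrow> \<zeta> (S s) = Z s"
  using S_mono[of s T] S_nonneg by (simp add: \<zeta>_def tau_S)

lemma causal_zeta: "causal \<zeta>"
proof -
  have "continuous_on (S ` {0..T}) \<tau>"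
    by (rule continuous_on_inv[OF S_continuous]) (auto simp: tau_S)
  then have "continuous_on {0..S T} \<tau>" by (simp add: S_image)
  moreover have "\<tau> ` {0..S T} \<subseteq> {0..}" using S_image tau_S by (auto simp flip: S_image)
  ultimately have c: "continuous_on {0..S T} (\<lambda>v. Z (\<tau> v))"
    by (rule continuous_on_compose2[OF Z_continuous])
  have "(\<lambda>v. indicator {0..S T} v *\<^sub>R Z (\<tau> v)) \<in> borel_measurable borel"
    by (rule borel_measurable_continuous_on_indicator[OF _ c]) simp
  also have "(\<lambda>v. indicator {0..S T} v *\<^sub>R Z (\<tau> v)) = \<zeta>" by (auto simp: \<zeta>_def indicator_def)
  finally have m: "\<zeta> \<in> borel_measurable borel" .
  have "bounded ((\<lambda>v. Z (\<tau> v)) ` {0..S T})"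
    by (rule compact_imp_bounded[OF compact_continuous_image[OF c]]) simp
  then obtain K where "\<forall>v\<in>{0..S T}. \<bar>Z (\<tau> v)\<bar> \<le> K" unfolding bounded_iff by auto
  then have K: "\<bar>Z (\<tau> v)\<bar> \<le> K" if "v \<in> {0..S T}" for v using that by blast
  show ?thesis
  proof (rule causalI[OF m, where B="\<lambda>_. max 0 K"])
    show "\<bar>\<zeta> y\<bar> \<le> max 0 K" for y using K[of y] by (auto simp: \<zeta>_def)
  qed (simp add: \<zeta>_def)
qed

lemma zeta_nonneg: "0 \<le> \<zeta> v"
proof (cases "v \<in> {0..S T}")
  case True
  then obtain s where "v = S s" "0 \<le> s" "s \<le> T" using S_image by (metis atLeastAtMost_iff imageE)
  then show ?thesis using zeta_S Z_pos[of s] by (simp add: less_imp_le)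
qed (auto simp: \<zeta>_def)

text \<open>Substitution \<open>v = S s\<close> in \<open>survival_mu\<close>: the clock has speed
  \<open>1 / Z s\<close>, which cancels the factor \<open>\<zeta> (S s) = Z s\<close>.\<close>

lemma conv_zeta:
  assumes t: "0 \<le> t" "t \<le> T" and a: "0 \<le> a"
  shows "conv f (\<lambda>y. if y < S t then \<zeta> y else 0) (a + S t) = survival (\<mu> t) a - survival (\<mu> 0) (a + S t)"
proof -
  have [measurable]: "\<zeta> \<in> borel_measurable borel" by (rule causal_measurable[OF causal_zeta])
  let ?z = "\<lambda>y. if y < S t then \<zeta> y else 0"
  let ?F = "\<lambda>v. f (a + S t - v) * \<zeta> v"
  have cz: "causal ?z" by (intro causal_truncate causal_zeta)
  have ae: "AE v in lborel. f (a + S t - v) * ?z v = indicator {S 0..S t} v * ?F v"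
    using AE_lborel_singleton[of "S t"]
    by (rule eventually_mono) (auto simp: S_0 indicator_def causal_neg[OF causal_zeta])
  have hi: "((\<lambda>s. f (a + (S t - S s))) has_integral (survival (\<mu> t) a - survival (\<mu> 0) (a + S t))) {0..t}"
    by (rule survival_mu[OF t a])
  have nn: "(\<integral>\<^sup>+s. ennreal (indicator {0..t} s * f (a + (S t - S s))) \<partial>lborel) = ennreal (survival (\<mu> t) a - survival (\<mu> 0) (a + S t))"
    using nn_integral_has_integral_lebesgue[OF _ hi] f_nonneg by simp
  have "ennreal (conv f ?z (a + S t)) = (\<integral>\<^sup>+v. ennreal (f (a + S t - v) * ?z v) \<partial>lborel)"
    unfolding conv_def
    by (rule nn_integral_eq_integral[symmetric]) (auto intro!: conv_integrable causal_f cz simp: f_nonneg zeta_nonneg)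
  also have "\<dots> = (\<integral>\<^sup>+v. ennreal (?F v * indicator {S 0..S t} v) \<partial>lborel)"
    by (rule nn_integral_cong_AE, rule eventually_mono[OF ae]) (simp only: mult.commute)
  also have "\<dots> = (\<integral>\<^sup>+s. ennreal (?F (S s) * (1 / Zc s) * indicator {0..t} s) \<partial>lborel)"
  proof (rule nn_integral_substitution[where f="?F" and g=S and g'="\<lambda>s. 1 / Zc s" and a=0 and b=t, OF _ _ inverse_Zc_continuous _ t(1)])
    show "set_borel_measurable borel {S 0..S t} ?F" unfolding set_borel_measurable_def by measurable
    show "(S has_real_derivative 1 / Zc x) (at x)" if "x \<in> {0..t}" for x using S_deriv[of x] that t by auto
    show "0 \<le> 1 / Zc x" for x using Zc_pos[of x] by simp
  qed
  also have "\<dots> = (\<integral>\<^sup>+s. ennreal (indicator {0..t} s * f (a + (S t - S s))) \<partial>lborel)"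
  proof (rule nn_integral_cong)
    fix s
    show "ennreal (?F (S s) * (1 / Zc s) * indicator {0..t} s) = ennreal (indicator {0..t} s * f (a + (S t - S s)))"
    proof (cases "s \<in> {0..t}")
      case True
      then have "\<zeta> (S s) = Zc s" using t by (simp add: zeta_S Zc_eq)
      then show ?thesis using True Zc_pos[of s] by (simp add: algebra_simps)
    qed auto
  qed
  finally have e: "ennreal (conv f ?z (a + S t)) = ennreal (survival (\<mu> t) a - survival (\<mu> 0) (a + S t))" using nn by simp
  have "0 \<le> conv f ?z (a + S t)" by (rule conv_nonneg) (auto simp: f_nonneg zeta_nonneg)
  moreover have "0 \<le> survival (\<mu> t) a - survival (\<mu> 0) (a + S t)"
    by (rule has_integral_nonneg[OF hi]) (simp add: f_nonneg)
  ultimately show ?thesis using e by simp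
qed

lemma Z_eq_survival: assumes t: "0 \<le> t" shows "Z t = survival (\<mu> t) 0"
proof -
  note M = mu_M_F[OF t]
  interpret finite_measure "\<mu> t" by (rule M_F_finite[OF M])
  have "measure (\<mu> t) {0..} = measure (\<mu> t) ({0} \<union> {0<..})" by (intro arg_cong[where f="measure (\<mu> t)"]) auto
  also have "\<dots> = measure (\<mu> t) {0} + measure (\<mu> t) {0<..}"
    by (intro finite_measure_Union M_F_in_sets[OF M]) auto
  finally show ?thesis using mu_0[OF t] by (simp add: Z_def pairing_one[OF M] survival_def)
qed

text \<open>\<open>conv_zeta\<close> at \<open>a = 0\<close> is the renewal equation, since without
  an atom at 0 the total mass is the survival function at 0.\<close>

lemma zeta_renewal:
  assumes x: "x \<le> S T"
  shows "\<zeta> x = survival (\<mu> 0) x + conv U (survival (\<mu> 0)) x"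
proof (rule renewal_unique[OF causal_survival[OF mu_M_F[OF order_refl]] causal_zeta _ x])
  fix x assume x: "x \<le> S T"
  show "\<zeta> x = survival (\<mu> 0) x + conv f \<zeta> x"
  proof (cases "x < 0")
    case True
    then show ?thesis
      using causal_neg[OF causal_zeta True] causal_neg[OF causal_conv[OF causal_f causal_zeta] True] by (simp add: survival_def)
  next
    case False
    then obtain t where t: "x = S t" "0 \<le> t" "t \<le> T"
      using x S_image by (metis atLeastAtMost_iff imageE not_le)
    have [measurable]: "\<zeta> \<in> borel_measurable borel" by (rule causal_measurable[OF causal_zeta])
    have "conv f (\<lambda>y. if y < S t then \<zeta> y else 0) (S t) = conv f \<zeta> (S t)"
      unfolding conv_def
    proof (rule integral_cong_AE)
      show "AE y in lborel. f (S t - y) * (if y < S t then \<zeta> y else 0) = f (S t - y) * \<zeta> y"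
        using AE_lborel_singleton[of "S t"] by (rule eventually_mono) (auto simp: causal_neg[OF causal_f])
    qed auto
    then show ?thesis using conv_zeta[OF t(2,3), of 0] zeta_S[OF t(2,3)] Z_eq_survival[OF t(2)] t(1) by simp
  qed
qed

text \<open>Continues \<zeta> beyond the range of the clock, because the renewal estimates concern
  solutions on the whole half-line.\<close>

definition Zr :: "real \<Rightarrow> real" where "Zr x = survival (\<mu> 0) x + conv U (survival (\<mu> 0)) x"

text \<open>Started afresh from the state at time \<open>T\<close>, the renewal equation has the
  tail of that state as free term; the analytic restart \<open>flow\<close> agrees with it.\<close>

lemma survival_mu_flow: "0 \<le> a \<Longrightarrow> survival (\<mu> T) a = flow (survival (\<mu> 0)) Zr (S T) a"
proof -
  assume a: "0 \<le> a"
  have "(\<lambda>y. if y < S T then \<zeta> y else 0) = (\<lambda>y. if y < S T then Zr y else 0)"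
    using zeta_renewal by (auto simp: Zr_def)
  then show ?thesis using conv_zeta[OF T_nonneg order_refl a] a by (simp add: flow_def)
qed

lemma Z_T: "Z T = Zr (S T)"
  using zeta_renewal[OF order_refl] zeta_S[OF T_nonneg order_refl] by (simp add: Zr_def)

text \<open>Mean value theorem with clock speed \<open>1 / Z \<ge> 1 / K\<close>. It converts a
  power rate in clock time into the same rate in real time.\<close>

lemma S_ge:
  assumes K: "\<And>x. Zr x \<le> K" "0 < K" shows "T / K \<le> S T"
proof (cases "T = 0")
  case False
  then have T: "0 < T" using T_nonneg by simp
  then obtain z where z: "0 < z" "z < T" "S T - S 0 = (T - 0) * (1 / Zc z)"
    using MVT2[OF T, of S "\<lambda>t. 1 / Zc t"] S_deriv by auto
  have "Zc z = \<zeta> (S z)" using z by (simp add: Zc_eq zeta_S)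
  also have "\<dots> = Zr (S z)" using zeta_renewal[of "S z"] S_mono[of z T] z by (simp add: Zr_def)
  finally have "Zc z \<le> K" using K by simp
  then have "1 / K \<le> 1 / Zc z" using Zc_pos[of z] by (intro divide_left_mono) (auto intro: mult_pos_pos K)
  then have "T * (1 / K) \<le> T * (1 / Zc z)" using T by (intro mult_left_mono) auto
  then show ?thesis using z(3) S_0 by simp
qed (use S_nonneg[OF T_nonneg order_refl] in simp)

end

section \<open>Set-wise closeness of measures\<close>

text \<open>Comparison in \<open>ennreal\<close> on both sides avoids subtraction; it controls both
  distances, through \<open>rho_le\<close> and \<open>tv_diff_le\<close>.\<close>

definition close_measures :: "real measure \<Rightarrow> real measure \<Rightarrow> real \<Rightarrow> bool" where
  "close_measures \<zeta>1 \<zeta>2 \<delta> \<longleftrightarrow> (\<forall>E. E \<in> sets borel \<and> E \<subseteq> {0..} \<longrightarrow>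
     emeasure \<zeta>1 E \<le> emeasure \<zeta>2 E + ennreal \<delta> \<and> emeasure \<zeta>2 E \<le> emeasure \<zeta>1 E + ennreal \<delta>)"

lemma close_measures_measure:
  assumes "\<zeta>1 \<in> M_F" "\<zeta>2 \<in> M_F" "close_measures \<zeta>1 \<zeta>2 \<delta>" "0 \<le> \<delta>" "E \<in> sets borel" "E \<subseteq> {0..}"
  shows "measure \<zeta>1 E \<le> measure \<zeta>2 E + \<delta>" "measure \<zeta>2 E \<le> measure \<zeta>1 E + \<delta>"
proof -
  interpret A: finite_measure \<zeta>1 by (rule M_F_finite) fact
  interpret B: finite_measure \<zeta>2 by (rule M_F_finite) fact
  have "ennreal (measure \<zeta>1 E) \<le> ennreal (measure \<zeta>2 E) + ennreal \<delta>"
    "ennreal (measure \<zeta>2 E) \<le> ennreal (measure \<zeta>1 E) + ennreal \<delta>"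
    using assms(3-6) unfolding close_measures_def by (auto simp: A.emeasure_eq_measure B.emeasure_eq_measure)
  then show "measure \<zeta>1 E \<le> measure \<zeta>2 E + \<delta>" "measure \<zeta>2 E \<le> measure \<zeta>1 E + \<delta>"
    using assms(4) by (simp_all add: ennreal_le_iff flip: ennreal_plus)
qed

text \<open>\<open>B\<close> is contained in \<open>enlarge B \<delta>\<close>, so closeness on the
  sets themselves suffices.\<close>

lemma rho_le:
  assumes M: "\<zeta>1 \<in> M_F" "\<zeta>2 \<in> M_F" and c: "close_measures \<zeta>1 \<zeta>2 \<delta>" and \<delta>: "0 < \<delta>"
  shows "rho \<zeta>1 \<zeta>2 \<le> \<delta>"
  unfolding rho_def
proof (rule cInf_lower)
  have mono: "measure \<zeta> B \<le> measure \<zeta> (enlarge B \<delta>)" if "\<zeta> \<in> M_F" "closed B" "B \<noteq> {}" "B \<subseteq> {0..}" for \<zeta> B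
  proof -
    interpret finite_measure \<zeta> by (rule M_F_finite) fact
    have "enlarge B \<delta> = {0..} \<inter> (\<lambda>x. infdist x B) -` {..<\<delta>}" by (auto simp: enlarge_def)
    moreover have "(\<lambda>x. infdist x B) -` {..<\<delta>} \<in> sets borel"
      by (intro borel_open open_vimage open_lessThan continuous_on_infdist continuous_on_id)
    ultimately have "enlarge B \<delta> \<in> sets borel" by simp
    moreover have "B \<subseteq> enlarge B \<delta>" using that \<delta> by (auto simp: enlarge_def)
    ultimately show ?thesis
      by (intro finite_measure_mono M_F_in_sets[OF that(1)]) (auto simp: enlarge_def)
  qed
  show "\<delta> \<in> {\<delta>. \<delta> > 0 \<and> (\<forall>B. closed B \<and> B \<noteq> {} \<and> B \<subseteq> {0..} \<longrightarrow>
        measure \<zeta>1 B \<le> measure \<zeta>2 (enlarge B \<delta>) + \<delta> \<and> measure \<zeta>2 B \<le> measure \<zeta>1 (enlarge B \<delta>) + \<delta>)}"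
  proof (intro CollectI conjI allI impI \<delta>)
    fix B :: "real set" assume B: "closed B \<and> B \<noteq> {} \<and> B \<subseteq> {0..}"
    then have b: "B \<in> sets borel" by auto
    have "measure \<zeta>1 B \<le> measure \<zeta>1 (enlarge B \<delta>)" "measure \<zeta>2 B \<le> measure \<zeta>2 (enlarge B \<delta>)"
      using B by (auto intro: mono M)
    then show "measure \<zeta>1 B \<le> measure \<zeta>2 (enlarge B \<delta>) + \<delta>" "measure \<zeta>2 B \<le> measure \<zeta>1 (enlarge B \<delta>) + \<delta>"
      using close_measures_measure[OF M c less_imp_le[OF \<delta>] b] B by linarith+
  qed
  show "bdd_below {\<delta>. \<delta> > 0 \<and> (\<forall>B. closed B \<and> B \<noteq> {} \<and> B \<subseteq> {0..} \<longrightarrow>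
        measure \<zeta>1 B \<le> measure \<zeta>2 (enlarge B \<delta>) + \<delta> \<and> measure \<zeta>2 B \<le> measure \<zeta>1 (enlarge B \<delta>) + \<delta>)}"
    by (rule bdd_belowI[of _ 0]) auto
qed

lemma layer_cake:
  fixes \<zeta> :: "real measure" and h :: "real \<Rightarrow> real"
  assumes "sigma_finite_measure \<zeta>" and h[measurable]: "h \<in> borel_measurable \<zeta>" and h01: "\<And>x. x \<in> space \<zeta> \<Longrightarrow> 0 \<le> h x \<and> h x \<le> 1"
  shows "(\<integral>\<^sup>+x. ennreal (h x) \<partial>\<zeta>) = (\<integral>\<^sup>+s. emeasure \<zeta> {x \<in> space \<zeta>. s < h x} * indicator {0..1} s \<partial>lborel)"
proof -
  interpret sigma_finite_measure \<zeta> by fact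
  interpret pair_sigma_finite lborel \<zeta> by unfold_locales
  have "(\<integral>\<^sup>+x. ennreal (h x) \<partial>\<zeta>) = (\<integral>\<^sup>+x. \<integral>\<^sup>+s. (if 0 \<le> s \<and> s \<le> 1 \<and> s < h x then 1 else 0) \<partial>lborel \<partial>\<zeta>)"
  proof (rule nn_integral_cong)
    fix x assume x: "x \<in> space \<zeta>"
    have "(\<integral>\<^sup>+s. (if 0 \<le> s \<and> s \<le> 1 \<and> s < h x then 1 else 0) \<partial>lborel) = (\<integral>\<^sup>+s. indicator {0..<h x} s \<partial>lborel)"
      using h01[OF x] by (intro nn_integral_cong) (auto simp: indicator_def)
    then show "ennreal (h x) = (\<integral>\<^sup>+s. (if 0 \<le> s \<and> s \<le> 1 \<and> s < h x then 1 else 0) \<partial>lborel)"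
      using h01[OF x] by simp
  qed
  also have "\<dots> = (\<integral>\<^sup>+s. \<integral>\<^sup>+x. (if 0 \<le> s \<and> s \<le> 1 \<and> s < h x then 1 else 0) \<partial>\<zeta> \<partial>lborel)"
    by (rule Fubini') measurable
  also have "\<dots> = (\<integral>\<^sup>+s. emeasure \<zeta> {x \<in> space \<zeta>. s < h x} * indicator {0..1} s \<partial>lborel)"
  proof (rule nn_integral_cong)
    fix s
    have "(\<integral>\<^sup>+x. (if 0 \<le> s \<and> s \<le> 1 \<and> s < h x then 1 else 0) \<partial>\<zeta>)
        = (\<integral>\<^sup>+x. indicator {x \<in> space \<zeta>. s < h x} x * indicator {0..1} s \<partial>\<zeta>)"
      by (intro nn_integral_cong) (auto simp: indicator_def)
    also have "\<dots> = emeasure \<zeta> {x \<in> space \<zeta>. s < h x} * indicator {0..1} s"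
      by (subst nn_integral_multc) auto
    finally show "(\<integral>\<^sup>+x. (if 0 \<le> s \<and> s \<le> 1 \<and> s < h x then 1 else 0) \<partial>\<zeta>)
        = emeasure \<zeta> {x \<in> space \<zeta>. s < h x} * indicator {0..1} s" .
  qed
  finally show ?thesis .
qed

text \<open>The set-wise error is integrated over the levels in \<open>{0..1}\<close>, an interval
  of length 1, so no constant is lost.\<close>

lemma nn_integral_close:
  assumes M: "\<zeta>1 \<in> M_F" "\<zeta>2 \<in> M_F" and c: "\<And>E. E \<in> sets borel \<Longrightarrow> E \<subseteq> {0..} \<Longrightarrow> emeasure \<zeta>1 E \<le> emeasure \<zeta>2 E + ennreal \<delta>"
    and h: "h \<in> borel_measurable borel_Rplus" "\<And>x. 0 \<le> x \<Longrightarrow> 0 \<le> h x \<and> h x \<le> 1"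
  shows "(\<integral>\<^sup>+x. ennreal (h x) \<partial>\<zeta>1) \<le> (\<integral>\<^sup>+x. ennreal (h x) \<partial>\<zeta>2) + ennreal \<delta>"
proof -
  have sf: "sigma_finite_measure \<zeta>" if "\<zeta> \<in> M_F" for \<zeta>
    using M_F_finite[OF that] by (simp add: finite_measure_def)
  have hm: "h \<in> borel_measurable \<zeta>" if "\<zeta> \<in> M_F" for \<zeta>
    using h(1) measurable_cong_sets[OF M_F_sets[OF that] refl] by blast
  have lc: "(\<integral>\<^sup>+x. ennreal (h x) \<partial>\<zeta>) = (\<integral>\<^sup>+s. emeasure \<zeta> {x \<in> {0..}. s < h x} * indicator {0..1} s \<partial>lborel)" if "\<zeta> \<in> M_F" for \<zeta>
    using layer_cake[OF sf[OF that] hm[OF that]] h(2) M_F_space[OF that] by simp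
  have mm: "(\<lambda>s. emeasure \<zeta> {x \<in> {0..}. s < h x} * indicator {0..1} s) \<in> borel_measurable lborel" if "\<zeta> \<in> M_F" for \<zeta>
  proof -
    interpret sigma_finite_measure \<zeta> by (rule sf[OF that])
    have [measurable]: "h \<in> borel_measurable \<zeta>" by (rule hm[OF that])
    have "(\<lambda>s. emeasure \<zeta> {x \<in> space \<zeta>. s < h x}) \<in> borel_measurable lborel" by measurable
    then show ?thesis using M_F_space[OF that] by simp
  qed
  have lev: "{x \<in> {0..}. s < h x} \<in> sets borel" for s
  proof -
    have "{x \<in> space borel_Rplus. s < h x} \<in> sets borel_Rplus"
      using h(1) by measurable
    then show ?thesis by (auto simp: space_restrict_space sets_restrict_space_iff)
  qed
  have "(\<integral>\<^sup>+x. ennreal (h x) \<partial>\<zeta>1) \<le> (\<integral>\<^sup>+s. emeasure \<zeta>2 {x \<in> {0..}. s < h x} * indicator {0..1} s + ennreal \<delta> * indicator {0..1} s \<partial>lborel)"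
    unfolding lc[OF M(1)]
  proof (rule nn_integral_mono)
    fix s :: real
    have "emeasure \<zeta>1 {x \<in> {0..}. s < h x} \<le> emeasure \<zeta>2 {x \<in> {0..}. s < h x} + ennreal \<delta>"
      by (rule c[OF lev]) auto
    then show "emeasure \<zeta>1 {x \<in> {0..}. s < h x} * indicator {0..1} s
       \<le> emeasure \<zeta>2 {x \<in> {0..}. s < h x} * indicator {0..1} s + ennreal \<delta> * indicator {0..1} s"
      by (auto simp: indicator_def)
  qed
  also have "\<dots> = (\<integral>\<^sup>+x. ennreal (h x) \<partial>\<zeta>2) + (\<integral>\<^sup>+s. ennreal \<delta> * indicator {0..1::real} s \<partial>lborel)"
    unfolding lc[OF M(2)] by (rule nn_integral_add[OF mm[OF M(2)]]) auto
  also have "(\<integral>\<^sup>+s. ennreal \<delta> * indicator {0..1::real} s \<partial>lborel) = ennreal \<delta>"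
    by (subst nn_integral_cmult_indicator) auto
  finally show ?thesis .
qed

text \<open>Write \<open>g = 2 * h - 1\<close> with \<open>h\<close> between 0 and 1: comparing
  \<open>h\<close> costs \<open>2 * \<delta>\<close>, and comparing total masses costs another
  \<delta>.\<close>

lemma tv_diff_le:
  assumes M: "\<zeta>1 \<in> M_F" "\<zeta>2 \<in> M_F" and c: "close_measures \<zeta>1 \<zeta>2 \<delta>" and \<delta>: "0 \<le> \<delta>"
  shows "tv_diff \<zeta>1 \<zeta>2 \<le> 3 * \<delta>"
  unfolding tv_diff_def
proof (rule cSUP_least)
  have "(\<lambda>_. 0) \<in> {g \<in> borel_measurable borel_Rplus. \<forall>x\<ge>0. \<bar>g x\<bar> \<le> (1::real)}" by simp
  then show "{g \<in> borel_measurable borel_Rplus. \<forall>x\<ge>0. \<bar>g x\<bar> \<le> (1::real)} \<noteq> {}" by blast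
  fix g :: "real \<Rightarrow> real" assume g: "g \<in> {g \<in> borel_measurable borel_Rplus. \<forall>x\<ge>0. \<bar>g x\<bar> \<le> 1}"
  let ?h = "\<lambda>x. (1 + g x) / 2"
  have hm: "?h \<in> borel_measurable borel_Rplus"
    using g by (intro borel_measurable_divide borel_measurable_add borel_measurable_const) simp
  have h01: "0 \<le> ?h x \<and> ?h x \<le> 1" if "0 \<le> x" for x
  proof -
    have "\<bar>g x\<bar> \<le> 1" using g that by simp
    then have "-1 \<le> g x" "g x \<le> 1" by linarith+
    then show ?thesis by simp
  qed
  have P: "integrable \<zeta> ?h" "pairing g \<zeta> = 2 * pairing ?h \<zeta> - measure \<zeta> {0..}"
    "(\<integral>\<^sup>+x. ennreal (?h x) \<partial>\<zeta>) = ennreal (pairing ?h \<zeta>)" "0 \<le> pairing ?h \<zeta>" if "\<zeta> \<in> M_F" for \<zeta>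
  proof -
    interpret finite_measure \<zeta> by (rule M_F_finite[OF that])
    have hm': "?h \<in> borel_measurable \<zeta>"
      using hm measurable_cong_sets[OF M_F_sets[OF that] refl] by blast
    show i: "integrable \<zeta> ?h"
      by (rule integrable_const_bound[where B=1, OF _ hm']) (use h01 M_F_space[OF that] in \<open>auto intro!: AE_I2\<close>)
    have "pairing g \<zeta> = (LINT x|\<zeta>. 2 * ?h x - 1)" unfolding pairing_def by (rule arg_cong[where f="integral\<^sup>L \<zeta>"]) (simp add: fun_eq_iff field_simps)
    also have "\<dots> = 2 * pairing ?h \<zeta> - measure \<zeta> {0..}"
    proof -
      have "(LINT x|\<zeta>. 2 * H x - 1) = 2 * pairing H \<zeta> - measure \<zeta> {0..}" if "integrable \<zeta> H" for H
        using that M_F_space[OF \<open>\<zeta> \<in> M_F\<close>] by (simp add: pairing_def)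
      then show ?thesis using i by blast
    qed
    finally show "pairing g \<zeta> = 2 * pairing ?h \<zeta> - measure \<zeta> {0..}" .
    show "(\<integral>\<^sup>+x. ennreal (?h x) \<partial>\<zeta>) = ennreal (pairing ?h \<zeta>)"
      unfolding pairing_def by (rule nn_integral_eq_integral[OF i]) (use h01 M_F_space[OF that] in \<open>auto intro!: AE_I2\<close>)
    show "0 \<le> pairing ?h \<zeta>" unfolding pairing_def
      by (rule Bochner_Integration.integral_nonneg_AE) (use h01 M_F_space[OF that] in \<open>auto intro!: AE_I2\<close>)
  qed
  have "ennreal (pairing ?h \<zeta>1) \<le> ennreal (pairing ?h \<zeta>2) + ennreal \<delta>"
    unfolding P(3)[OF M(1), symmetric] P(3)[OF M(2), symmetric]
    by (rule nn_integral_close[OF M _ hm h01]) (use c in \<open>auto simp: close_measures_def\<close>)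
  then have 1: "pairing ?h \<zeta>1 \<le> pairing ?h \<zeta>2 + \<delta>"
    using P(4)[OF M(2)] \<delta> by (simp add: ennreal_le_iff flip: ennreal_plus)
  have "ennreal (pairing ?h \<zeta>2) \<le> ennreal (pairing ?h \<zeta>1) + ennreal \<delta>"
    unfolding P(3)[OF M(1), symmetric] P(3)[OF M(2), symmetric]
    by (rule nn_integral_close[OF M(2,1) _ hm h01]) (use c in \<open>auto simp: close_measures_def\<close>)
  then have 2: "pairing ?h \<zeta>2 \<le> pairing ?h \<zeta>1 + \<delta>"
    using P(4)[OF M(1)] \<delta> by (simp add: ennreal_le_iff flip: ennreal_plus)
  show "\<bar>pairing g \<zeta>1 - pairing g \<zeta>2\<bar> \<le> 3 * \<delta>"
  proof -
    have "measure \<zeta>1 {0..} \<le> measure \<zeta>2 {0..} + \<delta>" "measure \<zeta>2 {0..} \<le> measure \<zeta>1 {0..} + \<delta>"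
      by (rule close_measures_measure[OF M c \<delta>]; simp)+
    then show ?thesis using 1 2 P(2)[OF M(1)] P(2)[OF M(2)] unfolding abs_le_iff by linarith
  qed
qed

section \<open>Explicit formula for the state and its comparison with the limit\<close>

context ps_data begin

text \<open>The \<nu>-mass of \<open>E\<close> translated by \<open>r\<close>: the probability that
  a new job has residual service in \<open>E\<close> after receiving \<open>r\<close> units of
  service.\<close>

definition \<kappa> :: "real \<Rightarrow> real set \<Rightarrow> ennreal" where
  "\<kappa> r E = (\<integral>\<^sup>+y. indicator E (y - r) \<partial>\<nu>)"

lemma measurable_id_nu: "(\<lambda>y. y) \<in> borel_measurable \<nu>"
  by (rule M_F_measurable[OF nu_M_F]) simp

lemma measurable_kappa:
  assumes [measurable]: "E \<in> sets borel"
  shows "(\<lambda>r. \<kappa> r E) \<in> borel_measurable borel"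
proof -
  interpret prob_space \<nu> by (rule nu_prob)
  note [measurable] = measurable_id_nu
  show ?thesis unfolding \<kappa>_def by measurable
qed

lemma emeasure_survival: assumes "\<xi> \<in> M_F" "0 \<le> x" shows "emeasure \<xi> {x<..} = ennreal (survival \<xi> x)"
proof -
  interpret finite_measure \<xi> by (rule M_F_finite) fact
  show ?thesis using assms by (simp add: survival_def emeasure_eq_measure)
qed

lemma kappa_le: assumes "0 \<le> r" "E \<subseteq> {0<..}" shows "\<kappa> r E \<le> ennreal (survival \<nu> r)"
proof -
  have "\<kappa> r E \<le> (\<integral>\<^sup>+y. indicator {r<..} y \<partial>\<nu>)"
    unfolding \<kappa>_def using assms(2) by (intro nn_integral_mono) (auto simp: indicator_def)
  also have "\<dots> = emeasure \<nu> {r<..}" using assms by (intro nn_integral_indicator M_F_in_sets[OF nu_M_F]) auto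
  finally show ?thesis using emeasure_survival[OF nu_M_F assms(1)] by simp
qed

lemma nn_integral_Ioi:
  assumes "\<xi> \<in> M_F" "0 \<le> r" "0 \<le> a"
  shows "(\<integral>\<^sup>+y. indicator {a<..} (y - r) \<partial>\<xi>) = ennreal (survival \<xi> (a + r))"
proof -
  have "(\<integral>\<^sup>+y. indicator {a<..} (y - r) \<partial>\<xi>) = (\<integral>\<^sup>+y. indicator {a+r<..} y \<partial>\<xi>)"
    by (intro nn_integral_cong) (auto simp: indicator_def)
  also have "\<dots> = emeasure \<xi> {a+r<..}" using assms by (intro nn_integral_indicator M_F_in_sets[OF assms(1)]) auto
  finally show ?thesis using emeasure_survival[OF assms(1), of "a + r"] assms by simp
qed

text \<open>Shows the excess lifetime as a superposition of aged jobs, all ages having equal weight: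
  Tonelli over \<open>x < y\<close>, then the substitution \<open>r = y - x\<close>.\<close>

lemma excess_kappa:
  assumes E[measurable]: "E \<in> sets borel" and E0: "E \<subseteq> {0<..}"
  shows "emeasure (excess_lifetime \<alpha> \<nu>) E = (\<integral>\<^sup>+r. ennreal \<alpha> * indicator {0<..} r * \<kappa> r E \<partial>lborel)"
proof -
  interpret prob_space \<nu> by (rule nu_prob)
  interpret pair_sigma_finite lborel \<nu> by unfold_locales
  note [measurable] = measurable_id_nu
  have "emeasure (excess_lifetime \<alpha> \<nu>) E = (\<integral>\<^sup>+x. ennreal (f x) * indicator E x \<partial>lborel)"
    using E0 by (intro emeasure_excess E) auto
  also have "\<dots> = (\<integral>\<^sup>+x. \<integral>\<^sup>+y. ennreal \<alpha> * indicator E x * (if x < y then 1 else 0) \<partial>\<nu> \<partial>lborel)"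
  proof (rule nn_integral_cong)
    fix x
    show "ennreal (f x) * indicator E x = (\<integral>\<^sup>+y. ennreal \<alpha> * indicator E x * (if x < y then 1 else 0) \<partial>\<nu>)"
    proof (cases "x \<in> E")
      case True
      then have x: "0 \<le> x" using E0 by auto
      have "(\<integral>\<^sup>+y. ennreal \<alpha> * indicator E x * (if x < y then 1 else 0) \<partial>\<nu>)
        = ennreal \<alpha> * indicator E x * (\<integral>\<^sup>+y. (if x < y then 1 else 0) \<partial>\<nu>)"
        by (rule nn_integral_cmult) measurable
      also have "(\<integral>\<^sup>+y. (if x < y then 1 else 0) \<partial>\<nu>) = (\<integral>\<^sup>+y. indicator {x<..} (y - 0) \<partial>\<nu>)"
        by (intro nn_integral_cong) (auto simp: indicator_def)
      also have "\<dots> = ennreal (survival \<nu> x)" using nn_integral_Ioi[OF nu_M_F order_refl x] by simp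
      finally show ?thesis using True alpha_pos survival_nonneg by (simp add: f_def ennreal_mult)
    qed simp
  qed
  also have "\<dots> = (\<integral>\<^sup>+y. \<integral>\<^sup>+x. ennreal \<alpha> * indicator E x * (if x < y then 1 else 0) \<partial>lborel \<partial>\<nu>)"
    by (rule Fubini'[symmetric]) measurable
  also have "\<dots> = (\<integral>\<^sup>+y. \<integral>\<^sup>+r. ennreal \<alpha> * indicator {0<..} r * indicator E (y - r) \<partial>lborel \<partial>\<nu>)"
  proof (rule nn_integral_cong)
    fix y
    have "(\<integral>\<^sup>+x. ennreal \<alpha> * indicator E x * (if x < y then 1 else 0) \<partial>lborel)
       = (\<integral>\<^sup>+r. ennreal \<alpha> * indicator E (y + (-1) * r) * (if y + (-1) * r < y then 1 else 0) \<partial>lborel)"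
      by (subst nn_integral_real_affine[where c="-1" and t=y]) auto
    also have "\<dots> = (\<integral>\<^sup>+r. ennreal \<alpha> * indicator {0<..} r * indicator E (y - r) \<partial>lborel)"
      by (intro nn_integral_cong) (auto simp: indicator_def)
    finally show "(\<integral>\<^sup>+x. ennreal \<alpha> * indicator E x * (if x < y then 1 else 0) \<partial>lborel)
      = (\<integral>\<^sup>+r. ennreal \<alpha> * indicator {0<..} r * indicator E (y - r) \<partial>lborel)" .
  qed
  also have "\<dots> = (\<integral>\<^sup>+r. \<integral>\<^sup>+y. ennreal \<alpha> * indicator {0<..} r * indicator E (y - r) \<partial>\<nu> \<partial>lborel)"
    by (rule Fubini') measurable
  also have "\<dots> = (\<integral>\<^sup>+r. ennreal \<alpha> * indicator {0<..} r * \<kappa> r E \<partial>lborel)"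
    unfolding \<kappa>_def by (intro nn_integral_cong nn_integral_cmult) measurable
  finally show ?thesis .
qed

text \<open>With \<open>r = u - v\<close> the limit appears as a system fed at a constant rate over
  the entire past, comparable under the integral with \<open>\<Phi>\<close>.\<close>

lemma excess_kappa_shift:
  assumes E: "E \<in> sets borel" and E0: "E \<subseteq> {0<..}"
  shows "emeasure (excess_lifetime \<alpha> \<nu>) E = (\<integral>\<^sup>+v. ennreal \<alpha> * indicator {..<u} v * \<kappa> (u - v) E \<partial>lborel)"
proof -
  have [measurable]: "(\<lambda>r. \<kappa> r E) \<in> borel_measurable borel" by (rule measurable_kappa[OF E])
  have "emeasure (excess_lifetime \<alpha> \<nu>) E
    = (\<integral>\<^sup>+v. ennreal \<alpha> * indicator {0<..} (u + (-1) * v) * \<kappa> (u + (-1) * v) E \<partial>lborel)"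
    unfolding excess_kappa[OF assms] by (subst nn_integral_real_affine[where c="-1" and t=u]) auto
  also have "\<dots> = (\<integral>\<^sup>+v. ennreal \<alpha> * indicator {..<u} v * \<kappa> (u - v) E \<partial>lborel)"
    by (intro nn_integral_cong) (auto simp: indicator_def)
  finally show ?thesis .
qed

end

lemma suminf_nn_integral_indicator:
  assumes A: "range A \<subseteq> sets borel" and "disjoint_family A" and h: "h \<in> borel_measurable M"
  shows "(\<Sum>i. \<integral>\<^sup>+y. indicator (A i) (h y) \<partial>M) = (\<integral>\<^sup>+y. indicator (\<Union>i. A i) (h y) \<partial>M)"
proof -
  have [measurable]: "A i \<in> sets borel" for i using A by auto
  note [measurable] = h
  have "(\<Sum>i. \<integral>\<^sup>+y. indicator (A i) (h y) \<partial>M) = (\<integral>\<^sup>+y. (\<Sum>i. indicator (A i) (h y)) \<partial>M)"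
    by (rule nn_integral_suminf[symmetric]) measurable
  then show ?thesis using suminf_indicator[OF assms(2)] by simp
qed

context ps_solution begin

lemma Zr_nonneg: "0 \<le> Zr x"
  unfolding Zr_def by (intro add_nonneg_nonneg survival_nonneg conv_nonneg U_nonneg)

lemma causal_Zr: "causal Zr"
  unfolding Zr_def[abs_def] by (intro causal_add causal_conv causal_U causal_survival mu_M_F order_refl)

lemma measurable_Zr [measurable]: "Zr \<in> borel_measurable borel"
  by (rule causal_measurable[OF causal_Zr])

text \<open>The formula for the state: initial jobs after \<open>S T\<close> units of service, and
  jobs that arrived when the clock showed \<open>v\<close>, at rate \<open>\<alpha> * Zr v\<close>
  per clock unit. The intersection with \<open>{0<..}\<close> makes it a measure on the whole line
  that ignores finished jobs.\<close>

definition \<Phi> :: "real set \<Rightarrow> ennreal" where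
  "\<Phi> E = (\<integral>\<^sup>+y. indicator (E \<inter> {0<..}) (y - S T) \<partial>\<mu> 0) +
     (\<integral>\<^sup>+v. ennreal (\<alpha> * Zr v) * indicator {0..<S T} v * \<kappa> (S T - v) (E \<inter> {0<..}) \<partial>lborel)"

lemma measurable_kappa_shift [measurable]:
  assumes "E \<in> sets borel" shows "(\<lambda>v. \<kappa> (S T - v) E) \<in> borel_measurable borel"
  by (rule measurable_compose[OF _ measurable_kappa[OF assms]]) measurable

lemma Phi_countably_additive: "countably_additive (sets borel) \<Phi>"
proof (rule countably_additiveI)
  fix A :: "nat \<Rightarrow> real set" assume A: "range A \<subseteq> sets borel" and dj: "disjoint_family A"
  define A' where "A' = (\<lambda>i. A i \<inter> {0<..})"
  have A': "range A' \<subseteq> sets borel" "disjoint_family A'" using A dj by (auto simp: A'_def disjoint_family_on_def)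
  have U: "(\<Union>i. A i) \<inter> {0<..} = (\<Union>i. A' i)" by (auto simp: A'_def)
  have [measurable]: "A' i \<in> sets borel" for i using A' by auto
  have m0: "(\<lambda>y. y - r) \<in> borel_measurable \<xi>" if "\<xi> \<in> M_F" for \<xi> r
    by (rule M_F_measurable[OF that]) simp
  have k: "\<kappa> r (\<Union>i. A' i) = (\<Sum>i. \<kappa> r (A' i))" for r
    unfolding \<kappa>_def by (rule suminf_nn_integral_indicator[symmetric, OF A' m0[OF nu_M_F]])
  have 2: "(\<integral>\<^sup>+v. ennreal (\<alpha> * Zr v) * indicator {0..<S T} v * \<kappa> (S T - v) (\<Union>i. A' i) \<partial>lborel)
     = (\<Sum>i. \<integral>\<^sup>+v. ennreal (\<alpha> * Zr v) * indicator {0..<S T} v * \<kappa> (S T - v) (A' i) \<partial>lborel)"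
    unfolding k ennreal_suminf_cmult[symmetric] by (rule nn_integral_suminf) measurable
  have "(\<Sum>i. \<Phi> (A i)) = (\<Sum>i. \<integral>\<^sup>+y. indicator (A' i) (y - S T) \<partial>\<mu> 0) +
    (\<Sum>i. \<integral>\<^sup>+v. ennreal (\<alpha> * Zr v) * indicator {0..<S T} v * \<kappa> (S T - v) (A' i) \<partial>lborel)"
    unfolding \<Phi>_def A'_def by (rule suminf_add[symmetric]) (rule summableI)+
  also have "\<dots> = \<Phi> (\<Union>i. A i)"
    unfolding \<Phi>_def U 2 suminf_nn_integral_indicator[OF A' m0[OF mu_M_F[OF order_refl]]] ..
  finally show "(\<Sum>i. \<Phi> (A i)) = \<Phi> (\<Union>i. A i)" .
qed

text \<open>On half-lines \<open>\<kappa>\<close> reduces to \<open>survival \<nu>\<close>, and the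
  formula becomes \<open>survival_mu_flow\<close>.\<close>

lemma Phi_Ioi: assumes a: "0 \<le> a" shows "\<Phi> {a<..} = ennreal (survival (\<mu> T) a)"
proof -
  have u: "0 \<le> S T" by (rule S_nonneg[OF T_nonneg order_refl])
  let ?z = "\<lambda>y. if y < S T then Zr y else 0"
  have cz: "causal ?z" by (intro causal_truncate causal_Zr)
  have int: "{a<..} \<inter> {0<..} = {a<..}" using a by auto
  have "(\<integral>\<^sup>+v. ennreal (\<alpha> * Zr v) * indicator {0..<S T} v * \<kappa> (S T - v) {a<..} \<partial>lborel)
     = (\<integral>\<^sup>+v. ennreal (f (a + S T - v) * ?z v) \<partial>lborel)"
  proof (rule nn_integral_cong)
    fix v
    show "ennreal (\<alpha> * Zr v) * indicator {0..<S T} v * \<kappa> (S T - v) {a<..} = ennreal (f (a + S T - v) * ?z v)"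
    proof (cases "0 \<le> v \<and> v < S T")
      case True
      then have "\<kappa> (S T - v) {a<..} = ennreal (survival \<nu> (a + S T - v))"
        unfolding \<kappa>_def using nn_integral_Ioi[OF nu_M_F _ a, of "S T - v"] by (simp add: algebra_simps)
      then show ?thesis using True alpha_pos Zr_nonneg survival_nonneg
        by (simp add: f_def ennreal_mult ac_simps)
    qed (auto simp: causal_neg[OF causal_Zr])
  qed
  also have "\<dots> = ennreal (conv f ?z (a + S T))"
    unfolding conv_def by (rule nn_integral_eq_integral[OF conv_integrable[OF causal_f cz]]) (auto simp: f_nonneg Zr_nonneg)
  finally have "\<Phi> {a<..} = ennreal (survival (\<mu> 0) (a + S T)) + ennreal (conv f ?z (a + S T))"
    unfolding \<Phi>_def int nn_integral_Ioi[OF mu_M_F[OF order_refl] u a] by simp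
  also have "\<dots> = ennreal (survival (\<mu> T) a)"
    unfolding survival_mu_flow[OF a] using a by (simp add: flow_def survival_nonneg conv_nonneg f_nonneg Zr_nonneg flip: ennreal_plus)
  finally show ?thesis .
qed

text \<open>Both sides are finite measures with the same tails.\<close>

lemma emeasure_mu:
  assumes E: "E \<in> sets borel" and E0: "E \<subseteq> {0<..}"
  shows "emeasure (\<mu> T) E = \<Phi> E"
proof -
  note M = mu_M_F[OF T_nonneg]
  interpret finite_measure "\<mu> T" by (rule M_F_finite[OF M])
  define N where "N = measure_of UNIV (sets borel) \<Phi>"
  have sN: "sets N = sets borel" unfolding N_def using sets.sigma_sets_eq[of "borel :: real measure"] by simp
  have eN: "emeasure N A = \<Phi> A" if "A \<in> sets borel" for A
  proof (rule emeasure_measure_of[OF N_def])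
    show "positive (sets N) \<Phi>" by (simp add: positive_def \<Phi>_def \<kappa>_def)
    show "countably_additive (sets N) \<Phi>" unfolding sN by (rule Phi_countably_additive)
    show "A \<in> sets N" using that sN by simp
  qed simp
  let ?D = "distr (\<mu> T) borel (\<lambda>x. x)"
  have idm: "(\<lambda>x. x) \<in> borel_measurable (\<mu> T)" by (rule M_F_measurable[OF M]) simp
  have eD: "emeasure ?D A = emeasure (\<mu> T) (A \<inter> {0..})" if "A \<in> sets borel" for A
    by (subst emeasure_distr[OF idm]) (use that M_F_space[OF M] in auto)
  have null: "emeasure (\<mu> T) {0} = 0" using mu_0[OF T_nonneg] by (simp add: emeasure_eq_measure)
  have "?D = N"
  proof (rule measure_eqI_lessThan)
    show "sets ?D = sets borel" "sets N = sets borel" using sN by auto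
    show "emeasure ?D {x<..} < \<infinity>" for x by (subst eD) (auto simp: emeasure_eq_measure)
    show "emeasure ?D {x<..} = emeasure N {x<..}" for x
    proof (cases "0 \<le> x")
      case True
      then have "{x<..} \<inter> {0..} = {x<..}" by auto
      then show ?thesis using True eD[of "{x<..}"] eN[of "{x<..}"] Phi_Ioi[OF True] emeasure_survival[OF M True] by simp
    next
      case False
      then have "{x<..} \<inter> {0..} = {0} \<union> {0<..}" by auto
      moreover have "emeasure (\<mu> T) ({0} \<union> {0<..}) = emeasure (\<mu> T) {0} + emeasure (\<mu> T) {0<..}"
        by (intro plus_emeasure[symmetric] M_F_in_sets[OF M]) auto
      moreover have "\<Phi> {x<..} = \<Phi> {0<..}"
      proof -
        have "{x<..} \<inter> {0<..} = {0<..} \<inter> {0<..}" using False by auto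
        then show ?thesis unfolding \<Phi>_def by simp
      qed
      ultimately show ?thesis
        using eD[of "{x<..}"] eN[of "{x<..}"] Phi_Ioi[OF order_refl] emeasure_survival[OF M order_refl] null by simp
    qed
  qed
  then have "emeasure (\<mu> T) (E \<inter> {0..}) = \<Phi> E" using eD[OF E] eN[OF E] by simp
  moreover have "E \<inter> {0..} = E" using E0 by auto
  ultimately show ?thesis by simp
qed

text \<open>\<open>\<Delta>\<close> collects three errors: initial jobs still present, the deviation
  \<open>d\<close> of the mass from \<open>b\<close>, and arrivals before clock time 0, which only
  the limit has. Bounding \<open>\<kappa>\<close> by \<open>survival \<nu>\<close> makes the errors
  independent of the set.\<close>

lemma set_bounds:
  assumes b: "0 \<le> b" and d: "\<And>v. d v = Zr v - b * unit_step v"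
    and E: "E \<in> sets borel" and E0: "E \<subseteq> {0<..}"
  defines "\<Delta> \<equiv> survival (\<mu> 0) (S T) + conv f (\<lambda>v. \<bar>d v\<bar>) (S T) + b * k (S T)"
  shows "emeasure (\<mu> T) E \<le> ennreal b * emeasure (excess_lifetime \<alpha> \<nu>) E + ennreal \<Delta>"
    and "ennreal b * emeasure (excess_lifetime \<alpha> \<nu>) E \<le> emeasure (\<mu> T) E + ennreal \<Delta>"
proof -
  define u where "u = S T"
  have u: "0 \<le> u" unfolding u_def by (rule S_nonneg[OF T_nonneg order_refl])
  note M0 = mu_M_F[OF order_refl]
  have cd: "causal d" unfolding d[abs_def] by (intro causal_diff causal_Zr causal_mult_left causal_unit_step)
  have [measurable]: "d \<in> borel_measurable borel" "(\<lambda>v. \<kappa> (u - v) E) \<in> borel_measurable borel"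
    using causal_measurable[OF cd] measurable_kappa_shift[OF E] by (auto simp: u_def)
  have EE: "E \<inter> {0<..} = E" using E0 by auto
  have nnc: "0 \<le> conv f (\<lambda>v. \<bar>d v\<bar>) u" by (rule conv_nonneg) (auto simp: f_nonneg)
  have tl0: "0 \<le> survival (\<mu> 0) u" "0 \<le> b * k u" using survival_nonneg b k_nonneg by auto
  have \<Delta>: "ennreal \<Delta> = ennreal (survival (\<mu> 0) u) + ennreal (conv f (\<lambda>v. \<bar>d v\<bar>) u) + ennreal (b * k u)"
    unfolding \<Delta>_def u_def[symmetric] using nnc tl0 by (simp add: ennreal_plus)
  define A where "A = (\<integral>\<^sup>+y. indicator E (y - u) \<partial>\<mu> 0)"
  define P where "P = (\<integral>\<^sup>+v. ennreal (\<alpha> * Zr v) * indicator {0..<u} v * \<kappa> (u - v) E \<partial>lborel)"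
  define Q where "Q = (\<integral>\<^sup>+v. ennreal (\<alpha> * b) * indicator {..<u} v * \<kappa> (u - v) E \<partial>lborel)"
  have mu: "emeasure (\<mu> T) E = A + P"
    using emeasure_mu[OF E E0] unfolding \<Phi>_def EE u_def[symmetric] A_def P_def .
  have expw: "ennreal b * emeasure (excess_lifetime \<alpha> \<nu>) E = Q"
    unfolding excess_kappa_shift[OF E E0, of u] Q_def
    using b alpha_pos by (subst nn_integral_cmult[symmetric]) (auto simp: ennreal_mult ac_simps intro!: nn_integral_cong)
  have "A \<le> (\<integral>\<^sup>+y. indicator {0<..} (y - u) \<partial>\<mu> 0)"
    unfolding A_def using E0 by (intro nn_integral_mono) (auto simp: indicator_def)
  then have A: "A \<le> ennreal (survival (\<mu> 0) u)" using nn_integral_Ioi[OF M0 u order_refl] by simp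
  have C: "(\<integral>\<^sup>+v. ennreal (f (u - v) * \<bar>d v\<bar>) \<partial>lborel) = ennreal (conv f (\<lambda>v. \<bar>d v\<bar>) u)"
    unfolding conv_def
    by (rule nn_integral_eq_integral[OF conv_integrable[OF causal_f causal_abs[OF cd]]]) (auto simp: f_nonneg)
  have kap: "ennreal c * \<kappa> (u - v) E \<le> ennreal (c * survival \<nu> (u - v))" if "v < u" "0 \<le> c" for v c
    using kappa_le[of "u - v" E] E0 that survival_nonneg by (simp add: ennreal_mult mult_left_mono)
  have "P \<le> (\<integral>\<^sup>+v. ennreal (\<alpha> * b) * indicator {..<u} v * \<kappa> (u - v) E + ennreal (f (u - v) * \<bar>d v\<bar>) \<partial>lborel)"
    unfolding P_def
  proof (rule nn_integral_mono)
    fix v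
    show "ennreal (\<alpha> * Zr v) * indicator {0..<u} v * \<kappa> (u - v) E
       \<le> ennreal (\<alpha> * b) * indicator {..<u} v * \<kappa> (u - v) E + ennreal (f (u - v) * \<bar>d v\<bar>)"
    proof (cases "0 \<le> v \<and> v < u")
      case True
      have "\<alpha> * Zr v \<le> \<alpha> * (b + \<bar>d v\<bar>)" using d[of v] True alpha_pos by (intro mult_left_mono) auto
      then have "ennreal (\<alpha> * Zr v) \<le> ennreal (\<alpha> * b + \<alpha> * \<bar>d v\<bar>)"
        by (intro ennreal_leI) (simp add: algebra_simps)
      also have "\<dots> = ennreal (\<alpha> * b) + ennreal (\<alpha> * \<bar>d v\<bar>)"
        using alpha_pos b by (intro ennreal_plus) auto
      finally have "ennreal (\<alpha> * Zr v) \<le> ennreal (\<alpha> * b) + ennreal (\<alpha> * \<bar>d v\<bar>)" .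
      then have "ennreal (\<alpha> * Zr v) * \<kappa> (u - v) E \<le> (ennreal (\<alpha> * b) + ennreal (\<alpha> * \<bar>d v\<bar>)) * \<kappa> (u - v) E"
        by (rule mult_right_mono) simp
      also have "\<dots> \<le> ennreal (\<alpha> * b) * \<kappa> (u - v) E + ennreal (\<alpha> * \<bar>d v\<bar> * survival \<nu> (u - v))"
        unfolding distrib_right using True alpha_pos by (intro add_left_mono kap) auto
      finally show ?thesis using True by (simp add: f_def ac_simps)
    qed auto
  qed
  also have "\<dots> = Q + ennreal (conv f (\<lambda>v. \<bar>d v\<bar>) u)"
    unfolding Q_def C[symmetric] by (rule nn_integral_add) measurable
  finally have P: "P \<le> Q + ennreal (conv f (\<lambda>v. \<bar>d v\<bar>) u)" .
  show "emeasure (\<mu> T) E \<le> ennreal b * emeasure (excess_lifetime \<alpha> \<nu>) E + ennreal \<Delta>"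
  proof -
    have "A + P \<le> ennreal (survival (\<mu> 0) u) + (Q + ennreal (conv f (\<lambda>v. \<bar>d v\<bar>) u)) + 0"
      using add_mono[OF A P] by simp
    also have "\<dots> \<le> ennreal (survival (\<mu> 0) u) + (Q + ennreal (conv f (\<lambda>v. \<bar>d v\<bar>) u)) + ennreal (b * k u)"
      by (rule add_left_mono) simp
    finally show ?thesis unfolding mu expw \<Delta> by (simp add: ac_simps)
  qed
  \<comment> \<open>Arrivals at \<open>v < 0\<close> have age above \<open>u\<close> at clock time
    \<open>u\<close>; together they weigh \<open>b * k u\<close>.\<close>
  have K: "(\<integral>\<^sup>+v. ennreal (b * (indicator {u<..} (u - v) * f (u - v))) \<partial>lborel) = ennreal (b * k u)"
  proof -
    have "(\<integral>\<^sup>+v. ennreal (b * (indicator {u<..} (u + (-1) * v) * f (u + (-1) * v))) \<partial>lborel)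
       = (\<integral>\<^sup>+r. ennreal (b * (indicator {u<..} r * f r)) \<partial>lborel)"
      by (subst (2) nn_integral_real_affine[where c="-1" and t=u]) auto
    also have "\<dots> = ennreal (LINT r|lborel. b * (indicator {u<..} r * f r))"
      using b f_nonneg integrable_indicator_f[of "{u<..}"] by (intro nn_integral_eq_integral) auto
    finally show ?thesis using k_tail[OF u] by simp
  qed
  have "Q \<le> (\<integral>\<^sup>+v. (ennreal (\<alpha> * Zr v) * indicator {0..<u} v * \<kappa> (u - v) E + ennreal (f (u - v) * \<bar>d v\<bar>))
       + ennreal (b * (indicator {u<..} (u - v) * f (u - v))) \<partial>lborel)"
    unfolding Q_def
  proof (rule nn_integral_mono)
    fix v
    show "ennreal (\<alpha> * b) * indicator {..<u} v * \<kappa> (u - v) E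
       \<le> (ennreal (\<alpha> * Zr v) * indicator {0..<u} v * \<kappa> (u - v) E + ennreal (f (u - v) * \<bar>d v\<bar>))
         + ennreal (b * (indicator {u<..} (u - v) * f (u - v)))"
    proof (cases "v < u")
      case vu: True
      show ?thesis
      proof (cases "0 \<le> v")
        case True
        have "\<alpha> * b \<le> \<alpha> * (Zr v + \<bar>d v\<bar>)" using d[of v] True alpha_pos by (intro mult_left_mono) auto
        then have "ennreal (\<alpha> * b) \<le> ennreal (\<alpha> * Zr v + \<alpha> * \<bar>d v\<bar>)"
          by (intro ennreal_leI) (simp add: algebra_simps)
        also have "\<dots> = ennreal (\<alpha> * Zr v) + ennreal (\<alpha> * \<bar>d v\<bar>)"
          using alpha_pos Zr_nonneg[of v] by (intro ennreal_plus) auto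
        finally have "ennreal (\<alpha> * b) \<le> ennreal (\<alpha> * Zr v) + ennreal (\<alpha> * \<bar>d v\<bar>)" .
        then have "ennreal (\<alpha> * b) * \<kappa> (u - v) E \<le> (ennreal (\<alpha> * Zr v) + ennreal (\<alpha> * \<bar>d v\<bar>)) * \<kappa> (u - v) E"
          by (rule mult_right_mono) simp
        also have "\<dots> \<le> ennreal (\<alpha> * Zr v) * \<kappa> (u - v) E + ennreal (\<alpha> * \<bar>d v\<bar> * survival \<nu> (u - v))"
          unfolding distrib_right using vu alpha_pos by (intro add_left_mono kap) auto
        finally show ?thesis using True vu by (simp add: f_def ac_simps)
      next
        case False
        have "ennreal (\<alpha> * b) * \<kappa> (u - v) E \<le> ennreal (\<alpha> * b * survival \<nu> (u - v))"
          using alpha_pos b vu by (intro kap) auto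
        also have "\<alpha> * b * survival \<nu> (u - v) = b * (indicator {u<..} (u - v) * f (u - v))"
          using False by (simp add: f_def)
        finally have "ennreal (\<alpha> * b) * indicator {..<u} v * \<kappa> (u - v) E
            \<le> ennreal (b * (indicator {u<..} (u - v) * f (u - v)))" using vu by simp
        then show ?thesis by (rule order_trans) (rule add_increasing[OF zero_le order_refl])
      qed
    qed auto
  qed
  also have "\<dots> = (\<integral>\<^sup>+v. ennreal (\<alpha> * Zr v) * indicator {0..<u} v * \<kappa> (u - v) E + ennreal (f (u - v) * \<bar>d v\<bar>) \<partial>lborel)
      + ennreal (b * k u)"
    unfolding K[symmetric] by (rule nn_integral_add) measurable
  also have "(\<integral>\<^sup>+v. ennreal (\<alpha> * Zr v) * indicator {0..<u} v * \<kappa> (u - v) E + ennreal (f (u - v) * \<bar>d v\<bar>) \<partial>lborel)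
      = P + ennreal (conv f (\<lambda>v. \<bar>d v\<bar>) u)"
    unfolding P_def C[symmetric] by (rule nn_integral_add) measurable
  finally have Q: "Q \<le> P + ennreal (conv f (\<lambda>v. \<bar>d v\<bar>) u) + ennreal (b * k u)" .
  show "ennreal b * emeasure (excess_lifetime \<alpha> \<nu>) E \<le> emeasure (\<mu> T) E + ennreal \<Delta>"
  proof -
    have "Q \<le> 0 + (P + ennreal (conv f (\<lambda>v. \<bar>d v\<bar>) u) + ennreal (b * k u))" using Q by simp
    also have "\<dots> \<le> (A + ennreal (survival (\<mu> 0) u)) + (P + ennreal (conv f (\<lambda>v. \<bar>d v\<bar>) u) + ennreal (b * k u))"
      by (rule add_right_mono) simp
    finally show ?thesis unfolding mu expw \<Delta> by (simp add: ac_simps)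
  qed
qed

end

lemma emeasure_drop_0:
  assumes \<zeta>: "\<zeta> \<in> M_F" and 0: "measure \<zeta> {0} = 0" and E: "E \<in> sets borel" "E \<subseteq> {0..}"
  shows "emeasure \<zeta> E = emeasure \<zeta> (E \<inter> {0<..})"
proof -
  interpret finite_measure \<zeta> by (rule M_F_finite[OF \<zeta>])
  have "emeasure \<zeta> E \<le> emeasure \<zeta> ((E \<inter> {0<..}) \<union> {0})"
    using E by (intro emeasure_mono M_F_in_sets[OF \<zeta>]) (auto simp: less_le)
  also have "\<dots> = emeasure \<zeta> (E \<inter> {0<..}) + emeasure \<zeta> {0}"
    using E by (intro plus_emeasure[symmetric] M_F_in_sets[OF \<zeta>]) auto
  finally have "emeasure \<zeta> E \<le> emeasure \<zeta> (E \<inter> {0<..})" using 0 by (simp add: emeasure_eq_measure)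
  moreover have "emeasure \<zeta> (E \<inter> {0<..}) \<le> emeasure \<zeta> E"
    using E by (intro emeasure_mono M_F_in_sets[OF \<zeta>]) auto
  ultimately show ?thesis by (rule antisym)
qed

lemma tl_0_eq_0:
  assumes \<xi>: "\<xi> \<in> M_F" and fin: "epairing (\<lambda>x. x) \<xi> < \<infinity>" and 0: "pairing (\<lambda>x. x) \<xi> = 0"
  shows "survival \<xi> 0 = 0"
proof -
  interpret finite_measure \<xi> by (rule M_F_finite[OF \<xi>])
  have m: "(\<lambda>x. ennreal x) \<in> borel_measurable \<xi>" by (rule M_F_measurable[OF \<xi>]) simp
  have "epairing (\<lambda>x. x) \<xi> = 0" using fin 0 unfolding pairing_id_eq[OF \<xi>] by (auto simp: enn2real_eq_0_iff)
  then have ae: "AE x in \<xi>. ennreal x = 0" unfolding epairing_def using nn_integral_0_iff_AE[OF m] by simp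
  have "emeasure \<xi> {0<..} = (\<integral>\<^sup>+x. indicator {0<..} x \<partial>\<xi>)"
    by (intro nn_integral_indicator[symmetric] M_F_in_sets[OF \<xi>]) auto
  also have "\<dots> = (\<integral>\<^sup>+x. 0 \<partial>\<xi>)"
    by (rule nn_integral_cong_AE, rule eventually_mono[OF ae]) (auto simp: indicator_def ennreal_eq_0_iff)
  finally show ?thesis by (simp add: survival_def measure_def)
qed

lemma B_rhoD:
  assumes "\<xi> \<in> B_rho M q" "0 < M"
  shows "\<xi> \<in> M_F" "measure \<xi> {0..} \<le> M" "epairing (\<lambda>x. x) \<xi> < \<infinity>"
    "0 \<le> pairing (\<lambda>x. x) \<xi>" "pairing (\<lambda>x. x) \<xi> \<le> M" "epairing (\<lambda>x. x powr (1 + q)) \<xi> \<le> ennreal M"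
proof -
  show \<xi>: "\<xi> \<in> M_F" using assms(1) unfolding B_rho_def M_F_c_def by auto
  interpret finite_measure \<xi> by (rule M_F_finite[OF \<xi>])
  have le: "epairing (\<lambda>_. 1) \<xi> \<le> ennreal M" "epairing (\<lambda>x. x) \<xi> \<le> ennreal M" "epairing (\<lambda>x. x powr (1 + q)) \<xi> \<le> ennreal M"
    using assms(1) unfolding B_rho_def by auto
  show "epairing (\<lambda>x. x powr (1 + q)) \<xi> \<le> ennreal M" by (rule le)
  show "epairing (\<lambda>x. x) \<xi> < \<infinity>" using le(2) by (auto simp: top.not_eq_extremum intro: le_less_trans)
  show "0 \<le> pairing (\<lambda>x. x) \<xi>" unfolding pairing_id_eq[OF \<xi>] by simp
  have "enn2real (epairing (\<lambda>x. x) \<xi>) \<le> enn2real (ennreal M)" by (rule enn2real_mono[OF le(2)]) simp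
  then show "pairing (\<lambda>x. x) \<xi> \<le> M" using assms(2) unfolding pairing_id_eq[OF \<xi>] by simp
  have "epairing (\<lambda>_. 1) \<xi> = ennreal (measure \<xi> {0..})"
    unfolding epairing_def using M_F_space[OF \<xi>] by (simp add: emeasure_eq_measure)
  then show "measure \<xi> {0..} \<le> M" using le(1) assms(2) by (simp add: ennreal_le_iff)
qed

section \<open>The uniform rate over the ball of initial states\<close>

context ps_data begin

lemma excess_0: "measure (excess_lifetime \<alpha> \<nu>) {0} = 0"
proof -
  have "emeasure (excess_lifetime \<alpha> \<nu>) {0} = (\<integral>\<^sup>+x. ennreal (f x) * indicator {0} x \<partial>lborel)"
    by (intro emeasure_excess) auto
  also have "\<dots> = ennreal (f 0) * emeasure lborel {0::real}"
    by (rule nn_integral_indicator_singleton) auto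
  also have "\<dots> = 0" by simp
  finally show ?thesis by (simp add: measure_def)
qed

lemma limit_state_M_F: "limit_state \<alpha> \<nu> \<xi> \<in> M_F"
proof -
  have "emeasure (limit_state \<alpha> \<nu> \<xi>) {0..} < \<infinity>"
    using finite_measure.emeasure_finite[OF M_F_finite[OF excess_M_F]]
    unfolding limit_state_def by (simp add: ennreal_mult_less_top less_top)
  then show ?thesis unfolding M_F_def
    by (auto intro!: finite_measureI simp: limit_state_def space_scale_measure space_excess sets_excess)
qed

text \<open>A positive mean gives \<open>survival \<xi> a > 0\<close> for some \<open>a > 0\<close>.
  Up to \<open>a\<close> the free term is large enough; beyond it \<open>U \<ge> c\<close> meets
  values of at least \<open>survival \<xi> a\<close> on \<open>{0..a}\<close>.\<close>

lemma renewal_positive: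
  assumes \<xi>: "\<xi> \<in> M_F" and fin: "epairing (\<lambda>x. x) \<xi> < \<infinity>" and pos: "0 < pairing (\<lambda>x. x) \<xi>"
    and c: "0 < c" "\<And>x. 0 \<le> x \<Longrightarrow> c \<le> U x"
  obtains z where "0 < z" "\<And>x. 0 \<le> x \<Longrightarrow> z \<le> survival \<xi> x + conv U (survival \<xi>) x" "0 < survival \<xi> 0"
proof -
  have "\<exists>a>0. survival \<xi> a > 0"
  proof (rule ccontr)
    assume "\<not> (\<exists>a>0. survival \<xi> a > 0)"
    then have *: "survival \<xi> x = 0" if "x \<noteq> 0" for x
    proof (cases "x < 0")
      case True then show ?thesis by (simp add: survival_def)
    next
      case False
      then have "\<not> 0 < survival \<xi> x" using that \<open>\<not> (\<exists>a>0. survival \<xi> a > 0)\<close> by (metis not_less_iff_gr_or_eq)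
      then show ?thesis using survival_nonneg[of \<xi> x] by linarith
    qed
    have "AE x in lborel. survival \<xi> x = 0"
      using AE_lborel_singleton[of "0::real"] by (rule eventually_mono) (rule *)
    then have "(LINT x|lborel. survival \<xi> x) = 0" by (rule integral_eq_zero_AE)
    then show False using survival_integrable(2)[OF \<xi> fin] pos by simp
  qed
  then obtain a where a: "0 < a" "0 < survival \<xi> a" by blast
  have nn: "0 \<le> conv U (survival \<xi>) x" for x by (intro conv_nonneg U_nonneg survival_nonneg)
  show thesis
  proof (rule that[of "min (survival \<xi> a) (c * survival \<xi> a * a)"])
    show "0 < min (survival \<xi> a) (c * survival \<xi> a * a)" using a c by simp
    show "0 < survival \<xi> 0" using a survival_anti[OF \<xi>, of 0 a] by simp
    fix x :: real assume x: "0 \<le> x"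
    show "min (survival \<xi> a) (c * survival \<xi> a * a) \<le> survival \<xi> x + conv U (survival \<xi>) x"
    proof (cases "x \<le> a")
      case True
      then show ?thesis using survival_anti[OF \<xi> x True] nn[of x] by linarith
    next
      case False
      have "c * survival \<xi> a * a = (LINT y|lborel. c * survival \<xi> a * indicator {0..a} y)" using a by simp
      also have "\<dots> \<le> conv U (survival \<xi>) x" unfolding conv_def
      proof (rule integral_mono)
        show "integrable lborel (\<lambda>y. U (x - y) * survival \<xi> y)" by (intro conv_integrable causal_U causal_survival \<xi>)
        show "c * survival \<xi> a * indicator {0..a} y \<le> U (x - y) * survival \<xi> y" for y
        proof (cases "y \<in> {0..a}")
          case True
          then have "c * survival \<xi> a \<le> U (x - y) * survival \<xi> y"
            using False c a survival_anti[OF \<xi>, of y a] by (intro mult_mono U_nonneg) auto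
          then show ?thesis using True by simp
        qed (simp add: U_nonneg survival_nonneg)
      qed (auto simp: emeasure_lborel_Icc_eq)
      finally show ?thesis using survival_nonneg[of \<xi> x] by linarith
    qed
  qed
qed

text \<open>Before \<open>t_star\<close> the mass is a value of \<open>Zr\<close>, hence at least a
  fixed \<open>z > 0\<close>. By continuity this would persist at a finite positive
  \<open>t_star\<close>, where the solution has mass 0. A \<open>t_star\<close> of 0 contradicts the
  positive initial mass.\<close>

lemma never_empty:
  assumes sol: "fluid_model_solution \<alpha> \<nu> \<mu>" and fin: "epairing (\<lambda>x. x) (\<mu> 0) < \<infinity>"
    and pos: "0 < pairing (\<lambda>x. x) (\<mu> 0)" and c: "0 < c" "\<And>x. 0 \<le> x \<Longrightarrow> c \<le> U x" and t: "0 \<le> t"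
  shows "ereal t < t_star \<mu>"
proof (rule ccontr)
  assume "\<not> ereal t < t_star \<mu>"
  then have le: "t_star \<mu> \<le> ereal t" by simp
  have M: "\<mu> s \<in> M_F" if "0 \<le> s" for s using sol that unfolding fluid_model_solution_def by auto
  obtain z where z: "0 < z" "\<And>x. 0 \<le> x \<Longrightarrow> z \<le> survival (\<mu> 0) x + conv U (survival (\<mu> 0)) x" "0 < survival (\<mu> 0) 0"
    using renewal_positive[OF M[OF order_refl] fin pos c] by blast
  have "0 \<le> t_star \<mu>" unfolding t_star_def by (rule INF_greatest) auto
  then obtain t0 where t0: "t_star \<mu> = ereal t0" "0 \<le> t0" using le by (cases "t_star \<mu>") auto
  have Z0: "pairing (\<lambda>_. 1) (\<mu> t0) = 0"
    using sol t0 unfolding fluid_model_solution_def by auto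
  have cont: "continuous_on {0..} (\<lambda>s. pairing (\<lambda>_. 1) (\<mu> s))"
    using sol unfolding fluid_model_solution_def continuous_map_weak_topology
    by (auto simp: bdd_cont_def image_constant_conv)
  show False
  proof (cases "t0 = 0")
    case True
    interpret finite_measure "\<mu> 0" by (rule M_F_finite[OF M[OF order_refl]])
    have "survival (\<mu> 0) 0 \<le> measure (\<mu> 0) {0..}" by (rule survival_le[OF M[OF order_refl]])
    then show False using Z0 z(3) True pairing_one[OF M[OF order_refl]] by simp
  next
    case False
    then have pos0: "0 < t0" using t0 by simp
    have cl: "closure {0..<t0} = {0..t0}" using pos0 by simp
    have "z \<le> pairing (\<lambda>_. 1) (\<mu> t0)"
    proof (rule continuous_ge_on_closure[where S="{0..<t0}" and f="\<lambda>s. pairing (\<lambda>_. 1) (\<mu> s)"])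
      show "continuous_on (closure {0..<t0}) (\<lambda>s. pairing (\<lambda>_. 1) (\<mu> s))"
        unfolding cl by (rule continuous_on_subset[OF cont]) auto
      show "t0 \<in> closure {0..<t0}" using cl pos0 by simp
      fix s assume s: "s \<in> {0..<t0}"
      interpret P: ps_solution \<alpha> \<nu> \<mu> s
        by unfold_locales (use sol s t0 in auto)
      have "z \<le> P.Zr (P.S s)" using z(2)[OF P.S_nonneg[OF P.T_nonneg order_refl]] by (simp add: P.Zr_def)
      then show "z \<le> pairing (\<lambda>_. 1) (\<mu> s)" using P.Z_T by (simp add: P.Z_def)
    qed
    then show False using Z0 z(1) by simp
  qed
qed

text \<open>Subtracting \<open>b * unit_step\<close> from \<open>Zr\<close> changes the free term
  into \<open>survival \<xi> - b * k\<close>. As \<beta> is the reciprocal of the integral of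
  \<open>k\<close>, the choice \<open>b = \<beta> * w\<close> is the one that centres it,
  \<open>w\<close> being the integral of \<open>survival \<xi>\<close>.\<close>

lemma close_limit_state:
  assumes q: "0 < q" and fin: "epairing (\<lambda>x. x powr (2 + q)) \<nu> < \<infinity>" and M: "0 < M"
  obtains C T0 where "C > 0" "T0 \<ge> 1"
    "\<And>\<xi> \<mu> t. \<xi> \<in> B_rho M q \<Longrightarrow> \<mu> \<in> solutions_from \<alpha> \<nu> \<xi> \<Longrightarrow> T0 \<le> t \<Longrightarrow>
       close_measures (\<mu> t) (limit_state \<alpha> \<nu> \<xi>) (C * t powr (-q))"
proof -
  obtain B where "renewal_density_moment f \<alpha> q B" using moment_locale[OF q fin] .
  then interpret R: renewal_density_moment f \<alpha> q B .
  obtain c where c: "0 < c" "c < 1" "\<And>x. 0 \<le> x \<Longrightarrow> c \<le> U x" using R.U_lower by blast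
  define \<beta> where "\<beta> = beta_e \<alpha> \<nu>"
  have \<beta>: "\<beta> * (LINT x|lborel. k x) = 1" "\<beta> > 0" unfolding \<beta>_def by (rule beta_e_eq[OF q fin])+
  \<comment> \<open>Bound for the total mass: \<open>M\<close> for the free term, and
    \<open>5 * \<alpha> * M\<close> for \<open>conv U\<close> by \<open>U_le\<close>.\<close>
  define K where "K = M + 5 * \<alpha> * M"
  have K: "0 < K" using M alpha_pos by (simp add: K_def add_pos_pos)
  \<comment> \<open>Dominates the three sizes in \<open>centred\<close>:
    \<open>K + \<beta> * M\<close> for \<open>d\<close>, \<open>2 * M\<close> for the norm of
    \<open>g\<close>, and \<open>M + \<beta> * M * B\<close> for its tail.\<close>
  define G where "G = K + \<beta> * M + 2 * M + \<beta> * M * B"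
  have G: "0 \<le> G" using K \<beta> M R.B_nonneg by (simp add: G_def)
  obtain C1 where C1: "C1 \<ge> 0" "\<forall>g d. R.centred G g d \<longrightarrow> (\<forall>u\<ge>8. conv f (\<lambda>x. \<bar>d x\<bar>) u \<le> C1 * u powr (-q))"
    using R.renewal_rate[OF G] by blast
  define C2 where "C2 = M * 2 powr q + C1 + \<beta> * M * (B * 2 powr q)"
  \<comment> \<open>The factor \<open>K powr q\<close> comes from passing to real time; the summand
    1 only makes \<open>C\<close> positive.\<close>
  define C where "C = C2 * K powr q + 1"
  have C2: "0 \<le> C2" using M C1(1) \<beta> R.B_nonneg by (simp add: C2_def)
  have C: "0 < C" using C2 by (simp add: C_def add_nonneg_pos)
  show thesis
  \<comment> \<open>From time \<open>8 * K\<close> on the clock shows at least 8, where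
    \<open>renewal_rate\<close> starts.\<close>
  proof (rule that[OF C, of "max 1 (8 * K)"])
    fix \<xi> \<mu> t
    assume \<xi>B: "\<xi> \<in> B_rho M q" and \<mu>: "\<mu> \<in> solutions_from \<alpha> \<nu> \<xi>" and t: "max 1 (8 * K) \<le> t"
    note \<xi> = B_rhoD[OF \<xi>B M]
    have sol: "fluid_model_solution \<alpha> \<nu> \<mu>" and \<mu>0: "\<mu> 0 = \<xi>" using \<mu> unfolding solutions_from_def by auto
    have t0: "0 \<le> t" "1 \<le> t" "8 * K \<le> t" using t by auto
    have MF: "\<mu> t \<in> M_F" and null: "measure (\<mu> t) {0} = 0" "measure \<xi> {0} = 0"
      using sol t0 \<mu>0 unfolding fluid_model_solution_def by auto
    define w where "w = pairing (\<lambda>x. x) \<xi>"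
    define b where "b = \<beta> * w"
    have w: "0 \<le> w" "w \<le> M" using \<xi> by (auto simp: w_def)
    have b: "0 \<le> b" "b \<le> \<beta> * M" using w \<beta> by (auto simp: b_def)
    have lim: "emeasure (limit_state \<alpha> \<nu> \<xi>) E = ennreal b * emeasure (excess_lifetime \<alpha> \<nu>) E" for E
      unfolding limit_state_def b_def w_def \<beta>_def by simp
    show "close_measures (\<mu> t) (limit_state \<alpha> \<nu> \<xi>) (C * t powr (-q))"
    proof (cases "w = 0")
      \<comment> \<open>A vanishing mean and no atom at 0 leave only the zero measure; then
        \<open>t_star\<close> is 0, and state and limit both vanish.\<close>
      case True
      interpret F: finite_measure \<xi> by (rule M_F_finite[OF \<xi>(1)])
      have "measure \<xi> {0..} = measure \<xi> ({0} \<union> {0<..})" by (intro arg_cong[where f="measure \<xi>"]) auto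
      also have "\<dots> = measure \<xi> {0} + measure \<xi> {0<..}"
        by (intro F.finite_measure_Union M_F_in_sets[OF \<xi>(1)]) auto
      also have "\<dots> = 0" using null(2) tl_0_eq_0[OF \<xi>(1,3)] True by (simp add: w_def survival_def)
      finally have "pairing (\<lambda>_. 1) (\<mu> 0) = 0" by (simp add: \<mu>0 pairing_one[OF \<xi>(1)])
      then have "t_star \<mu> \<le> ereal 0" unfolding t_star_def by (intro INF_lower) auto
      then have "t_star \<mu> \<le> ereal t" using t0(1) by (meson ereal_less_eq(3) order_trans)
      then have "pairing (\<lambda>_. 1) (\<mu> t) = 0" using sol t0 unfolding fluid_model_solution_def by auto
      then have m0: "measure (\<mu> t) {0..} = 0" by (simp add: pairing_one[OF MF])
      interpret F': finite_measure "\<mu> t" by (rule M_F_finite[OF MF])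
      have "emeasure (\<mu> t) E = 0" if "E \<in> sets borel" "E \<subseteq> {0..}" for E
      proof -
        have "emeasure (\<mu> t) E \<le> emeasure (\<mu> t) {0..}"
          using that by (intro emeasure_mono M_F_in_sets[OF MF]) auto
        then show ?thesis using m0 by (simp add: F'.emeasure_eq_measure)
      qed
      then show ?thesis unfolding close_measures_def lim using True by (simp add: b_def)
    next
      case False
      then have wpos: "0 < pairing (\<lambda>x. x) (\<mu> 0)" using w by (simp add: w_def \<mu>0)
      interpret P: ps_solution \<alpha> \<nu> \<mu> t
        by unfold_locales (use sol t0 never_empty[OF sol _ wpos c(1,3), of t] \<xi>(3) \<mu>0 in auto)
      define d where "d = (\<lambda>v. P.Zr v - b * unit_step v)"
      define g where "g = (\<lambda>v. survival \<xi> v - b * k v)"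
      have ctl: "causal (survival \<xi>)" by (rule causal_survival[OF \<xi>(1)])
      have cg: "causal g" unfolding g_def by (intro causal_diff causal_mult_left ctl causal_k)
      have cbs: "causal (\<lambda>v. b * unit_step v)" by (intro causal_mult_left causal_unit_step)
      have cd: "causal d" unfolding d_def by (intro causal_diff P.causal_Zr cbs)
      have itl: "integrable lborel (survival \<xi>)" and wtl: "(LINT x|lborel. survival \<xi> x) = w"
        using survival_integrable[OF \<xi>(1,3)] by (auto simp: w_def)
      have ibk: "integrable lborel (\<lambda>v. b * k v)" using R.k_integrable by simp
      have ig: "integrable lborel g" unfolding g_def by (intro Bochner_Integration.integrable_diff itl ibk)
      have wk: "b * (LINT x|lborel. k x) = w" using \<beta>(1) by (simp add: b_def mult.assoc mult.commute[of w] flip: mult.assoc)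
      have zero: "(LINT x|lborel. g x) = 0"
        unfolding g_def using Bochner_Integration.integral_diff[OF itl ibk] wtl wk by simp
      have eq: "d x = g x + conv f d x" for x
      proof -
        have "P.Zr x = survival \<xi> x + conv f P.Zr x" by (rule renewal_solution[OF ctl]) (simp add: P.Zr_def \<mu>0)
        moreover have "conv f d x = conv f P.Zr x - b * conv f unit_step x"
          unfolding d_def using conv_diff_right[OF causal_f P.causal_Zr cbs, of x] by (simp add: conv_mult_right)
        ultimately show ?thesis by (simp add: d_def g_def k_def algebra_simps)
      qed
      have ZrK: "P.Zr x \<le> K" for x
      proof -
        have "conv U (survival \<xi>) x \<le> (LINT y|lborel. 5 * \<alpha> * survival \<xi> y)" unfolding conv_def
          by (rule integral_mono[OF conv_integrable[OF causal_U ctl]]) (auto simp: itl survival_nonneg intro: mult_right_mono U_le)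
        also have "\<dots> = 5 * \<alpha> * w" using wtl by simp
        also have "\<dots> \<le> 5 * \<alpha> * M" using w alpha_pos by (intro mult_left_mono) auto
        finally show ?thesis using survival_le[OF \<xi>(1), of x] \<xi>(2) by (simp add: P.Zr_def \<mu>0 K_def)
      qed
      have bM: "0 \<le> \<beta> * M" "0 \<le> \<beta> * M * B" using \<beta> M R.B_nonneg by auto
      have dG: "\<bar>d x\<bar> \<le> G" for x
      proof -
        have "\<bar>d x\<bar> \<le> \<bar>P.Zr x\<bar> + \<bar>b * unit_step x\<bar>" unfolding d_def by (rule abs_triangle_ineq4)
        also have "\<bar>b * unit_step x\<bar> \<le> b" using b by (auto simp: indicator_def)
        also have "\<bar>P.Zr x\<bar> \<le> K" using ZrK[of x] P.Zr_nonneg[of x] by simp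
        finally show ?thesis using b bM M by (simp add: G_def)
      qed
      have gabs: "\<bar>g x\<bar> \<le> survival \<xi> x + b * k x" for x
        unfolding g_def using survival_nonneg[of \<xi> x] mult_nonneg_nonneg[OF b(1) k_nonneg[of x]] by linarith
      have iabs: "integrable lborel (\<lambda>x. \<bar>g x\<bar>)" "integrable lborel (\<lambda>x. survival \<xi> x + b * k x)"
        by (rule integrable_abs[OF ig], rule Bochner_Integration.integrable_add[OF itl ibk])
      have "(LINT x|lborel. \<bar>g x\<bar>) \<le> (LINT x|lborel. survival \<xi> x + b * k x)"
        by (rule integral_mono[OF iabs gabs])
      also have "\<dots> = 2 * w" using Bochner_Integration.integral_add[OF itl ibk] wtl wk by simp
      finally have gG: "(LINT x|lborel. \<bar>g x\<bar>) \<le> G" using w bM K by (simp add: G_def)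
      have tlt: "tail (survival \<xi>) R \<le> M * R powr (-q)" if "0 < R" for R
        using q M that by (intro tail_survival_le \<xi>) auto
      have gt: "tail (\<lambda>x. \<bar>g x\<bar>) R \<le> G * R powr (-q)" if R: "1 \<le> R" for R
      proof -
        have "tail (\<lambda>x. \<bar>g x\<bar>) R \<le> tail (\<lambda>x. survival \<xi> x + b * k x) R" by (rule tail_mono[OF iabs gabs])
        also have "\<dots> = tail (survival \<xi>) R + b * tail k R"
          unfolding tail_def
          using Bochner_Integration.integral_add[OF integrable_indicator_mult[OF itl] integrable_indicator_mult[OF ibk], of "{R<..}" "{R<..}"]
          by (simp add: algebra_simps)
        also have "\<dots> \<le> M * R powr (-q) + (\<beta> * M) * (B * R powr (-q))"
          using tlt[of R] R R.k_tail_le[OF R] b bM tail_nonneg[of k R] k_nonneg by (intro add_mono mult_mono) auto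
        also have "\<dots> \<le> G * R powr (-q)"
        proof -
          have "M + \<beta> * M * B \<le> G" using K bM M by (simp add: G_def)
          then have "(M + \<beta> * M * B) * R powr (-q) \<le> G * R powr (-q)" by (rule mult_right_mono) simp
          then show ?thesis by (simp add: algebra_simps)
        qed
        finally show ?thesis .
      qed
      define u where "u = P.S t"
      have uK: "t / K \<le> u" unfolding u_def by (rule P.S_ge[OF ZrK K])
      have tK8: "8 \<le> t / K" using t0 K by (simp add: field_simps)
      have u8: "8 \<le> u" using uK tK8 by simp
      have conv: "conv f (\<lambda>x. \<bar>d x\<bar>) u \<le> C1 * u powr (-q)"
      proof -
        have "R.centred G g d" unfolding R.centred_def using cg ig zero cd eq dG gG gt by blast
        then show ?thesis using C1(2) u8 by blast
      qed
      have half: "(u / 2) powr (-q) = 2 powr q * u powr (-q)" using u8 by (simp add: powr_divide powr_minus_divide)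
      have tlu: "survival \<xi> u \<le> M * (2 powr q * u powr (-q))"
      proof -
        have "1 * survival \<xi> u \<le> (u - u / 2) * survival \<xi> u" using u8 survival_nonneg by (intro mult_right_mono) auto
        also have "\<dots> \<le> tail (survival \<xi>) (u / 2)"
          using u8 by (intro antimono_le_tail itl survival_nonneg survival_anti[OF \<xi>(1)]) auto
        also have "\<dots> \<le> M * (u / 2) powr (-q)" using u8 by (intro tlt) auto
        finally show ?thesis by (simp add: half)
      qed
      have ku: "k u \<le> B * (2 powr q * u powr (-q))"
      proof -
        have "1 * k u \<le> (u / 2) * k u" using u8 k_nonneg by (intro mult_right_mono) auto
        also have "\<dots> = (u / 2) * k (2 * (u / 2))" by simp
        also have "\<dots> \<le> B * (u / 2) powr (-q)" using u8 by (intro R.k_le_powr) auto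
        finally show ?thesis by (simp add: half)
      qed
      have "b * k u \<le> (\<beta> * M) * (B * (2 powr q * u powr (-q)))"
        using b bM ku k_nonneg by (intro mult_mono) auto
      then have "survival \<xi> u + conv f (\<lambda>x. \<bar>d x\<bar>) u + b * k u \<le> C2 * u powr (-q)"
        using tlu conv by (simp add: C2_def algebra_simps)
      also have "\<dots> \<le> C2 * (K powr q * t powr (-q))"
      proof (rule mult_left_mono[OF _ C2])
        have "u powr (-q) \<le> (t / K) powr (-q)" using uK tK8 q by (intro powr_mono2') auto
        also have "\<dots> = K powr q * t powr (-q)" using t0 K by (simp add: powr_divide powr_minus_divide)
        finally show "u powr (-q) \<le> K powr q * t powr (-q)" .
      qed
      also have "\<dots> \<le> C * t powr (-q)" by (simp add: C_def algebra_simps)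
      finally have \<Delta>: "ennreal (survival (\<mu> 0) (P.S t) + conv f (\<lambda>x. \<bar>d x\<bar>) (P.S t) + b * k (P.S t)) \<le> ennreal (C * t powr (-q))"
        by (intro ennreal_leI) (simp add: u_def \<mu>0)
      show ?thesis unfolding close_measures_def
      proof (intro allI impI)
        fix E :: "real set" assume E: "E \<in> sets borel \<and> E \<subseteq> {0..}"
        let ?E = "E \<inter> {0<..}"
        have E': "?E \<in> sets borel" "?E \<subseteq> {0<..}" using E by auto
        have eqs: "emeasure (\<mu> t) E = emeasure (\<mu> t) ?E"
          "emeasure (excess_lifetime \<alpha> \<nu>) E = emeasure (excess_lifetime \<alpha> \<nu>) ?E"
          using E by (auto intro!: emeasure_drop_0 MF null excess_M_F excess_0)
        have dd: "d v = P.Zr v - b * unit_step v" for v by (simp add: d_def)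
        note sb = P.set_bounds[OF b(1) dd E']
        show "emeasure (\<mu> t) E \<le> emeasure (limit_state \<alpha> \<nu> \<xi>) E + ennreal (C * t powr (-q)) \<and>
              emeasure (limit_state \<alpha> \<nu> \<xi>) E \<le> emeasure (\<mu> t) E + ennreal (C * t powr (-q))"
          unfolding lim eqs using sb \<Delta> by (meson add_left_mono order_trans)
      qed
    qed
  qed simp
qed

end

theorem theorem1p3:
  fixes \<alpha> M :: real and \<nu> :: "real measure"
  assumes "critical_data \<alpha> \<nu>" and "M > 0"
  shows "(\<forall>\<epsilon>>0. epairing (\<lambda>x. x powr (2 + \<epsilon>)) \<nu> < \<infinity> \<longrightarrow>
            (\<exists>C>0. \<exists>T>0. \<forall>t\<ge>T.
               (SUP \<xi> \<in> B_rho M \<epsilon>. SUP \<mu> \<in> solutions_from \<alpha> \<nu> \<xi>.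
                  ennreal (rho (\<mu> t) (limit_state \<alpha> \<nu> \<xi>)))
               \<le> ennreal (C * t powr (- \<epsilon> / 4)))) \<and>
         (\<forall>\<epsilon>>0. epairing (\<lambda>x. x powr (3 + \<epsilon>)) \<nu> < \<infinity> \<longrightarrow>
            (\<exists>C>0. \<exists>T>0. \<forall>t\<ge>T.
               (SUP \<xi> \<in> B_TV M \<epsilon>. SUP \<mu> \<in> solutions_from \<alpha> \<nu> \<xi>.
                  ennreal (tv_diff (\<mu> t) (limit_state \<alpha> \<nu> \<xi>)))
               \<le> ennreal (C * t powr (- \<epsilon>))))"
proof (intro conjI allI impI)
  interpret ps_data \<alpha> \<nu> by unfold_locales (rule assms(1))
  have MF: "\<mu> t \<in> M_F" if "\<mu> \<in> solutions_from \<alpha> \<nu> \<xi>" "0 \<le> t" for \<mu> \<xi> t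
    using that unfolding solutions_from_def fluid_model_solution_def by auto
  {
    fix \<epsilon> :: real assume \<epsilon>: "0 < \<epsilon>" and fin: "epairing (\<lambda>x. x powr (2 + \<epsilon>)) \<nu> < \<infinity>"
    obtain C T0 where C: "C > 0" "T0 \<ge> 1" "\<And>\<xi> \<mu> t. \<xi> \<in> B_rho M \<epsilon> \<Longrightarrow> \<mu> \<in> solutions_from \<alpha> \<nu> \<xi> \<Longrightarrow> T0 \<le> t \<Longrightarrow>
       close_measures (\<mu> t) (limit_state \<alpha> \<nu> \<xi>) (C * t powr (-\<epsilon>))"
      using close_limit_state[OF \<epsilon> fin assms(2)] by blast
    have "rho (\<mu> t) (limit_state \<alpha> \<nu> \<xi>) \<le> C * t powr (- \<epsilon> / 4)"
      if "\<xi> \<in> B_rho M \<epsilon>" "\<mu> \<in> solutions_from \<alpha> \<nu> \<xi>" "T0 \<le> t" for \<xi> \<mu> t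
    proof -
      have t: "1 \<le> t" using that C by simp
      have "rho (\<mu> t) (limit_state \<alpha> \<nu> \<xi>) \<le> C * t powr (-\<epsilon>)"
        by (rule rho_le[OF MF[OF that(2)] limit_state_M_F C(3)[OF that]]) (use t C in auto)
      \<comment> \<open>The case \<open>q = \<epsilon>\<close> gives a faster rate, which implies
        the stated one for \<open>t \<ge> 1\<close>.\<close>
      also have "\<dots> \<le> C * t powr (- \<epsilon> / 4)" using t \<epsilon> C by (intro mult_left_mono powr_mono) auto
      finally show ?thesis .
    qed
    then show "\<exists>C>0. \<exists>T>0. \<forall>t\<ge>T. (SUP \<xi> \<in> B_rho M \<epsilon>. SUP \<mu> \<in> solutions_from \<alpha> \<nu> \<xi>.
                  ennreal (rho (\<mu> t) (limit_state \<alpha> \<nu> \<xi>))) \<le> ennreal (C * t powr (- \<epsilon> / 4))"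
      using C by (intro exI[of _ C] conjI exI[of _ T0] allI impI SUP_least ennreal_leI) auto
  }
  {
    fix \<epsilon> :: real assume \<epsilon>: "0 < \<epsilon>" and fin: "epairing (\<lambda>x. x powr (3 + \<epsilon>)) \<nu> < \<infinity>"
    \<comment> \<open>With \<open>q = 1 + \<epsilon>\<close> the moments of orders
      \<open>1 + q\<close> and \<open>2 + q\<close> are the assumed ones of orders
      \<open>2 + \<epsilon>\<close> and \<open>3 + \<epsilon>\<close>.\<close>
    have sub: "\<xi> \<in> B_rho M (1 + \<epsilon>)" if "\<xi> \<in> B_TV M \<epsilon>" for \<xi>
      using that unfolding B_TV_def B_rho_def by (simp add: add.assoc[symmetric])
    have "epairing (\<lambda>x. x powr (2 + (1 + \<epsilon>))) \<nu> < \<infinity>" using fin by (simp add: add.assoc[symmetric])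
    then obtain C T0 where C: "C > 0" "T0 \<ge> 1" "\<And>\<xi> \<mu> t. \<xi> \<in> B_rho M (1 + \<epsilon>) \<Longrightarrow> \<mu> \<in> solutions_from \<alpha> \<nu> \<xi> \<Longrightarrow> T0 \<le> t \<Longrightarrow>
       close_measures (\<mu> t) (limit_state \<alpha> \<nu> \<xi>) (C * t powr (-(1 + \<epsilon>)))"
      using close_limit_state[of "1 + \<epsilon>" M] \<epsilon> assms(2) by (metis add_pos_pos zero_less_one)
    have "tv_diff (\<mu> t) (limit_state \<alpha> \<nu> \<xi>) \<le> 3 * C * t powr (- \<epsilon>)"
      if "\<xi> \<in> B_TV M \<epsilon>" "\<mu> \<in> solutions_from \<alpha> \<nu> \<xi>" "T0 \<le> t" for \<xi> \<mu> t
    proof -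
      have t: "1 \<le> t" using that C by simp
      have "tv_diff (\<mu> t) (limit_state \<alpha> \<nu> \<xi>) \<le> 3 * (C * t powr (-(1 + \<epsilon>)))"
        by (rule tv_diff_le[OF MF[OF that(2)] limit_state_M_F C(3)[OF sub[OF that(1)] that(2,3)]]) (use t C in auto)
      also have "\<dots> \<le> 3 * (C * t powr (- \<epsilon>))" using t \<epsilon> C by (intro mult_left_mono powr_mono) auto
      finally show ?thesis by simp
    qed
    then show "\<exists>C>0. \<exists>T>0. \<forall>t\<ge>T. (SUP \<xi> \<in> B_TV M \<epsilon>. SUP \<mu> \<in> solutions_from \<alpha> \<nu> \<xi>.
                  ennreal (tv_diff (\<mu> t) (limit_state \<alpha> \<nu> \<xi>))) \<le> ennreal (C * t powr (- \<epsilon>))"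
      using C by (intro exI[of _ "3 * C"] conjI exI[of _ T0] allI impI SUP_least ennreal_leI) auto
  }
qed

end
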